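(* Let $L(t)=\cos(t)L_0+\sin(t)L_1\in\mathrm{Sym}(5,\mathbb{R})$, $t\in\mathbb{R}$, be isospectral, where $L_0=\mathrm{diag}(\sqrt{3},\tfrac{1}{\sqrt{3}},0,-\tfrac{1}{\sqrt{3}},-\sqrt{3})$. Up to conjugation by an element $A\in\mathrm{O}(5)$ with $AL_0A^{-1}=L_0$, the matrix $L_1$ is given by one of the following six matrices: $$(1)\ \tfrac{1}{3\sqrt{3}}\begin{pmatrix}0&5&0&2&0\\5&0&4&0&2\\0&4&0&4&0\\2&0&4&0&5\\0&2&0&5&0\end{pmatrix},\quad (2)\ \tfrac{1}{\sqrt{6}}\begin{pmatrix}0&0&0&0&3\sqrt{2}\\0&0&1&0&0\\0&1&0&1&0\\0&0&1&0&0\\3\sqrt{2}&0&0&0&0\end{pmatrix},\quad (3)\ \tfrac{1}{\sqrt{6}}\begin{pmatrix}0&0&3&0&0\\0&0&0&\sqrt{2}&0\\3&0&0&0&3\\0&\sqrt{2}&0&0&0\\0&0&3&0&0\end{pmatrix},$$ $$(4)\ \tfrac{1}{\sqrt{3}}\begin{pmatrix}0&1&0&2&0\\1&0&0&0&2\\0&0&0&0&0\\2&0&0&0&1\\0&2&0&1&0\end{pmatrix},\quad (5)\ \tfrac{1}{\sqrt{3}}\begin{pmatrix}0&\sqrt{3}&0&0&0\\\sqrt{3}&0&0&2&0\\0&0&0&0&0\\0&2&0&0&\sqrt{3}\\0&0&0&\sqrt{3}&0\end{pmatrix},\quad (6)\ \tfrac{1}{\sqrt{3}}\begin{pmatrix}0&0&0&0&3\\0&0&0&1&0\\0&0&0&0&0\\0&1&0&0&0\\3&0&0&0&0\end{pmatrix}.$$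 For these cases (1)--(6), $\dim E$ is given by $3,2,2,1,1$ and $1$, respectively.
   Context: $\mathrm{Sym}(5,\mathbb{R})$ denotes the real symmetric $5\times 5$ matrices. The family $L(t)$ is isospectral if the spectrum of $L(t)$ (with multiplicities) does not depend on $t\in\mathbb{R}$; so here it equals $\{-\sqrt{3},-\tfrac{1}{\sqrt{3}},0,\tfrac{1}{\sqrt{3}},\sqrt{3}\}$ for all $t$, each eigenvalue being simple. The subspace $E$ is $E=\mathrm{span}_{t\in\mathbb{R}}\ker L(t)\subset\mathbb{R}^5$, the linear span of all the kernels $\ker L(t)$, $t\in\mathbb{R}$. *)

theory Defs
  imports "HOL-Analysis.Analysis" "HOL-Computational_Algebra.Polynomial"
begin

definition charpoly :: "real^'n^'n \<Rightarrow> real poly" where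
  "charpoly A = det (\<chi> i j. (if i = j then [:0, 1:] else 0) - [:A $ i $ j:])"

text \<open>The multiset of eigenvalues, counted with algebraic multiplicity. Only real roots of the
  characteristic polynomial are collected; for symmetric matrices these are all of them.\<close>

definition spectrum :: "real^'n^'n \<Rightarrow> real multiset" where
  "spectrum A = proots (charpoly A)"

definition isospectral :: "(real \<Rightarrow> real^'n^'n) \<Rightarrow> bool" where
  "isospectral L \<longleftrightarrow> (\<forall>s t. spectrum (L s) = spectrum (L t))"

definition kernel :: "real^'n^'n \<Rightarrow> (real^'n) set" where
  "kernel A = {v. A *v v = 0}"

definition kernel_span :: "(real \<Rightarrow> real^'n^'n) \<Rightarrow> (real^'n) set" where
  "kernel_span L = span (\<Union>t. kernel (L t))"

definition L0 :: "real^5^5" where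
  "L0 = vector [vector [sqrt 3, 0, 0, 0, 0],
                vector [0, 1 / sqrt 3, 0, 0, 0],
                vector [0, 0, 0, 0, 0],
                vector [0, 0, 0, - (1 / sqrt 3), 0],
                vector [0, 0, 0, 0, - sqrt 3]]"

definition family :: "real^5^5 \<Rightarrow> real \<Rightarrow> real^5^5" where
  "family L1 t = cos t *\<^sub>R L0 + sin t *\<^sub>R L1"

definition conj_fixing_L0 :: "real^5^5 \<Rightarrow> real^5^5 \<Rightarrow> bool" where
  "conj_fixing_L0 L1 M \<longleftrightarrow>
     (\<exists>A. orthogonal_matrix A \<and> A ** L0 ** matrix_inv A = L0 \<and> A ** L1 ** matrix_inv A = M)"

definition M1 :: "real^5^5" where
  "M1 = (1 / (3 * sqrt 3)) *\<^sub>R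
     vector [vector [0, 5, 0, 2, 0],
             vector [5, 0, 4, 0, 2],
             vector [0, 4, 0, 4, 0],
             vector [2, 0, 4, 0, 5],
             vector [0, 2, 0, 5, 0]]"

definition M2 :: "real^5^5" where
  "M2 = (1 / sqrt 6) *\<^sub>R
     vector [vector [0, 0, 0, 0, 3 * sqrt 2],
             vector [0, 0, 1, 0, 0],
             vector [0, 1, 0, 1, 0],
             vector [0, 0, 1, 0, 0],
             vector [3 * sqrt 2, 0, 0, 0, 0]]"

definition M3 :: "real^5^5" where
  "M3 = (1 / sqrt 6) *\<^sub>R
     vector [vector [0, 0, 3, 0, 0],
             vector [0, 0, 0, sqrt 2, 0],
             vector [3, 0, 0, 0, 3],
             vector [0, sqrt 2, 0, 0, 0],
             vector [0, 0, 3, 0, 0]]"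

definition M4 :: "real^5^5" where
  "M4 = (1 / sqrt 3) *\<^sub>R
     vector [vector [0, 1, 0, 2, 0],
             vector [1, 0, 0, 0, 2],
             vector [0, 0, 0, 0, 0],
             vector [2, 0, 0, 0, 1],
             vector [0, 2, 0, 1, 0]]"

definition M5 :: "real^5^5" where
  "M5 = (1 / sqrt 3) *\<^sub>R
     vector [vector [0, sqrt 3, 0, 0, 0],
             vector [sqrt 3, 0, 0, 2, 0],
             vector [0, 0, 0, 0, 0],
             vector [0, 2, 0, 0, sqrt 3],
             vector [0, 0, 0, sqrt 3, 0]]"

definition M6 :: "real^5^5" where
  "M6 = (1 / sqrt 3) *\<^sub>R
     vector [vector [0, 0, 0, 0, 3],
             vector [0, 0, 0, 1, 0],
             vector [0, 0, 0, 0, 0],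
             vector [0, 1, 0, 0, 0],
             vector [3, 0, 0, 0, 0]]"

text \<open>In the index type \<open>5\<close> the numeral \<open>5\<close> equals \<open>0\<close>; the rows and columns are
  nevertheless listed in the order 1, 2, 3, 4, 5.\<close>

lemma vector_5:
  fixes a b c d e :: "'a :: zero"
  shows "(vector [a, b, c, d, e] :: 'a^5) $ 1 = a"
    and "(vector [a, b, c, d, e] :: 'a^5) $ 2 = b"
    and "(vector [a, b, c, d, e] :: 'a^5) $ 3 = c"
    and "(vector [a, b, c, d, e] :: 'a^5) $ 4 = d"
    and "(vector [a, b, c, d, e] :: 'a^5) $ 5 = e"
  by (simp_all add: vector_def)

end

theory Submission
  imports Defs
begin

text \<open>Put \<open>Lam = sqrt 3 L0\<close> and \<open>B = sqrt 3 L1\<close>. Isospectrality means that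
  \<open>det (x - c Lam - s B) = x (x^2 - r) (x^2 - 9 r)\<close> with \<open>r = c^2 + s^2\<close>. The pencil
  \<open>c Lam + s B\<close> is a singular symmetric pencil of rank 4, so its kernel is spanned by a vector
  whose entries are forms of degree 0, 1 or 2 in \<open>c, s\<close> (the minimal index). If \<open>E\<close> is the span
  of the kernels, the pencil maps \<open>E\<close> into its orthogonal complement, and in an orthonormal frame
  adapted to \<open>E\<close> the characteristic polynomial becomes a small system of real equations.
  Degree 2 yields \<open>M1\<close>, degree 1 yields \<open>M2\<close> and \<open>M3\<close>. In degree 0 the third row of \<open>B\<close>
  vanishes, and the remaining four by four problem is transported to three by three matrices with
  singular values 2, 1, 0, yielding \<open>M4\<close>, \<open>M5\<close>, \<open>M6\<close>.\<close>

section \<open>Real forms in two variables\<close>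

text \<open>The factor \<open>sqrt 3\<close> turns the spectrum into 3, 1, 0, -1, -3. Arbitrary c, s
  in place of a cosine and a sine make each condition an identity of binary forms, comparable
  coefficient by coefficient and stable under rotations of (c, s).

  The obstacle is that the ten off-diagonal entries of B obey coupled equations of degree up to
  five. An adapted frame produces a zero block and leaves few unknowns, but it forgets the
  eigenbasis of \<open>Lam\<close>. That basis returns through eigenvectors of the square of
  \<open>Lam\<close>: with h the first-order coefficient of the kernel vector, up to sign, the frame
  computation ends in \<open>Lam (Lam h) = F h\<close> with F = 1 or 9. The eigenspaces for 1 and 9
  are the coordinate planes with indices {2, 4} and {1, 5}, so h has only two entries, and its
  length together with isotropy fixes them up to sign. What then remains free is a choice of signs,
  which is exactly the freedom of conjugating by orthogonal matrices that commute with the diagonal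
  matrix \<open>L0\<close>. The dimensions of E are read off from explicit kernels of the six model
  matrices.\<close>

lemma quadratic_form_coeffs:
  fixes a0 :: real
  assumes "\<And>c s. a0 * c^2 + a1 * (c * s) + a2 * s^2 = 0"
  shows "a0 = 0" "a1 = 0" "a2 = 0"
  using assms[of 1 0] assms[of 0 1] assms[of 1 1] by simp_all

lemma cubic_form_coeffs:
  fixes a0 :: real
  assumes "\<And>c s. a0 * c^3 + a1 * (c^2 * s) + a2 * (c * s^2) + a3 * s^3 = 0"
  shows "a0 = 0" "a1 = 0" "a2 = 0" "a3 = 0"
  using assms[of 1 0] assms[of 0 1] assms[of 1 1] assms[of 1 "-1"] by simp_all

lemma quartic_form_coeffs:
  fixes a0 :: real
  assumes "\<And>c s. a0 * c^4 + a1 * (c^3 * s) + a2 * (c^2 * s^2) + a3 * (c * s^3) + a4 * s^4 = 0"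
  shows "a0 = 0" "a1 = 0" "a2 = 0" "a3 = 0" "a4 = 0"
  using assms[of 1 0] assms[of 0 1] assms[of 1 1] assms[of 1 "-1"] assms[of 1 2] by simp_all

section \<open>Scalar equations for a kernel of degree one\<close>

lemma kernel_line_scalar_aux:
  fixes b g Q K l0 M m :: real
  assumes K: "K > 0" and l0: "l0 \<noteq> 0"
    and Q: "Q^2 = M^2 * K" and b: "b^2 * K = K + l0^2" and g: "g^2 * M = M - 4 * l0^2"
    and e1: "l0 * M - b * Q + 2 * g * Q = 2 * l0 * m"
    and e2: "g^2 * (l0 * M + b * Q) = 2 * l0 * m"
  shows "m = K"
proof -
  have M: "M \<noteq> 0" using g l0 by auto
  have d: "4 * l0^3 = Q * (b * (1 + g^2) - 2 * g)"
    using e1 e2 g by algebra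
  have "16 * l0^6 = M^2 * K * (b * (1 + g^2) - 2 * g)^2"
    using d Q by algebra
  moreover have "16 * l0^4 = M^2 * (1 - g^2)^2"
    using g by algebra
  ultimately have "M^2 * (l0^2 * (1 - g^2)^2) = M^2 * (K * (b * (1 + g^2) - 2 * g)^2)"
    by algebra
  then have "l0^2 * (1 - g^2)^2 = K * (b * (1 + g^2) - 2 * g)^2"
    using M by simp
  \<comment> \<open>Here \<open>l0^2 = K * (b^2 - 1)\<close>, and
    \<open>(b^2 - 1) (1 - g^2)^2 - (b (1 + g^2) - 2 g)^2\<close> equals
    \<open>- (2 g b - (1 + g^2))^2\<close>. So one equation becomes a vanishing real square and ties
    \<open>b\<close> to \<open>g\<close>.\<close>
  then have "K * (2 * g * b - (1 + g^2))^2 = 0"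
    using b by algebra
  then have gb: "2 * g * b = 1 + g^2" using K by simp
  have "l0^2 * (2 * l0 * K) = l0^2 * (g * Q)"
    using d gb b by algebra
  then have gQ: "2 * l0 * K = g * Q" using l0 by simp
  have "M^2 * (g^2 * K) = 4 * l0^2 * K * K"
    using gQ Q by algebra
  then have "K * (g^2 * M^2) = K * (4 * l0^2 * K)" by algebra
  then have "g^2 * M^2 = 4 * l0^2 * K" using K by simp
  then have "M * (g^2 * (M + K)) = M * K" using g by algebra
  then have gMK: "g^2 * (M + K) = K" using M by simp
  have "l0 * (g^2 * M + g^2 * K + K) = l0 * (2 * m)"
    using e2 gQ gb by algebra
  then have "g^2 * M + g^2 * K + K = 2 * m" using l0 by (simp only: mult_cancel_left) simp
  then show ?thesis using gMK by algebra
qed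

lemma orthogonal_in_plane:
  fixes x y u v :: real
  assumes "x * u + y * v = 0" "u^2 + v^2 \<noteq> 0"
  obtains b where "x = - b * v" "y = b * u"
proof -
  define b where "b = (y * u - x * v) / (u^2 + v^2)"
  have b: "b * (u^2 + v^2) = y * u - x * v" using assms(2) by (simp add: b_def)
  have "(u^2 + v^2) * x = (u^2 + v^2) * (- b * v)" "(u^2 + v^2) * y = (u^2 + v^2) * (b * u)"
    using b assms(1) by algebra+
  then have "x = - b * v" "y = b * u" using assms(2) by (metis mult_left_cancel)+
  then show ?thesis by (rule that)
qed

text \<open>In \<open>kernel_line_case\<close> the form \<open>l\<close> is half the trace of a
  symmetric two by two block, \<open>(x, y)\<close> is its traceless part, and \<open>(h, k)\<close>
  couples the block to one further direction. Aligned means that \<open>l\<close> is a multiple of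
  \<open>c\<close>. Coefficients then give three orthogonality relations in the plane, hence three
  factors \<open>b\<close>, \<open>g\<close>, \<open>q\<close>, and
  \<open>kernel_line_scalar_aux\<close> yields \<open>K - F = K\<close>, against
  \<open>F > 0\<close>.\<close>

lemma kernel_line_scalar_aligned:
  fixes l0 x0 x1 y0 y1 h0 h1 k0 k1 K F :: real
  assumes F: "F > 0" and K: "K > 0"
    and c1: "\<And>c s. (c*x0+s*x1)^2 + (c*y0+s*y1)^2 = K*(c^2+s^2) + (c*l0)^2"
    and c2: "\<And>c s. (c*h0+s*h1)^2 + (c*k0+s*k1)^2 = (10-F-K)*(c^2+s^2) - 4*(c*l0)^2"
    and c3: "\<And>c s. (c*l0)*((c*h0+s*h1)^2 + (c*k0+s*k1)^2)
        - ((c*x0+s*x1)*((c*h0+s*h1)^2 - (c*k0+s*k1)^2) + 2*(c*y0+s*y1)*(c*h0+s*h1)*(c*k0+s*k1))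
        = 2*(c*l0)*(K-F)*(c^2+s^2)"
  shows "l0 = 0"
proof (rule ccontr)
  assume l0: "l0 \<noteq> 0"
  define M m where "M = 10 - F - K" and "m = K - F"
  have a1: "x0^2 + y0^2 = K + l0^2" and a3: "x1^2 + y1^2 = K"
    using c1[of 1 0] c1[of 0 1] by (auto simp: algebra_simps)
  have a2: "x0*x1 + y0*y1 = 0"
    using c1[of 1 1] a1 a3 by (simp add: power2_eq_square algebra_simps)
  have b1: "h0^2 + k0^2 = M - 4*l0^2" and b3: "h1^2 + k1^2 = M"
    using c2[of 1 0] c2[of 0 1] by (auto simp: M_def algebra_simps)
  have b2: "h0*h1 + k0*k1 = 0"
    using c2[of 1 1] b1 b3 by (simp add: M_def power2_eq_square algebra_simps)
  have "l0^2 > 0" using l0 by simp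
  then have M: "M > 0" using b1 by (smt (verit) zero_le_power2)
  have "(l0*(h0^2+k0^2) - (x0*(h0^2-k0^2) + 2*y0*h0*k0) - 2*l0*m) * c^3
     + (2*l0*(h0*h1+k0*k1) - (x1*(h0^2-k0^2) + 2*x0*(h0*h1-k0*k1) + 2*y1*h0*k0 + 2*y0*(h0*k1+h1*k0))) * (c^2 * s)
     + (l0*(h1^2+k1^2) - (x0*(h1^2-k1^2) + 2*x1*(h0*h1-k0*k1) + 2*y0*h1*k1 + 2*y1*(h0*k1+h1*k0)) - 2*l0*m) * (c * s^2)
     + (- (x1*(h1^2-k1^2) + 2*y1*h1*k1)) * s^3 = 0" for c s
    using c3[of c s] unfolding m_def by algebra
  note f = cubic_form_coeffs[OF this]
  have s3: "x1*(h1^2-k1^2) + 2*y1*h1*k1 = 0" using f(4) by simp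
  obtain b where x0: "x0 = - b*y1" and y0: "y0 = b*x1"
    using orthogonal_in_plane[of x0 x1 y0 y1] a2 a3 K by auto
  obtain g where h0: "h0 = - g*k1" and k0: "k0 = g*h1"
    using orthogonal_in_plane[of h0 h1 k0 k1] b2 b3 M by auto
  obtain q where q1: "h1^2-k1^2 = - q*y1" and q2: "2*h1*k1 = q*x1"
    using orthogonal_in_plane[of "h1^2-k1^2" x1 "2*h1*k1" y1] s3 a3 K
    by (auto simp: algebra_simps)
  have "m = K"
  proof (rule kernel_line_scalar_aux[OF K l0])
    have "q^2 * K = M^2" using q1 q2 a3 b3 by algebra
    then show "(q*K)^2 = M^2 * K" by algebra
    show "b^2 * K = K + l0^2" using a1 a3 x0 y0 by algebra
    show "g^2 * M = M - 4 * l0^2" using b1 b3 h0 k0 by algebra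
    show "l0 * M - b * (q*K) + 2 * g * (q*K) = 2 * l0 * m"
      using f(3) x0 y0 h0 k0 q1 q2 a3 b3 by algebra
    show "g^2 * (l0 * M + b * (q*K)) = 2 * l0 * m"
      using f(1) x0 y0 h0 k0 q1 q2 a3 b3 by algebra
  qed
  then show False using F by (simp add: m_def)
qed

lemma exists_unit_annihilating:
  fixes a b :: real
  obtains C S where "C^2 + S^2 = 1" "a * C + b * S = 0"
proof (cases "a = 0 \<and> b = 0")
  case True
  then show ?thesis using that[of 1 0] by simp
next
  case False
  define r where "r = sqrt (a^2 + b^2)"
  have "a^2 + b^2 \<noteq> 0" using False by simp
  then have r: "r \<noteq> 0" "r^2 = a^2 + b^2" by (simp_all add: r_def)
  then have "(b / r)^2 + (- a / r)^2 = r^2 / r^2"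
    by (simp only: power_divide power2_minus flip: add_divide_distrib) (simp add: add.commute)
  then have "(b / r)^2 + (- a / r)^2 = 1" using r(1) by simp
  then show ?thesis by (rule that) (simp add: mult.commute)
qed

text \<open>A rotation of \<open>(c, s)\<close> preserves the shape of all three identities and
  makes \<open>l\<close> a multiple of \<open>c\<close>, so the aligned case gives
  \<open>l = 0\<close>. Then \<open>(x, y)\<close> and \<open>(h, k)\<close> run through circles of
  squared radii \<open>K\<close> and \<open>10 - F - K\<close>. The third identity collapses the
  second circle, and \<open>F + K = 10\<close> meets \<open>F * K = 9\<close>.\<close>

lemma kernel_line_scalar:
  fixes l0 l1 x0 x1 y0 y1 h0 h1 k0 k1 K F :: real
  assumes F: "F > 0" and K: "K > 0" and FK: "F * K = 9"
    and c1: "\<And>c s. (c*x0+s*x1)^2 + (c*y0+s*y1)^2 = K*(c^2+s^2) + (c*l0+s*l1)^2"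
    and c2: "\<And>c s. (c*h0+s*h1)^2 + (c*k0+s*k1)^2 = (10-F-K)*(c^2+s^2) - 4*(c*l0+s*l1)^2"
    and c3: "\<And>c s. (c*l0+s*l1)*((c*h0+s*h1)^2 + (c*k0+s*k1)^2)
        - ((c*x0+s*x1)*((c*h0+s*h1)^2 - (c*k0+s*k1)^2) + 2*(c*y0+s*y1)*(c*h0+s*h1)*(c*k0+s*k1))
        = 2*(c*l0+s*l1)*(K-F)*(c^2+s^2)"
  shows "l0 = 0 \<and> l1 = 0 \<and> h0 = 0 \<and> h1 = 0 \<and> k0 = 0 \<and> k1 = 0 \<and> (F = 1 \<or> F = 9)"
proof -
  obtain C S where CS: "C^2 + S^2 = 1" and l: "l0 * C + l1 * S = 0"
    by (rule exists_unit_annihilating)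
  have "l1 * C - l0 * S = 0"
  proof (rule kernel_line_scalar_aligned[OF F K])
    have rot: "(-(c*S)+s*C)^2 + (c*C+s*S)^2 = c^2+s^2" for c s
      using CS by algebra
    have rot': "(-(c*S)+s*C)*z0 + (c*C+s*S)*z1 = c*(z1*C - z0*S) + s*(z0*C+z1*S)" for c s z0 z1
      by algebra
    have rl: "c*(l1*C - l0*S) + s*(l0*C+l1*S) = c*(l1*C - l0*S)" for c s
      using l by algebra
    show "(c*(x1*C - x0*S)+s*(x0*C+x1*S))^2 + (c*(y1*C - y0*S)+s*(y0*C+y1*S))^2
        = K*(c^2+s^2) + (c*(l1*C - l0*S))^2" for c s
      using c1[of "-(c*S)+s*C" "c*C+s*S"] unfolding rot rot' rl .
    show "(c*(h1*C - h0*S)+s*(h0*C+h1*S))^2 + (c*(k1*C - k0*S)+s*(k0*C+k1*S))^2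
        = (10-F-K)*(c^2+s^2) - 4*(c*(l1*C - l0*S))^2" for c s
      using c2[of "-(c*S)+s*C" "c*C+s*S"] unfolding rot rot' rl .
    show "(c*(l1*C - l0*S))*((c*(h1*C - h0*S)+s*(h0*C+h1*S))^2 + (c*(k1*C - k0*S)+s*(k0*C+k1*S))^2)
        - ((c*(x1*C - x0*S)+s*(x0*C+x1*S))*((c*(h1*C - h0*S)+s*(h0*C+h1*S))^2 - (c*(k1*C - k0*S)+s*(k0*C+k1*S))^2)
          + 2*(c*(y1*C - y0*S)+s*(y0*C+y1*S))*(c*(h1*C - h0*S)+s*(h0*C+h1*S))*(c*(k1*C - k0*S)+s*(k0*C+k1*S)))
        = 2*(c*(l1*C - l0*S))*(K-F)*(c^2+s^2)" for c s
      using c3[of "-(c*S)+s*C" "c*C+s*S"] unfolding rot rot' rl .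
  qed
  then have l00: "l0 = 0" and l10: "l1 = 0" using l CS by algebra+
  define M where "M = 10 - F - K"
  have a1: "x0^2 + y0^2 = K" and a3: "x1^2 + y1^2 = K"
    using c1[of 1 0] c1[of 0 1] l00 l10 by (auto simp: algebra_simps)
  have a2: "x0*x1 + y0*y1 = 0"
    using c1[of 1 1] a1 a3 l00 l10 by (simp add: power2_eq_square algebra_simps)
  have b1: "h0^2 + k0^2 = M" and b3: "h1^2 + k1^2 = M"
    using c2[of 1 0] c2[of 0 1] l00 l10 by (auto simp: M_def algebra_simps)
  have b2: "h0*h1 + k0*k1 = 0"
    using c2[of 1 1] b1 b3 l00 l10 by (simp add: M_def power2_eq_square algebra_simps)
  have "(x0*(h0^2-k0^2) + 2*y0*h0*k0) * c^3
     + (x1*(h0^2-k0^2) + 2*x0*(h0*h1-k0*k1) + 2*y1*h0*k0 + 2*y0*(h0*k1+h1*k0)) * (c^2 * s)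
     + (x0*(h1^2-k1^2) + 2*x1*(h0*h1-k0*k1) + 2*y0*h1*k1 + 2*y1*(h0*k1+h1*k0)) * (c * s^2)
     + (x1*(h1^2-k1^2) + 2*y1*h1*k1) * s^3 = 0" for c s
    using c3[of c s] unfolding l00 l10 by algebra
  note f = cubic_form_coeffs[OF this]
  have "M = 0"
  proof (rule ccontr)
    assume M: "M \<noteq> 0"
    obtain e where x1: "x1 = - e*y0" and y1: "y1 = e*x0"
      using orthogonal_in_plane[of x1 x0 y1 y0] a2 a1 K by (auto simp: mult.commute)
    obtain d where h1: "h1 = - d*k0" and k1: "k1 = d*h0"
      using orthogonal_in_plane[of h1 h0 k1 k0] b2 b1 M by (auto simp: mult.commute)
    have "K * e^2 = K * 1" using x1 y1 a1 a3 by algebra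
    then have e: "e^2 = 1" using K by simp
    have "M * d^2 = M * 1" using h1 k1 b1 b3 by algebra
    then have d: "d^2 = 1" using M by simp
    \<comment> \<open>With \<open>X = x + i y\<close> and \<open>H = h + i k\<close>, the third
      identity says that \<open>cnj X * H^2\<close> has real part 0. \<open>X\<close> turns at speed
      \<open>e\<close> and \<open>H^2\<close> at speed \<open>2 d\<close>, where \<open>e\<close>
      and \<open>d\<close> are signs, so the speeds never agree. \<open>Z\<close> is the imaginary
      part at \<open>c = 1\<close>, \<open>s = 0\<close>; both parts vanish there, which forces
      \<open>H = 0\<close>.\<close>
    define Z where "Z = x0*(2*h0*k0) - y0*(h0^2-k0^2)"
    have "(e - 2*d) * Z = 0" using f(2) x1 y1 h1 k1 unfolding Z_def by algebra
    moreover have "e - 2*d \<noteq> 0" using e d by algebra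
    ultimately have "Z = 0" by simp
    then have "K * M^2 = 0" using f(1) a1 b1 unfolding Z_def by algebra
    then show False using K M by simp
  qed
  moreover from this have "(F - 1) * (F - 9) = 0" using FK unfolding M_def by algebra
  ultimately show ?thesis using l00 l10 b1 b3 by auto
qed

section \<open>Scalar equations for a kernel of degree two\<close>

lemma square_le_of_mult_eq:
  fixes U V g :: real
  assumes "U * (1 + g^2) = 2 * g * V"
  shows "U^2 \<le> V^2"
proof -
  have "U^2 * (1+g^2)^2 = V^2 * (2*g)^2" using assms by algebra
  also have "\<dots> \<le> V^2 * (1+g^2)^2"
  proof (rule mult_left_mono)
    have "(1+g^2)^2 - (2*g)^2 = (1-g^2)^2" by algebra
    then show "(2*g)^2 \<le> (1+g^2)^2" by (smt (verit) zero_le_power2)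
  qed simp
  finally show ?thesis
    by (smt (verit) mult_le_cancel_right zero_less_power2 zero_le_power2)
qed

text \<open>Up to sign \<open>g\<close> is the ratio of the lengths of the orthogonal vectors
  \<open>q\<close> and \<open>p\<close>. If \<open>g^2\<close> were not 1, hypothesis
  \<open>b\<close> would kill so many components of \<open>(k, l)\<close> that the difference of the
  \<open>c^2\<close> and \<open>s^2\<close> coefficients of \<open>a\<close> has the strict sign of
  \<open>g^2 - 1\<close>, although it is 0. Once \<open>g^2 = 1\<close>, hypothesis \<open>b\<close>
  leaves only \<open>k = l = 0\<close>.\<close>

lemma kernel_conic_scalar_aligned:
  fixes p1 p2 q1 q2 k0 k1 l0 l1 A D :: real
  assumes A: "A > 0" and D: "D > 0" and nz: "p1*q2 - p2*q1 \<noteq> 0" and orth: "p1*q1 + p2*q2 = 0"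
    and a: "\<And>c s. A*(c^2+s^2)*(p1^2+p2^2+q1^2+q2^2) + D*((c*q1+s*p1)^2+(c*q2+s*p2)^2)
        + (c*k0+s*k1)^2 + (c*l0+s*l1)^2 = 10*(c^2+s^2)"
    and b: "\<And>c s. (c*k0+s*k1)*(A*(c^2+s^2)*(p1^2-p2^2+q1^2-q2^2) + D*((c*q1+s*p1)^2-(c*q2+s*p2)^2))
        + 2*(c*l0+s*l1)*(A*(c^2+s^2)*(p1*p2+q1*q2) + D*((c*q1+s*p1)*(c*q2+s*p2))) = 0"
  shows "k0 = 0 \<and> k1 = 0 \<and> l0 = 0 \<and> l1 = 0 \<and> p1^2+p2^2 = q1^2+q2^2"
proof -
  define r where "r = p1^2+p2^2"
  have r: "r > 0" using nz by (auto simp: r_def sum_power2_gt_zero_iff)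
  obtain g where q1: "q1 = - g*p2" and q2: "q2 = g*p1"
  proof (rule orthogonal_in_plane)
    show "q1 * p1 + q2 * p2 = 0" using orth by (simp add: mult.commute)
    show "p1^2 + p2^2 \<noteq> 0" using r by (simp only: r_def)
  qed
  \<comment> \<open>With \<open>P = p1 + i p2\<close>, the number \<open>U0 + i V0\<close> is
    \<open>(k0 + i l0) * cnj (P^2)\<close>, and likewise for index 1. This expresses the traceless
    block \<open>(k, l)\<close> in axes turned along \<open>p\<close>; the angle doubles because the
    block acts as a quadratic form.\<close>
  define U0 U1 V0 V1 where "U0 = k0*(p1^2-p2^2) + 2*l0*p1*p2" and "U1 = k1*(p1^2-p2^2) + 2*l1*p1*p2"
    and "V0 = l0*(p1^2-p2^2) - 2*k0*p1*p2" and "V1 = l1*(p1^2-p2^2) - 2*k1*p1*p2"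
  note UV = U0_def U1_def V0_def V1_def
  have "(U0*(A*(1-g^2) - D*g^2)) * c^3 + (U1*(A*(1-g^2) - D*g^2) + 2*D*g*V0) * (c^2 * s)
    + (U0*(A*(1-g^2) + D) + 2*D*g*V1) * (c * s^2) + (U1*(A*(1-g^2) + D)) * s^3 = 0" for c s
    using b[of c s] unfolding UV q1 q2 by algebra
  note fb = cubic_form_coeffs[OF this]
  have ra: "(r^3*(A*(1+g^2) + D*g^2) + U0^2+V0^2 - 10*r^2) * c^2 + (2*(U0*U1+V0*V1)) * (c * s)
    + (r^3*(A*(1+g^2) + D) + U1^2+V1^2 - 10*r^2) * s^2 = 0" for c s
    using a[of c s] unfolding UV q1 q2 r_def by algebra
  note fa = quadratic_form_coeffs[OF ra]
  have diff: "r^3*D*(g^2-1) + (U0^2-V1^2) + (V0^2-U1^2) = 0"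
    using fa(1,3) by algebra
  have r3: "r^3*D > 0" using r D by simp
  have g1: "g^2 = 1"
  proof (rule ccontr)
    assume "g^2 \<noteq> 1"
    then consider "g^2 < 1" | "g^2 > 1" by linarith
    then show False
    proof cases
      case 1
      have "A*(1-g^2) + D > 0" using 1 A D by (simp add: add_pos_pos)
      then have U1: "U1 = 0" using fb(4) by simp
      have "U0^2 \<le> V1^2 \<and> V0 = 0"
      proof (cases "U0 = 0")
        case True
        have "g \<noteq> 0" using nz q1 q2 by auto
        then show ?thesis using True U1 fb(2) D by simp
      next
        case False
        then have "A*(1-g^2) - D*g^2 = 0" using fb(1) by simp
        then have "D*(U0*(1+g^2)) = D*(2*g*(-V1))" "D*(g*V0) = 0" using fb(2,3) by algebra+
        then have "U0*(1+g^2) = 2*g*(-V1)" "g * V0 = 0"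
          using D by (metis mult_left_cancel less_irrefl, simp)
        moreover have "g \<noteq> 0" using nz q1 q2 by auto
        ultimately show ?thesis using square_le_of_mult_eq[of U0 g "-V1"] by simp
      qed
      moreover have "r^3*D*(g^2-1) < 0" using r3 1 by (simp add: mult_pos_neg)
      ultimately show False using diff U1 by simp
    next
      case 2
      have g0: "g \<noteq> 0" using nz q1 q2 by auto
      have "A*(g^2-1) > 0" "D*g^2 > 0" using 2 A D g0 by simp_all
      then have "A*(1-g^2) - D*g^2 < 0" by (simp add: algebra_simps)
      then have U0: "U0 = 0" using fb(1) by simp
      then have V1: "V1 = 0" using fb(3) g0 D by simp
      have "U1^2 \<le> V0^2"
      proof (cases "U1 = 0")
        case False
        then have "A*(1-g^2) + D = 0" using fb(4) by simp
        then have "D*(U1*(1+g^2)) = D*(2*g*V0)" using fb(2) by algebra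
        then have "U1*(1+g^2) = 2*g*V0" using D by simp
        then show ?thesis by (rule square_le_of_mult_eq)
      qed simp
      moreover have "r^3*D*(g^2-1) > 0" using r3 2 by simp
      ultimately show False using diff U0 V1 by simp
    qed
  qed
  have "U0 = 0" "U1 = 0" using fb(1,4) g1 D by simp_all
  moreover have "g \<noteq> 0" using g1 by auto
  ultimately have "V0 = 0" "V1 = 0" using fb(2,3) D by simp_all
  have "r^2 * k0 = 0" "r^2 * l0 = 0" "r^2 * k1 = 0" "r^2 * l1 = 0"
    using \<open>U0 = 0\<close> \<open>U1 = 0\<close> \<open>V0 = 0\<close> \<open>V1 = 0\<close> unfolding UV r_def by algebra+
  moreover have "p1^2+p2^2 = q1^2+q2^2" using q1 q2 g1 by algebra
  ultimately show ?thesis using r by simp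
qed

text \<open>The new inner product is \<open>u (C^2 - S^2) + v C S\<close>, half of
  \<open>2 u cos (2 phi) + v sin (2 phi)\<close> for the angle phi of the rotation. It vanishes when
  \<open>2 phi\<close> is the argument of \<open>v - 2 i u\<close>; the complex square root halves
  that angle.\<close>

lemma exists_rotation_orthogonalising:
  fixes p1 p2 q1 q2 :: real
  obtains C S where "C^2 + S^2 = 1"
    "(C*p1 - S*q1)*(C*q1 + S*p1) + (C*p2 - S*q2)*(C*q2 + S*p2) = 0"
proof -
  define u v where "u = p1*q1 + p2*q2" and "v = p1^2+p2^2-q1^2-q2^2"
  define t where "t = Complex v (- 2*u)"
  define z where "z = csqrt (if t = 0 then 1 else t / of_real (cmod t))"
  have nz: "cmod z = 1" unfolding z_def by (simp add: norm_divide)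
  have "z^2 * cnj t = of_real (cmod t)"
  proof (cases "t = 0")
    case False
    then have "z^2 * cnj t = (t * cnj t) / of_real (cmod t)" unfolding z_def by simp
    also have "\<dots> = of_real (cmod t)"
      using False by (simp add: complex_norm_square[symmetric] power2_eq_square)
    finally show ?thesis .
  qed simp
  then have "Im (z^2 * cnj t) = 0" by simp
  then have "u*((Re z)^2 - (Im z)^2) + Re z * Im z * v = 0"
    unfolding t_def by (simp add: power2_eq_square algebra_simps)
  then have "(Re z*p1 - Im z*q1)*(Re z*q1 + Im z*p1) + (Re z*p2 - Im z*q2)*(Re z*q2 + Im z*p2) = 0"
    unfolding u_def v_def by algebra
  moreover have "(Re z)^2 + (Im z)^2 = 1" using nz by (simp add: cmod_def)
  ultimately show ?thesis using that by blast
qed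

lemma kernel_conic_scalar:
  fixes p1 p2 q1 q2 k0 k1 l0 l1 A D :: real
  assumes A: "A > 0" and D: "D > 0" and nz: "p1*q2 - p2*q1 \<noteq> 0"
    and a: "\<And>c s. A*(c^2+s^2)*(p1^2+p2^2+q1^2+q2^2) + D*((c*q1+s*p1)^2+(c*q2+s*p2)^2)
        + (c*k0+s*k1)^2 + (c*l0+s*l1)^2 = 10*(c^2+s^2)"
    and b: "\<And>c s. (c*k0+s*k1)*(A*(c^2+s^2)*(p1^2-p2^2+q1^2-q2^2) + D*((c*q1+s*p1)^2-(c*q2+s*p2)^2))
        + 2*(c*l0+s*l1)*(A*(c^2+s^2)*(p1*p2+q1*q2) + D*((c*q1+s*p1)*(c*q2+s*p2))) = 0"
  shows "k0 = 0" "k1 = 0" "l0 = 0" "l1 = 0" "p1*q1 + p2*q2 = 0" "p1^2+p2^2 = q1^2+q2^2"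
    "(2*A+D)*(p1^2+p2^2) = 10"
proof -
  obtain C S where CS: "C^2 + S^2 = 1"
    and o: "(C*p1 - S*q1)*(C*q1 + S*p1) + (C*p2 - S*q2)*(C*q2 + S*p2) = 0"
    by (rule exists_rotation_orthogonalising)
  have rot: "(c*C-s*S)^2 + (c*S+s*C)^2 = c^2+s^2" for c s
    using CS by algebra
  have rot': "(c*C-s*S)*z0 + (c*S+s*C)*z1 = c*(C*z0 + S*z1) + s*(C*z1-S*z0)" for c s z0 z1
    by algebra
  have inv1: "(C*p1 - S*q1)^2 + (C*p2 - S*q2)^2 + (C*q1 + S*p1)^2 + (C*q2 + S*p2)^2 = p1^2+p2^2+q1^2+q2^2"
    using CS by algebra
  have inv2: "(C*p1 - S*q1)^2 - (C*p2 - S*q2)^2 + (C*q1 + S*p1)^2 - (C*q2 + S*p2)^2 = p1^2-p2^2+q1^2-q2^2"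
    using CS by algebra
  have inv3: "(C*p1 - S*q1)*(C*p2 - S*q2) + (C*q1 + S*p1)*(C*q2 + S*p2) = p1*p2+q1*q2"
    using CS by algebra
  have inv4: "(C*p1 - S*q1)*(C*q2 + S*p2) - (C*p2 - S*q2)*(C*q1 + S*p1) = p1*q2 - p2*q1"
    using CS by algebra
  have *: "C*k0 + S*k1 = 0 \<and> C*k1 - S*k0 = 0 \<and> C*l0 + S*l1 = 0 \<and> C*l1 - S*l0 = 0
    \<and> (C*p1 - S*q1)^2 + (C*p2 - S*q2)^2 = (C*q1 + S*p1)^2 + (C*q2 + S*p2)^2"
  proof (rule kernel_conic_scalar_aligned[OF A D])
    show "(C*p1 - S*q1)*(C*q2 + S*p2) - (C*p2 - S*q2)*(C*q1 + S*p1) \<noteq> 0"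
      using nz inv4 by simp
    show "A*(c^2+s^2)*((C*p1 - S*q1)^2 + (C*p2 - S*q2)^2 + (C*q1 + S*p1)^2 + (C*q2 + S*p2)^2)
        + D*((c*(C*q1 + S*p1)+s*(C*p1 - S*q1))^2+(c*(C*q2 + S*p2)+s*(C*p2 - S*q2))^2)
        + (c*(C*k0 + S*k1)+s*(C*k1 - S*k0))^2 + (c*(C*l0 + S*l1)+s*(C*l1 - S*l0))^2 = 10*(c^2+s^2)" for c s
      using a[of "c*C-s*S" "c*S+s*C"] unfolding rot rot' inv1 .
    show "(c*(C*k0 + S*k1)+s*(C*k1 - S*k0))*(A*(c^2+s^2)*((C*p1 - S*q1)^2 - (C*p2 - S*q2)^2 + (C*q1 + S*p1)^2 - (C*q2 + S*p2)^2)
        + D*((c*(C*q1 + S*p1)+s*(C*p1 - S*q1))^2-(c*(C*q2 + S*p2)+s*(C*p2 - S*q2))^2))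
        + 2*(c*(C*l0 + S*l1)+s*(C*l1 - S*l0))*(A*(c^2+s^2)*((C*p1 - S*q1)*(C*p2 - S*q2) + (C*q1 + S*p1)*(C*q2 + S*p2))
        + D*((c*(C*q1 + S*p1)+s*(C*p1 - S*q1))*(c*(C*q2 + S*p2)+s*(C*p2 - S*q2)))) = 0" for c s
      using b[of "c*C-s*S" "c*S+s*C"] unfolding rot rot' inv2 inv3 .
  qed (rule o)
  show k: "k0 = 0" "k1 = 0" "l0 = 0" "l1 = 0" using * CS by algebra+
  \<comment> \<open>A linear system for the inner product of \<open>p\<close> and \<open>q\<close>
    and the difference of their squared lengths. Its determinant is
    \<open>(C^2 - S^2)^2 + 4 C^2 S^2 = 1\<close>, so being orthogonal of equal length survives
    undoing the rotation.\<close>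
  have eqn: "(C^2-S^2)*(p1^2+p2^2-q1^2-q2^2) = 4*C*S*(p1*q1+p2*q2)"
    "(C^2-S^2)*(p1*q1+p2*q2) = - C*S*(p1^2+p2^2-q1^2-q2^2)"
    using * o by algebra+
  show pq: "p1*q1 + p2*q2 = 0" using eqn CS by algebra
  show eq: "p1^2+p2^2 = q1^2+q2^2" using eqn CS by algebra
  show "(2*A+D)*(p1^2+p2^2) = 10"
    using a[of 1 0] k eq by (simp add: algebra_simps)
qed

text \<open>The origin of the constants in \<open>M1\<close>: \<open>n\<close> is the coefficient
  \<open>\<nu>\<close> of \<open>kernel_conic_case\<close> and \<open>r\<close> a squared length.
  Eliminating \<open>r\<close> leaves \<open>(9 n - 7) (n + 17) = 0\<close>, and the bounds on
  \<open>n\<close> discard -17.\<close>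

lemma minimal_index_two_parameter:
  fixes n r :: real
  assumes n: "-1 < n" "n < 1" and r: "r^2 = 18*(1+n)^2*(1-n)"
    and e: "(1/(1+n) + 1/(2*(1-n))) * r = 10"
  shows "n = 7/9" "r = 32/9"
proof -
  have "r * (3 - n) = 20*(1-n)*(1+n)"
  proof -
    define X where "X = 2*(1+n)*(1-n)"
    have "1/(1+n) + 1/(2*(1-n)) = (3-n) / X"
      using n unfolding X_def by (simp add: divide_simps) algebra
    then have "(3-n) * r = 10 * X"
      using e n unfolding X_def by (simp add: divide_simps)
    then show ?thesis unfolding X_def by algebra
  qed
  then have "((1+n)^2 * (1-n)) * (18 * (3-n)^2) = ((1+n)^2 * (1-n)) * (400*(1-n))"
    using r by algebra
  then have "18 * (3-n)^2 = 400*(1-n)" using n by simp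
  then have "(9*n - 7)*(n + 17) = 0" by algebra
  then show n7: "n = 7/9" using n by auto
  show "r = 32/9" using e unfolding n7 by simp
qed

section \<open>Isospectral four by four pencils\<close>

text \<open>Let \<open>N\<close> have rows \<open>(0, p, q)\<close>, \<open>(r, 0, u)\<close>,
  \<open>(v, w, 0)\<close>. The hypotheses come from requiring that
  \<open>c * diag (2, 1, 0) + s * N\<close> has singular values \<open>2 R\<close>,
  \<open>R\<close>, \<open>0\<close> with \<open>R^2 = c^2 + s^2\<close>: \<open>e1\<close> and
  \<open>e2\<close> are the vanishing determinant, \<open>e3\<close> is the norm of
  \<open>N\<close>, and \<open>e4\<close>, \<open>e5\<close>, \<open>e6\<close> are the coefficients
  of the sum of squared two by two minors.\<close>

lemma singular_three_by_three_pencil: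
  fixes p q r u v w :: real
  assumes e1: "2 * u * w + q * v = 0"
    and e2: "p * u * v + q * r * w = 0"
    and e3: "p^2 + q^2 + r^2 + u^2 + v^2 + w^2 = 5"
    and e4: "4 * u^2 + q^2 + 4 * w^2 + v^2 - 4 * p * r = 8"
    and e5: "q * u * (2 * r+p) + w * v * (2 * p+r) = 0"
    and e6: "(p * r)^2 + (q * r)^2 + (p * u)^2 + (p * v)^2 + (q * v)^2 + (q * w)^2 + (r * w)^2 + (u * v)^2 + (u * w)^2 = 4"
  shows "(q = 0 \<or> v = 0) \<and> (u = 0 \<or> w = 0)"
proof (rule ccontr)
  assume "\<not> ?thesis"
  then have nz: "u \<noteq> 0" "w \<noteq> 0" "q \<noteq> 0" "v \<noteq> 0"
    using e1 by auto
  have rq: "2 * p * u^2 = q^2 * r"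
  proof -
    have "v * (2 * p * u^2) = v * (q^2 * r)" using e1 e2 by algebra
    then show ?thesis using nz by simp
  qed
  show False
  proof (cases "p = 0")
    case True
    then have r0: "r = 0" using rq nz by simp
    have s1: "u^2 + w^2 = 1" and s2: "q^2 + v^2 = 4"
      using e3 e4 True r0 by simp_all
    have s3: "4 * u^2 * w^2 = q^2 * v^2" using e1 by algebra
    have s4: "(q^2 + u^2) * (v^2 + w^2) = 4"
      using e6 unfolding True r0 by (simp add: power_mult_distrib algebra_simps)
    have "(q^2 + u^2 - 1) * (q^2 + u^2 - 4) = 0" using s1 s2 s4 by algebra
    then have "q^2 + u^2 = 1 \<or> q^2 + u^2 = 4" by auto
    then show False
    proof
      assume "q^2 + u^2 = 1"
      then have "3 * (q^2)^2 = 0" using s1 s2 s3 by algebra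
      then show False using nz by simp
    next
      assume "q^2 + u^2 = 4"
      then have "v^2 = u^2" "w^2 = 1 - u^2" "q^2 = 4 - u^2" using s1 s2 by simp_all
      then have "4 * v^2 * (1 - v^2) = (4 - v^2) * v^2" using s3 by simp
      then have "3 * (v^2)^2 = 0" by algebra
      then show False using nz by simp
    qed
  next
    case False
    define S where "S = q^2 + u^2"
    have S: "S > 0" using nz by (simp add: S_def add_pos_pos)
    have V: "v^2 * S = u^2 * (4 * u^2 + q^2)"
    proof -
      have "p * q * u * q^2 * (v^2 * S) = p * q * u * q^2 * (u^2 * (4 * u^2 + q^2))"
        using e1 e5 rq unfolding S_def by algebra
      then show ?thesis using nz False by simp
    qed
    have W: "4 * w^2 * S = q^2 * (4 * u^2 + q^2)"
    proof -
      have "u^2 * (4 * w^2 * S) = u^2 * (q^2 * (4 * u^2 + q^2))"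
        using V e1 by algebra
      then show ?thesis using nz by simp
    qed
    define Y where "Y = 4 * u^2 + q^2"
    have VW: "v^2 + 4 * w^2 = Y"
    proof -
      have "S * (v^2 + 4 * w^2) = S * Y" using V W unfolding S_def Y_def by algebra
      then show ?thesis using S by simp
    qed
    \<comment> \<open>This gives the contradiction: \<open>Y = 4 + 2 p r\<close> exceeds 4, so
      \<open>(q^2 + u^2) (v^2 + w^2) = Y^2 / 4\<close> exceeds 4 as well, while \<open>e6\<close>
      bounds this part of the squared minors by 4.\<close>
    have pr: "p * r > 0"
    proof -
      have "q^2 * (p * r) = 2 * p^2 * u^2" using rq by algebra
      also have "\<dots> > 0" using nz False by simp
      finally show ?thesis using nz by (simp add: zero_less_mult_iff)
    qed
    have Y4: "Y = 4 + 2 * p * r" using e4 VW unfolding Y_def by linarith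
    have "S * (v^2 + w^2) * 4 = Y^2"
      using V W unfolding S_def Y_def by algebra
    then have SV: "4 * ((q^2 + u^2) * (v^2 + w^2)) = Y^2" unfolding S_def by algebra
    have "Y^2 > 16" using Y4 pr power_strict_mono[of 4 Y 2] by simp
    moreover have "(q^2 + u^2) * (v^2 + w^2) = (q * v)^2 + (q * w)^2 + (u * v)^2 + (u * w)^2" by algebra
    ultimately show False using SV e6
      by (smt (verit) zero_le_power2)
  qed
qed

text \<open>The substitution below identifies the traceless symmetric \<open>4 \<times> 4\<close> matrices with the real
  \<open>3 \<times> 3\<close> matrices, acted on by left and right unit quaternions: the diagonal matrix
  \<open>diag (3, 1, -1, -3)\<close> becomes \<open>diag (2, 1, 0)\<close>, and the spectrum becomes the singular values
  \<open>2, 1, 0\<close>.\<close>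

lemma isospectral_four_by_four:
  fixes a b c d e f :: real
  assumes s1: "6 * a^2 + 3 * b^2 + 2 * c^2 = 18"
    and s2: "-2 * a^2 + 2 * d^2 + e^2 = 2"
    and s3: "2 * f^2 - b^2 - 2 * d^2 = -2"
    and t1: "3 * a * b * d + 2 * a * c * e + b * c * f = 0"
    and t2: "-2 * a * b * d - a * c * e + d * e * f = 0"
    and q: "(a * f)^2 + (b * e)^2 + (c * d)^2 - 2 * a * f * b * e - 2 * a * f * c * d - 2 * b * e * c * d = 9"
  shows "(a^2 = 1 \<and> b^2 = 4 \<and> c = 0 \<and> d = 0 \<and> e^2 = 4 \<and> f^2 = 1 \<and> a * b * e * f = 4) \<or>
    (a^2 = 3 \<and> b = 0 \<and> c = 0 \<and> d^2 = 4 \<and> e = 0 \<and> f^2 = 3) \<or>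
    (a = 0 \<and> b = 0 \<and> c^2 = 9 \<and> d^2 = 1 \<and> e = 0 \<and> f = 0)"
proof -
  define p q' r u v w where "p = (d+c)/2" and "q' = (e-b)/2" and "r = (d-c)/2" and "u = (f+a)/2"
    and "v = (e+b)/2" and "w = (f-a)/2"
  note D = this
  have h: "d = p+r" "c = p-r" "e = v+q'" "b = v-q'" "f = u+w" "a = u-w"
    unfolding D by (simp_all add: field_simps)
  have e1: "2 * u * w + q' * v = 0" using s2 s3 unfolding h by (simp add: power2_eq_square algebra_simps)
  have e2: "p * u * v + q' * r * w = 0" using t1 t2 unfolding h by algebra
  have e3: "p^2 + q'^2 + r^2 + u^2 + v^2 + w^2 = 5" using s1 s2 s3 unfolding h by (simp add: power2_eq_square algebra_simps)
  have e4: "4 * u^2 + q'^2 + 4 * w^2 + v^2 - 4 * p * r = 8" using s1 s2 s3 unfolding h by (simp add: power2_eq_square algebra_simps)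
  have e5: "q' * u * (2 * r+p) + w * v * (2 * p+r) = 0" using t1 t2 unfolding h by algebra
  have e6: "(p * r)^2 + (q' * r)^2 + (p * u)^2 + (p * v)^2 + (q' * v)^2 + (q' * w)^2 + (r * w)^2 + (u * v)^2 + (u * w)^2 = 4"
  proof -
    \<comment> \<open>If x, y, z are the singular values of the three by three matrix, the four by
      four matrix has, up to a common sign, the eigenvalues x + y - z, x - y + z, - x + y + z, - x -
      y - z. As in Heron's formula their product depends only on the elementary symmetric functions
      of the squares, and this is the stated identity for the determinant.\<close>
    have "(a * f)^2 + (b * e)^2 + (c * d)^2 - 2 * a * f * b * e - 2 * a * f * c * d - 2 * b * e * c * d =
      (p^2 + q'^2 + r^2 + u^2 + v^2 + w^2)^2 - 4 * ((p * r)^2 + (q' * r)^2 + (p * u)^2 + (p * v)^2 + (q' * v)^2 + (q' * w)^2 + (r * w)^2 + (u * v)^2 + (u * w)^2)"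
      unfolding h by algebra
    then show ?thesis using q e3 by simp
  qed
  \<comment> \<open>The case \<open>q' = u = 0\<close>. Transposing the three by three matrix
    exchanges \<open>p\<close> with \<open>r\<close>, \<open>q'\<close> with \<open>v\<close> and
    \<open>u\<close> with \<open>w\<close>, so the same statement serves
    \<open>v = w = 0\<close>.\<close>
  have hr: "(p^2 = 1 \<and> r = p \<and> w^2 = 3 \<and> v = 0) \<or> (p^2 = 1 \<and> r = - 2 * p \<and> v = 0 \<and> w = 0) \<or> (p^2 = 4 \<and> 2 * r = - p \<and> v = 0 \<and> w = 0)"
    if g: "v^2 + 4 * w^2 - 4 * p * r = 8" "p^2 + r^2 + v^2 + w^2 = 5" "(p * r)^2 + (p * v)^2 + (r * w)^2 = 4" "w * v * (2 * p+r) = 0"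
    for p r v w :: real
  proof -
    consider "v = 0" | "w = 0" | "v \<noteq> 0" "w \<noteq> 0" by auto
    then show ?thesis
    proof cases
      case 1
      have "p^2 + w^2 = 5 - r^2" "r^2 * (p^2 + w^2) = 4"
        using g(2,3) 1 by (simp_all add: algebra_simps power_mult_distrib)
      then have "r^2 * (5 - r^2) = 4" by simp
      then have "(r^2 - 1) * (r^2 - 4) = 0" by (simp add: algebra_simps power2_eq_square)
      then consider "r^2 = 1" | "r^2 = 4" by auto
      then show ?thesis
      proof cases
        case 1
        have "(p - r) * (p + 2 * r) = 0" using g(1,2) \<open>v = 0\<close> 1 by (simp_all add: algebra_simps power2_eq_square)
        then have "p = r \<or> p = - 2 * r" unfolding mult_eq_0_iff by arith
        then consider "p = r" | "p = - 2 * r" by blast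
        then show ?thesis
        proof cases
          case 1
          then have "w^2 = 3" using g(2) \<open>v = 0\<close> \<open>r^2 = 1\<close> by (simp_all add: power_mult_distrib)
          then show ?thesis using 1 \<open>v = 0\<close> \<open>r^2 = 1\<close> by simp
        next
          case 2
          then have "w^2 = 0" "p^2 = 4" using g(2) \<open>v = 0\<close> \<open>r^2 = 1\<close> by (simp_all add: power_mult_distrib)
          then show ?thesis using 2 \<open>v = 0\<close> by simp
        qed
      next
        case 2
        have "(2 * p + r)^2 = 0" using g(1,2) \<open>v = 0\<close> 2 by (simp_all add: algebra_simps power2_eq_square)
        then have "r = - 2 * p" by simp
        moreover from this have "p^2 = 1" using 2 by (simp_all add: power_mult_distrib)
        moreover from calculation have "w^2 = 0" using g(2) \<open>v = 0\<close> 2 by (simp_all add: power_mult_distrib)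
        ultimately show ?thesis using \<open>v = 0\<close> by simp
      qed
    next
      case 2
      have "r^2 + v^2 = 5 - p^2" "p^2 * (r^2 + v^2) = 4"
        using g(2,3) 2 by (simp_all add: algebra_simps power_mult_distrib)
      then have "p^2 * (5 - p^2) = 4" by simp
      then have "(p^2 - 1) * (p^2 - 4) = 0" by (simp add: algebra_simps power2_eq_square)
      then consider "p^2 = 1" | "p^2 = 4" by auto
      then show ?thesis
      proof cases
        case 1
        have "(r + 2 * p)^2 = 0" using g(1,2) \<open>w = 0\<close> 1 by (simp_all add: algebra_simps power2_eq_square)
        then have r: "r = - 2 * p" by simp
        moreover have "v^2 = 0" using r g(2) \<open>w = 0\<close> 1 by (simp_all add: power_mult_distrib)
        ultimately show ?thesis using \<open>w = 0\<close> 1 by simp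
      next
        case 2
        have "(2 * r + p) * (2 * r + 7 * p) = 0" using g(1,2) \<open>w = 0\<close> 2 by (simp_all add: algebra_simps power2_eq_square)
        then have "2 * r = - p \<or> 2 * r = - 7 * p" unfolding mult_eq_0_iff by arith
        then consider "2 * r = - p" | "2 * r = - 7 * p" by blast
        then show ?thesis
        proof cases
          case 1
          then have "p = - 2 * r" by simp
          then have "r^2 = 1" using 2 by (simp_all add: power_mult_distrib)
          then have "v^2 = 0" using g(2) \<open>w = 0\<close> 2 by simp
          then show ?thesis using 1 2 \<open>w = 0\<close> by simp
        next
          case b: 2
          then have "4 * r^2 = 49 * p^2" by algebra
          then have "r^2 = 49" using 2 by simp
          then show ?thesis using g(2) 2 zero_le_power2[of v] zero_le_power2[of w] by linarith
        qed
      qed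
    next
      case 3
      then have r: "r = - 2 * p" using g(4) by simp
      have "w^2 = 1 - p^2" "v^2 = 4 - 4 * p^2" using g(1,2) r by (simp_all add: algebra_simps power2_eq_square)
      moreover have "4 * (p^2)^2 + p^2 * v^2 + 4 * p^2 * w^2 = 4"
        using g(3) r by (simp add: power_mult_distrib power2_eq_square mult_ac)
      ultimately have "4 * (p^2)^2 + p^2 * (4 - 4 * p^2) + 4 * p^2 * (1 - p^2) = 4" by simp
      then have "4 * (p^2 - 1)^2 = 0" by (simp add: algebra_simps power2_eq_square)
      then have "w^2 = 0" using \<open>w^2 = 1 - p^2\<close> by simp
      then show ?thesis using 3 by simp
    qed
  qed
  \<comment> \<open>The alternatives pair up under transposition. The first two lead to the entries
    of \<open>M5\<close> and \<open>M6\<close>, the last two to those of \<open>M4\<close>.\<close>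
  consider "q' = 0" "u = 0" | "w = 0" "v = 0" | "q' = 0" "w = 0" "u \<noteq> 0" "v \<noteq> 0" | "u = 0" "v = 0" "q' \<noteq> 0" "w \<noteq> 0"
    using singular_three_by_three_pencil[OF e1 e2 e3 e4 e5 e6] e1 by fastforce
  then show ?thesis
  proof cases
    case 1
    have "(p^2 = 1 \<and> r = p \<and> w^2 = 3 \<and> v = 0) \<or> (p^2 = 1 \<and> r = - 2 * p \<and> v = 0 \<and> w = 0) \<or> (p^2 = 4 \<and> 2 * r = - p \<and> v = 0 \<and> w = 0)"
      using e3 e4 e5 e6 1 by (intro hr) simp_all
    then show ?thesis
    proof (elim disjE conjE)
      assume "p^2 = 1" "r = p" "w^2 = 3" "v = 0"
      then show ?thesis unfolding h using 1 by (simp add: power_mult_distrib)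
    next
      assume "p^2 = 1" "r = - 2 * p" "v = 0" "w = 0"
      then show ?thesis unfolding h using 1 by (simp add: power_mult_distrib)
    next
      assume "p^2 = 4" "2 * r = - p" "v = 0" "w = 0"
      then have "p = - 2 * r" by simp
      moreover from this have "r^2 = 1" using \<open>p^2 = 4\<close> by (simp_all add: power_mult_distrib)
      ultimately have "p = - 2 * r" "r^2 = 1" by simp_all
      then show ?thesis unfolding h using 1 \<open>v = 0\<close> \<open>w = 0\<close> by (simp add: power_mult_distrib)
    qed
  next
    case 2
    have "(r^2 = 1 \<and> p = r \<and> u^2 = 3 \<and> q' = 0) \<or> (r^2 = 1 \<and> p = - 2 * r \<and> q' = 0 \<and> u = 0) \<or> (r^2 = 4 \<and> 2 * p = - r \<and> q' = 0 \<and> u = 0)"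
      using e3 e4 e5 e6 2 by (intro hr) (simp_all add: algebra_simps)
    then show ?thesis
    proof (elim disjE conjE)
      assume "r^2 = 1" "p = r" "u^2 = 3" "q' = 0"
      then show ?thesis unfolding h using 2 by (simp add: power_mult_distrib)
    next
      assume "r^2 = 1" "p = - 2 * r" "q' = 0" "u = 0"
      then show ?thesis unfolding h using 2 by (simp add: power_mult_distrib)
    next
      assume "r^2 = 4" "2 * p = - r" "q' = 0" "u = 0"
      then have "r = - 2 * p" by simp
      moreover from this have "p^2 = 1" using \<open>r^2 = 4\<close> by (simp_all add: power_mult_distrib)
      ultimately have "r = - 2 * p" "p^2 = 1" by simp_all
      then show ?thesis unfolding h using 2 \<open>q' = 0\<close> \<open>u = 0\<close> by (simp add: power_mult_distrib)
    qed
  next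
    case 3
    have p: "p = 0" using e2 3 by simp
    have x: "4 * u^2 + v^2 = 8" "r^2 + u^2 + v^2 = 5" "u^2 * v^2 = 4"
      using e3 e4 e6 3 p by (simp_all add: power_mult_distrib)
    have "v^2 = 8 - 4 * u^2" using x(1) by simp
    then have "u^2 * (8 - 4 * u^2) = 4" using x(3) by simp
    then have "4 * (u^2 - 1)^2 = 0" by (simp add: algebra_simps power2_eq_square)
    then have u: "u^2 = 1" by simp
    then have v: "v^2 = 4" "r^2 = 0" using x by simp_all
    have "(u * v)^2 = 4" using x(3) by (simp add: power_mult_distrib)
    then show ?thesis unfolding h using 3 p u v by (simp add: power2_eq_square mult.assoc mult.left_commute)
  next
    case 4
    have r: "r = 0" using e2 4 by simp
    have x: "4 * w^2 + q'^2 = 8" "p^2 + w^2 + q'^2 = 5" "w^2 * q'^2 = 4"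
      using e3 e4 e6 4 r by (simp_all add: power_mult_distrib algebra_simps)
    have "q'^2 = 8 - 4 * w^2" using x(1) by simp
    then have "w^2 * (8 - 4 * w^2) = 4" using x(3) by simp
    then have "4 * (w^2 - 1)^2 = 0" by (simp add: algebra_simps power2_eq_square)
    then have w: "w^2 = 1" by simp
    then have v: "q'^2 = 4" "p^2 = 0" using x by simp_all
    have "(w * q')^2 = 4" using x(3) by (simp add: power_mult_distrib)
    then show ?thesis unfolding h using 4 r w v by (simp add: power2_eq_square mult.assoc mult.left_commute)
  qed
qed

section \<open>Characteristic polynomials\<close>

lemma exhaust_5:
  fixes x :: 5
  shows "x = 1 \<or> x = 2 \<or> x = 3 \<or> x = 4 \<or> x = 5"
proof (induct x)
  case (of_int z)
  then have "0 \<le> z" and "z < 5" by simp_all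
  then have "z = 0 \<or> z = 1 \<or> z = 2 \<or> z = 3 \<or> z = 4" by arith
  then show ?case by auto
qed

lemma forall_5: "(\<forall>i::5. P i) \<longleftrightarrow> P 1 \<and> P 2 \<and> P 3 \<and> P 4 \<and> P 5"
  by (metis exhaust_5)

lemma UNIV_5: "UNIV = {1, 2, 3, 4, 5::5}"
  using exhaust_5 by auto

lemma sum_5: "sum f (UNIV::5 set) = f 1 + f 2 + f 3 + f 4 + f 5"
  unfolding UNIV_5 by (simp add: ac_simps)

text \<open>Laplace expansion along row 1, then of each four by four minor along rows 2, 3 against
  rows 4, 5. The complementary two by two minors \<open>m\<close> keep the formula far below the 120
  terms of the permutation sum.\<close>

lemma det_5:
  fixes A :: "real^5^5"
  defines "m \<equiv> \<lambda>i j k l. A$i$k * A$j$l - A$i$l * A$j$k"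
  shows "det A =
    A$1$1 * (m 2 3 2 3 * m 4 5 4 5 - m 2 3 2 4 * m 4 5 3 5 + m 2 3 2 5 * m 4 5 3 4
           + m 2 3 3 4 * m 4 5 2 5 - m 2 3 3 5 * m 4 5 2 4 + m 2 3 4 5 * m 4 5 2 3)
  - A$1$2 * (m 2 3 1 3 * m 4 5 4 5 - m 2 3 1 4 * m 4 5 3 5 + m 2 3 1 5 * m 4 5 3 4
           + m 2 3 3 4 * m 4 5 1 5 - m 2 3 3 5 * m 4 5 1 4 + m 2 3 4 5 * m 4 5 1 3)
  + A$1$3 * (m 2 3 1 2 * m 4 5 4 5 - m 2 3 1 4 * m 4 5 2 5 + m 2 3 1 5 * m 4 5 2 4
           + m 2 3 2 4 * m 4 5 1 5 - m 2 3 2 5 * m 4 5 1 4 + m 2 3 4 5 * m 4 5 1 2)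
  - A$1$4 * (m 2 3 1 2 * m 4 5 3 5 - m 2 3 1 3 * m 4 5 2 5 + m 2 3 1 5 * m 4 5 2 3
           + m 2 3 2 3 * m 4 5 1 5 - m 2 3 2 5 * m 4 5 1 3 + m 2 3 3 5 * m 4 5 1 2)
  + A$1$5 * (m 2 3 1 2 * m 4 5 3 4 - m 2 3 1 3 * m 4 5 2 4 + m 2 3 1 4 * m 4 5 2 3
           + m 2 3 2 3 * m 4 5 1 4 - m 2 3 2 4 * m 4 5 1 3 + m 2 3 3 4 * m 4 5 1 2)"
proof -
  have f1: "finite {2::5, 3, 4, 5}" "1 \<notin> {2::5, 3, 4, 5}"
    by auto
  have f2: "finite {3::5, 4, 5}" "2 \<notin> {3::5, 4, 5}"
    by auto
  have f3: "finite {4::5, 5}" "3 \<notin> {4::5, 5}"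
    by auto
  have f4: "finite {5::5}" "4 \<notin> {5::5}"
    by auto
  show ?thesis
    unfolding det_def UNIV_5
    unfolding sum_over_permutations_insert[OF f1]
    unfolding sum_over_permutations_insert[OF f2]
    unfolding sum_over_permutations_insert[OF f3]
    unfolding sum_over_permutations_insert[OF f4]
    unfolding permutes_sing m_def
    apply (simp add: sign_swap_id permutation_swap_id permutation_compose sign_compose sign_id swap_id_eq)
    apply (simp add: algebra_simps)
    done
qed

lemma poly_det:
  fixes M :: "real poly^'n^'n"
  shows "poly (det M) x = det (\<chi> i j. poly (M $ i $ j) x)"
  by (simp add: det_def poly_sum poly_prod of_int_poly)

lemma poly_charpoly: "poly (charpoly A) x = det (x *\<^sub>R mat 1 - A)"
proof -
  have "(\<chi> i j. poly ((\<chi> i j. (if i = j then [:0, 1:] else 0) - [:A $ i $ j:]) $ i $ j) x) = x *\<^sub>R mat 1 - A"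
    by (simp add: vec_eq_iff mat_def)
  then show ?thesis unfolding charpoly_def poly_det by simp
qed

text \<open>The product belonging to a permutation has degree at most its number of fixed points, so
  only the identity reaches the top degree.\<close>

lemma charpoly_monic:
  fixes A :: "real^'n^'n"
  shows "degree (charpoly A) \<le> CARD('n)" "coeff (charpoly A) CARD('n) = 1"
proof -
  define M :: "real poly^'n^'n" where "M = (\<chi> i j. (if i = j then [:0, 1:] else 0) - [:A $ i $ j:])"
  have M: "M $ i $ j = (if i = j then [:- A $ i $ i, 1:] else [:- A $ i $ j:])" for i j
    by (simp add: M_def)
  have deg: "degree (\<Prod>i\<in>UNIV. M $ i $ p i) \<le> card {i. p i = i}" for p
  proof -
    have "degree (\<Prod>i\<in>UNIV. M $ i $ p i) \<le> (\<Sum>i\<in>UNIV. degree (M $ i $ p i))"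
      using degree_prod_sum_le[of UNIV "\<lambda>i. M $ i $ p i"] by (simp add: o_def)
    also have "\<dots> = (\<Sum>i\<in>UNIV. if p i = i then 1 else 0)"
      by (rule sum.cong) (auto simp: M)
    finally show ?thesis by (simp add: sum.If_cases)
  qed
  have deg_of_int: "degree (of_int k * q) \<le> degree q" for k and q :: "real poly"
    by (simp add: of_int_poly degree_smult_le)
  have ch: "charpoly A = (\<Sum>p\<in>{p. p permutes UNIV}. of_int (sign p) * (\<Prod>i\<in>UNIV. M $ i $ p i))"
    unfolding charpoly_def M_def det_def by simp
  have fp: "card {i. p i = i} \<le> CARD('n)" for p :: "'n \<Rightarrow> 'n"
    by (rule card_mono) auto
  show "degree (charpoly A) \<le> CARD('n)"
    unfolding ch
    by (rule degree_sum_le) (auto intro: order_trans[OF deg_of_int] order_trans[OF deg] fp)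
  have zero: "coeff (of_int (sign p) * (\<Prod>i\<in>UNIV. M $ i $ p i)) CARD('n) = 0" if "p \<noteq> id" for p
  proof (rule coeff_eq_0)
    have "{i. p i = i} \<subset> UNIV" using that by (auto simp: fun_eq_iff)
    then have "card {i. p i = i} < CARD('n)" by (intro psubset_card_mono) auto
    then show "degree (of_int (sign p) * (\<Prod>i\<in>UNIV. M $ i $ p i)) < CARD('n)"
      using deg_of_int[of "sign p" "\<Prod>i\<in>UNIV. M $ i $ p i"] deg[of p] by linarith
  qed
  have "coeff (charpoly A) CARD('n) = (\<Sum>p\<in>{p. p permutes UNIV}. coeff (of_int (sign p) * (\<Prod>i\<in>UNIV. M $ i $ p i)) CARD('n))"
    unfolding ch coeff_sum ..
  also have "\<dots> = (\<Sum>p\<in>{id}. coeff (of_int (sign p) * (\<Prod>i\<in>UNIV. M $ i $ p i)) CARD('n))"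
    by (rule sum.mono_neutral_right) (auto simp: zero permutes_id finite_permutations)
  also have "\<dots> = coeff (\<Prod>i\<in>UNIV. [:- A $ i $ i, 1:]) CARD('n)"
    by (simp add: M sign_id)
  also have "\<dots> = 1"
  proof -
    have "degree (\<Prod>i\<in>UNIV. [:- A $ i $ i, 1:]) = CARD('n)"
      by (subst degree_prod_eq_sum_degree) auto
    then show ?thesis
      using lead_coeff_prod[of "\<lambda>i. [:- A $ i $ i, 1:]" UNIV] by simp
  qed
  finally show "coeff (charpoly A) CARD('n) = 1" .
qed

text \<open>Two monic polynomials of degree n that agree at n points coincide. Since
  \<open>spectrum\<close> collects real roots only, it is the cardinality hypothesis that supplies
  these points.\<close>

lemma charpoly_eq_if_spectrum_eq:
  fixes A B :: "real^'n^'n"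
  assumes "spectrum A = spectrum B" "card (set_mset (spectrum A)) = CARD('n)"
  shows "charpoly A = charpoly B"
proof (rule poly_eqI_degree_lead_coeff[where n = "CARD('n)" and A = "set_mset (spectrum A)"])
  have "charpoly A \<noteq> 0" "charpoly B \<noteq> 0" using charpoly_monic(2) by (metis coeff_0 zero_neq_one)+
  then have "set_mset (spectrum A) = {x. poly (charpoly A) x = 0}"
    "set_mset (spectrum B) = {x. poly (charpoly B) x = 0}"
    by (simp_all add: spectrum_def)
  then show "poly (charpoly A) z = poly (charpoly B) z" if "z \<in> set_mset (spectrum A)" for z
    using that assms(1) by auto
qed (simp_all add: charpoly_monic assms(2))

lemma L0_entries:
  "L0 $ 1 = vector [sqrt 3, 0, 0, 0, 0]" "L0 $ 2 = vector [0, 1 / sqrt 3, 0, 0, 0]"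
  "L0 $ 3 = vector [0, 0, 0, 0, 0]" "L0 $ 4 = vector [0, 0, 0, - (1 / sqrt 3), 0]"
  "L0 $ 5 = vector [0, 0, 0, 0, - sqrt 3]"
  unfolding L0_def by (simp_all only: vector_5)

text \<open>The homogeneous form of isospectrality: \<open>c\<close> and \<open>s\<close> are
  independent, so that both sides can be compared as forms in \<open>c\<close>, \<open>s\<close> and
  as polynomials in \<open>x\<close>.\<close>

definition isospectral_pencil :: "real^5^5 \<Rightarrow> real^5^5 \<Rightarrow> bool" where
  "isospectral_pencil P Q \<longleftrightarrow> (\<forall>x c s. det (x *\<^sub>R mat 1 - c *\<^sub>R P - s *\<^sub>R Q)
      = x * (x^2 - (c^2 + s^2)) * (x^2 - 9 * (c^2 + s^2)))"

lemma isospectral_pencilD: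
  "isospectral_pencil P Q \<Longrightarrow> det (x *\<^sub>R mat 1 - (c *\<^sub>R P + s *\<^sub>R Q))
      = x * (x^2 - (c^2 + s^2)) * (x^2 - 9 * (c^2 + s^2))"
  by (simp add: isospectral_pencil_def diff_diff_eq)

lemma det_scaleR:
  fixes A :: "real^'n^'n"
  shows "det (r *\<^sub>R A) = r ^ CARD('n) * det A"
proof -
  have "r *\<^sub>R A = matrix ((*\<^sub>R) r) ** A"
    by (simp add: vec_eq_iff matrix_def matrix_matrix_mult_def axis_def if_distrib if_distribR sum.delta cong: if_cong)
  then show ?thesis by (simp only: det_mul det_matrix_scaleR)
qed

lemma isospectral_pencil_if_isospectral:
  assumes "isospectral (family L1)"
  shows "isospectral_pencil (sqrt 3 *\<^sub>R L0) (sqrt 3 *\<^sub>R L1)"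
proof -
  have f0: "family L1 0 = L0" by (simp add: family_def)
  have c0: "poly (charpoly L0) x = x * (x^2 - 1/3) * (x^2 - 3)" for x
    unfolding poly_charpoly
    by (simp add: det_5 L0_entries vector_5 mat_def field_simps power2_eq_square)
  define q where "q = sqrt 3"
  have q: "q > 1" "q^2 = 3" by (simp_all add: q_def)
  have "1 / q < 1" "1 / q > 0" using q(1) by simp_all
  then have "q \<noteq> 1 / q" "q \<noteq> - (1 / q)" using q(1) by linarith+
  then have "card {q, 1 / q, 0, - (1 / q), - q} = 5"
    using q(1) by (auto simp: card_insert_if)
  moreover have "poly (charpoly L0) x = (x - q) * (x - 1/q) * x * (x + 1/q) * (x + q)" for x
  proof -
    have q3: "1 / q = q / 3" using q by (simp add: field_simps power2_eq_square)
    have "(x - q) * (x - q/3) * x * (x + q/3) * (x + q) = x * (x^2 - q^2 / 9) * (x^2 - q^2)"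
      by (simp add: field_simps power2_eq_square)
    then show ?thesis unfolding c0 q3 q(2) by (simp only:) simp
  qed
  then have "{x. poly (charpoly L0) x = 0} = {q, 1 / q, 0, - (1 / q), - q}"
    by (auto simp: eq_neg_iff_add_eq_0)
  moreover have "charpoly L0 \<noteq> 0" using charpoly_monic(2) by (metis coeff_0 zero_neq_one)
  then have "set_mset (spectrum L0) = {x. poly (charpoly L0) x = 0}" by (simp add: spectrum_def)
  ultimately have "card (set_mset (spectrum L0)) = CARD(5)" by simp
  then have ch: "charpoly (family L1 t) = charpoly L0" for t
    using charpoly_eq_if_spectrum_eq[of L0 "family L1 t"] assms f0 unfolding isospectral_def by metis
  show ?thesis unfolding isospectral_pencil_def
  proof (intro allI)
    fix x c s :: real
    show "det (x *\<^sub>R mat 1 - c *\<^sub>R (sqrt 3 *\<^sub>R L0) - s *\<^sub>R (sqrt 3 *\<^sub>R L1))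
       = x * (x^2 - (c^2 + s^2)) * (x^2 - 9 * (c^2 + s^2))"
    proof (cases "c = 0 \<and> s = 0")
      case True
      then show ?thesis by (simp add: det_scaleR eval_nat_numeral)
    next
      case False
      define r where "r = sqrt (c^2 + s^2)"
      have r: "r > 0" "r^2 = c^2 + s^2" using False by (simp_all add: r_def sum_power2_gt_zero_iff)
      have "(c / r)^2 + (s / r)^2 = r^2 / r^2"
        by (simp only: power_divide r(2) add_divide_distrib)
      then have "(c / r)^2 + (s / r)^2 = 1" using r(1) by simp
      then obtain t where t: "c / r = cos t" "s / r = sin t" by (rule sincos_total_2pi) auto
      then have cs: "c = r * cos t" "s = r * sin t" using r by (simp_all add: field_simps)
      \<comment> \<open>The pencil minus \<open>x\<close> is a multiple by \<open>k\<close> of the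
        family at angle \<open>t\<close>, with \<open>(r, t)\<close> polar coordinates of
        \<open>(c, s)\<close>. Isospectrality replaces the family at \<open>t\<close> by
        \<open>L0\<close>, so \<open>t\<close> drops out.\<close>
      define k where "k = sqrt 3 * r"
      have k: "k \<noteq> 0" "k^2 = 3 * (c^2+s^2)" using r by (simp_all add: k_def power_mult_distrib)
      have "x *\<^sub>R mat 1 - c *\<^sub>R (sqrt 3 *\<^sub>R L0) - s *\<^sub>R (sqrt 3 *\<^sub>R L1) = k *\<^sub>R ((x / k) *\<^sub>R mat 1 - family L1 t)"
        using k(1) by (simp add: family_def cs k_def algebra_simps)
      then have "det (x *\<^sub>R mat 1 - c *\<^sub>R (sqrt 3 *\<^sub>R L0) - s *\<^sub>R (sqrt 3 *\<^sub>R L1)) = k^5 * poly (charpoly L0) (x / k)"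
        by (simp only: det_scaleR ch[symmetric, of t] poly_charpoly) simp
      also have "\<dots> = x * (x^2 - k^2/3) * (x^2 - 3 * k^2)"
        unfolding c0 using k(1) by (simp add: field_simps eval_nat_numeral)
      also have "\<dots> = x * (x^2 - (c^2 + s^2)) * (x^2 - 9 * (c^2 + s^2))"
        unfolding k(2) by (simp add: field_simps)
      finally show ?thesis .
    qed
  qed
qed

text \<open>The shape for a kernel of degree one: the first two frame vectors span E, and the third
  spans the line onto which the pencil maps E. The constant term of the quartic factors into two
  binary quadratic forms.\<close>

lemma det_block_2_3:
  fixes n1 n2 k11 k12 k13 k22 k23 k33 x :: real
  shows "det (x *\<^sub>R mat 1 - (vector [vector [0, 0, n1, 0, 0], vector [0, 0, n2, 0, 0],
      vector [n1, n2, k11, k12, k13],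
      vector [0, 0, k12, k22, k23], vector [0, 0, k13, k23, k33]] :: real^5^5))
    = x * (x^4 + (- (k11 + k22 + k33)) * x^3
    + (k11 * k22 + k11 * k33 + k22 * k33 - k12^2 - k13^2 - k23^2 - (n1^2 + n2^2)) * x^2
    + ((n1^2 + n2^2) * (k22 + k33) - (k11 * (k22 * k33 - k23^2) - k12^2 * k33 - k13^2 * k22 + 2 * k12 * k13 * k23)) * x
    + (n1^2 + n2^2) * (k23^2 - k22 * k33))"
  by (simp add: det_5 vector_5 mat_def) (simp add: algebra_simps power2_eq_square power3_eq_cube power4_eq_xxxx)

text \<open>The shape for a kernel of degree two: the first three frame vectors span E, which is
  mapped into the plane of the last two. The constant term of the quartic is the Gram determinant of
  the columns \<open>u\<close> and \<open>v\<close>.\<close>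

lemma det_block_3_2:
  fixes u1 u2 u3 v1 v2 v3 k11 k12 k22 x :: real
  shows "det (x *\<^sub>R mat 1 - (vector [vector [0, 0, 0, u1, v1], vector [0, 0, 0, u2, v2],
      vector [0, 0, 0, u3, v3],
      vector [u1, u2, u3, k11, k12], vector [v1, v2, v3, k12, k22]] :: real^5^5))
    = x * (x^4 + (- (k11 + k22)) * x^3
    + (k11 * k22 - k12^2 - (u1^2 + u2^2 + u3^2) - (v1^2 + v2^2 + v3^2)) * x^2
    + (k11 * (v1^2 + v2^2 + v3^2) + k22 * (u1^2 + u2^2 + u3^2) - 2 * k12 * (u1 * v1 + u2 * v2 + u3 * v3)) * x
    + ((u1^2 + u2^2 + u3^2) * (v1^2 + v2^2 + v3^2) - (u1 * v1 + u2 * v2 + u3 * v3)^2))"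
  by (simp add: det_5 vector_5 mat_def) (simp add: algebra_simps power2_eq_square power3_eq_cube power4_eq_xxxx)

section \<open>Orthonormal frames\<close>

lemma isospectral_pencil_conj:
  assumes "isospectral_pencil P Q" "orthogonal_matrix A"
  shows "isospectral_pencil (A ** P ** transpose A) (A ** Q ** transpose A)"
  unfolding isospectral_pencil_def
proof (intro allI)
  fix x c s
  have AA: "A ** transpose A = mat 1" using assms(2) by (simp add: orthogonal_matrix_def)
  have "x *\<^sub>R mat 1 - c *\<^sub>R (A ** P ** transpose A) - s *\<^sub>R (A ** Q ** transpose A)
      = x *\<^sub>R (A ** transpose A) - c *\<^sub>R (A ** P ** transpose A) - s *\<^sub>R (A ** Q ** transpose A)"
    unfolding AA ..
  also have "\<dots> = A ** (x *\<^sub>R mat 1 - c *\<^sub>R P - s *\<^sub>R Q) ** transpose A"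
    by (simp add: matrix_eq matrix_vector_mul_assoc[symmetric] matrix_vector_mult_diff_rdistrib
        matrix_vector_mult_diff_distrib scaleR_matrix_vector_assoc[symmetric] matrix_vector_mult_scaleR)
  finally have "det (x *\<^sub>R mat 1 - c *\<^sub>R (A ** P ** transpose A) - s *\<^sub>R (A ** Q ** transpose A))
      = det A * det (x *\<^sub>R mat 1 - c *\<^sub>R P - s *\<^sub>R Q) * det (transpose A)"
    by (simp only: det_mul)
  also have "\<dots> = det (x *\<^sub>R mat 1 - c *\<^sub>R P - s *\<^sub>R Q)"
  proof -
    have "det A * det (transpose A) = 1" using AA by (simp only: flip: det_mul) simp
    then show ?thesis by (simp add: mult.left_commute mult.commute)
  qed
  finally show "det (x *\<^sub>R mat 1 - c *\<^sub>R (A ** P ** transpose A) - s *\<^sub>R (A ** Q ** transpose A))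
    = x * (x\<^sup>2 - (c\<^sup>2 + s\<^sup>2)) * (x\<^sup>2 - 9 * (c\<^sup>2 + s\<^sup>2))"
    using assms(1) by (simp add: isospectral_pencil_def)
qed

lemma orthonormal_frame:
  fixes g1 g2 g3 g4 g5 :: "real^5"
  assumes "g1 \<bullet> g1 = 1" "g2 \<bullet> g2 = 1" "g3 \<bullet> g3 = 1" "g4 \<bullet> g4 = 1" "g5 \<bullet> g5 = 1"
    "g1 \<bullet> g2 = 0" "g1 \<bullet> g3 = 0" "g1 \<bullet> g4 = 0" "g1 \<bullet> g5 = 0" "g2 \<bullet> g3 = 0"
    "g2 \<bullet> g4 = 0" "g2 \<bullet> g5 = 0" "g3 \<bullet> g4 = 0" "g3 \<bullet> g5 = 0" "g4 \<bullet> g5 = 0"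
  shows "orthogonal_matrix (vector [g1, g2, g3, g4, g5] :: real^5^5)"
  using assms unfolding orthogonal_matrix_orthonormal_rows row_def vec_nth_inverse
  by (simp add: forall_5 vector_5 orthogonal_def norm_eq_1 inner_commute)

lemma conj_entry:
  fixes A S :: "real^'n^'n"
  shows "(A ** S ** transpose A) $ i $ j = A $ i \<bullet> (S *v A $ j)"
proof -
  have "(A ** S ** transpose A) $ i $ j = (\<Sum>k\<in>UNIV. \<Sum>l\<in>UNIV. A $ i $ l * S $ l $ k * A $ j $ k)"
    by (simp add: matrix_matrix_mult_def transpose_def sum_distrib_right)
  also have "\<dots> = (\<Sum>l\<in>UNIV. \<Sum>k\<in>UNIV. A $ i $ l * S $ l $ k * A $ j $ k)"
    by (rule sum.swap)
  also have "\<dots> = A $ i \<bullet> (S *v A $ j)"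
    by (simp add: inner_vec_def matrix_vector_mult_def sum_distrib_left mult.assoc)
  finally show ?thesis .
qed

lemma frame_expansion:
  fixes A :: "real^5^5"
  assumes "orthogonal_matrix A"
  shows "v = (A$1 \<bullet> v) *\<^sub>R A$1 + (A$2 \<bullet> v) *\<^sub>R A$2 + (A$3 \<bullet> v) *\<^sub>R A$3 + (A$4 \<bullet> v) *\<^sub>R A$4 + (A$5 \<bullet> v) *\<^sub>R A$5"
proof -
  have v: "v = transpose A *v (A *v v)"
    using assms by (simp add: matrix_vector_mul_assoc orthogonal_matrix_def)
  have "v $ i = (A$1 \<bullet> v) * A$1$i + (A$2 \<bullet> v) * A$2$i + (A$3 \<bullet> v) * A$3$i + (A$4 \<bullet> v) * A$4$i + (A$5 \<bullet> v) * A$5$i" for i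
    by (subst v, subst (1) matrix_vector_mult_def)
      (simp add: transpose_def sum_5 matrix_vector_mul_component mult.commute)
  then show ?thesis by (simp add: vec_eq_iff)
qed

lemma exists_unit_orthogonal:
  fixes S :: "(real^5) set"
  assumes "finite S" "card S < 5"
  obtains u where "u \<bullet> u = 1" "\<And>v. v \<in> S \<Longrightarrow> v \<bullet> u = 0"
proof -
  have "dim S < DIM(real^5)" using dim_le_card[OF span_superset assms(1)] assms(2) by simp
  then obtain x where x: "x \<noteq> 0" "\<And>y. y \<in> span S \<Longrightarrow> orthogonal x y"
    by (rule orthogonal_to_subspace_exists) blast
  show ?thesis
  proof (rule that[of "x /\<^sub>R norm x"])
    show "(x /\<^sub>R norm x) \<bullet> (x /\<^sub>R norm x) = 1"
      using x(1) by (simp add: dot_square_norm power2_eq_square)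
    show "v \<bullet> (x /\<^sub>R norm x) = 0" if "v \<in> S" for v
      using x(2)[OF span_base[OF that]] by (simp add: orthogonal_def inner_commute)
  qed
qed

lemma quartic_coeffs:
  fixes a b d e R :: real
  assumes "\<And>x. x * (x^4 + a * x^3 + b * x^2 + d * x + e) = x * (x^2 - R) * (x^2 - 9 * R)"
  shows "a = 0" "b = - 10 * R" "d = 0" "e = 9 * R^2"
proof -
  have "(x^4 + a * x^3 + b * x^2 + d * x + e) = (x^2 - R) * (x^2 - 9 * R)" if "x \<noteq> 0" for x
    using assms[of x] that by (simp add: mult.assoc)
  from this[of 1] this[of "-1"] this[of 2] this[of "-2"]
  show "a = 0" "b = - 10 * R" "d = 0" "e = 9 * R^2"
    by (simp_all add: algebra_simps power2_eq_square)
qed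

lemma isospectral_pencil_block_2_3:
  fixes c s :: real
  assumes "isospectral_pencil P Q"
    and "c *\<^sub>R P + s *\<^sub>R Q = vector [vector [0, 0, n1, 0, 0], vector [0, 0, n2, 0, 0],
      vector [n1, n2, k11, k12, k13],
      vector [0, 0, k12, k22, k23], vector [0, 0, k13, k23, k33]]"
  defines "N \<equiv> n1^2 + n2^2"
  shows "k11 + k22 + k33 = 0"
    "k11 * k22 + k11 * k33 + k22 * k33 - k12^2 - k13^2 - k23^2 - N
      = - 10 * (c^2 + s^2)"
    "N * (k22 + k33) - (k11 * (k22 * k33 - k23^2)
      - k12^2 * k33 - k13^2 * k22 + 2 * k12 * k13 * k23) = 0"
    "N * (k23^2 - k22 * k33) = 9 * (c^2 + s^2)^2"
proof -
  have "x * (x^4 + (- (k11 + k22 + k33)) * x^3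
    + (k11 * k22 + k11 * k33 + k22 * k33 - k12^2 - k13^2 - k23^2 - N) * x^2
    + (N * (k22 + k33) - (k11 * (k22 * k33 - k23^2)
      - k12^2 * k33 - k13^2 * k22 + 2 * k12 * k13 * k23)) * x
    + N * (k23^2 - k22 * k33))
    = x * (x^2 - (c^2+s^2)) * (x^2 - 9 * (c^2+s^2))" for x
    using isospectral_pencilD[OF assms(1), of x c s] unfolding assms(2) det_block_2_3 N_def .
  from quartic_coeffs[OF this] show 
    "k11 + k22 + k33 = 0"
    "k11 * k22 + k11 * k33 + k22 * k33 - k12^2 - k13^2 - k23^2 - N
      = - 10 * (c^2 + s^2)"
    "N * (k22 + k33) - (k11 * (k22 * k33 - k23^2)
      - k12^2 * k33 - k13^2 * k22 + 2 * k12 * k13 * k23) = 0"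
    "N * (k23^2 - k22 * k33) = 9 * (c^2 + s^2)^2"
    by simp_all
qed

lemma isospectral_pencil_block_3_2:
  fixes c s :: real
  assumes "isospectral_pencil P Q"
    and "c *\<^sub>R P + s *\<^sub>R Q = vector [vector [0, 0, 0, u1, v1], vector [0, 0, 0, u2, v2],
      vector [0, 0, 0, u3, v3],
      vector [u1, u2, u3, k11, k12], vector [v1, v2, v3, k12, k22]]"
  defines "H11 \<equiv> u1^2 + u2^2 + u3^2"
    and "H12 \<equiv> u1 * v1 + u2 * v2 + u3 * v3"
    and "H22 \<equiv> v1^2 + v2^2 + v3^2"
  shows "k11 + k22 = 0"
    "k11 * k22 - k12^2 - H11 - H22 = - 10 * (c^2 + s^2)"
    "k11 * H22 + k22 * H11 - 2 * k12 * H12 = 0"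
    "H11 * H22 - H12^2 = 9 * (c^2 + s^2)^2"
proof -
  have "x * (x^4 + (- (k11 + k22)) * x^3
    + (k11 * k22 - k12^2 - H11 - H22) * x^2
    + (k11 * H22 + k22 * H11 - 2 * k12 * H12) * x
    + (H11 * H22 - H12^2))
    = x * (x^2 - (c^2+s^2)) * (x^2 - 9 * (c^2+s^2))" for x
    using isospectral_pencilD[OF assms(1), of x c s] unfolding assms(2) det_block_3_2 H11_def H12_def H22_def .
  from quartic_coeffs[OF this] show "k11 + k22 = 0"
    "k11 * k22 - k12^2 - H11 - H22 = - 10 * (c^2 + s^2)"
    "k11 * H22 + k22 * H11 - 2 * k12 * H12 = 0"
    "H11 * H22 - H12^2 = 9 * (c^2 + s^2)^2"
    by simp_all
qed

section \<open>The pencil in the eigenbasis of the diagonal matrix\<close>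

definition Lam :: "real^5^5" where
  "Lam = vector [vector [3, 0, 0, 0, 0], vector [0, 1, 0, 0, 0], vector [0, 0, 0, 0, 0],
     vector [0, 0, 0, -1, 0], vector [0, 0, 0, 0, -3]]"

lemma Lam_entries:
  "Lam $ 1 = vector [3, 0, 0, 0, 0]" "Lam $ 2 = vector [0, 1, 0, 0, 0]"
  "Lam $ 3 = vector [0, 0, 0, 0, 0]" "Lam $ 4 = vector [0, 0, 0, -1, 0]"
  "Lam $ 5 = vector [0, 0, 0, 0, -3]"
  unfolding Lam_def by (simp_all only: vector_5)

lemma vec_eq_5: "(v::'a^5) = w \<longleftrightarrow> v$1 = w$1 \<and> v$2 = w$2 \<and> v$3 = w$3 \<and> v$4 = w$4 \<and> v$5 = w$5"
  by (simp add: vec_eq_iff forall_5)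

lemma Lam_eq_L0: "sqrt 3 *\<^sub>R L0 = Lam"
  by (simp add: vec_eq_5 L0_entries Lam_entries vector_5)

lemma Lam_mult:
  "(Lam *v v) $ 1 = 3 * v$1" "(Lam *v v) $ 2 = v$2" "(Lam *v v) $ 3 = 0"
  "(Lam *v v) $ 4 = - v$4" "(Lam *v v) $ 5 = - 3 * v$5"
  by (simp_all add: matrix_vector_mult_def sum_5 Lam_entries vector_5)

lemma inner_5: "(v::real^5) \<bullet> w = v$1 * w$1 + v$2 * w$2 + v$3 * w$3 + v$4 * w$4 + v$5 * w$5"
  by (simp add: inner_vec_def sum_5)

lemma symmetric_5_eq:
  fixes B :: "real^5^5"
  assumes "transpose B = B"
  shows "B = vector [vector [B$1$1, B$1$2, B$1$3, B$1$4, B$1$5], vector [B$1$2, B$2$2, B$2$3, B$2$4, B$2$5],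
    vector [B$1$3, B$2$3, B$3$3, B$3$4, B$3$5], vector [B$1$4, B$2$4, B$3$4, B$4$4, B$4$5],
    vector [B$1$5, B$2$5, B$3$5, B$4$5, B$5$5]]"
proof -
  have "B $ i $ j = B $ j $ i" for i j
  proof -
    have "B $ i $ j = transpose B $ i $ j" using assms by simp
    then show ?thesis by (simp add: transpose_def)
  qed
  from this[of 2 1] this[of 3 1] this[of 3 2] this[of 4 1] this[of 4 2] this[of 4 3]
    this[of 5 1] this[of 5 2] this[of 5 3] this[of 5 4]
  show ?thesis by (simp add: vec_eq_5 vector_5)
qed

text \<open>Row \<open>i\<close> of \<open>D\<close> is zero, so the determinant is divisible by
  \<open>s\<close>, and the coefficient of \<open>s\<close> is minus the determinant with row
  \<open>i\<close> taken from \<open>B\<close>. Divisibility by \<open>s^2\<close> makes that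
  coefficient vanish.\<close>

lemma det_linear_term_eq_0:
  fixes D B :: "real^'n^'n"
  assumes "D $ i = 0" and "\<And>s. det (D - s *\<^sub>R B) = s^2 * q s" and "continuous (at 0) q"
  shows "det (\<chi> k. if k = i then B $ i else D $ k) = 0"
proof -
  define g where "g s = det (\<chi> k. if k = i then B $ i else D $ k - s *\<^sub>R B $ k)" for s
  have "det (D - s *\<^sub>R B) = - s * g s" for s
  proof -
    have "D - s *\<^sub>R B = (\<chi> k. if k = i then (- s) *s B $ i else D $ k - s *\<^sub>R B $ k)"
      using assms(1) by (simp add: vec_eq_iff)
    then show ?thesis unfolding g_def by (simp only: det_row_mul)
  qed
  then have "- g s = s * q s" if "s \<noteq> 0" for s
    using assms(2)[of s] that unfolding power2_eq_square by (metis minus_mult_commute mult.assoc mult_left_cancel mult_minus_left)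
  then have "eventually (\<lambda>s. s * q s = - g s) (at 0)"
    by (auto simp: eventually_at_filter)
  moreover have "((\<lambda>s. s * q s) \<longlongrightarrow> 0 * q 0) (at 0)"
    using assms(3) by (intro tendsto_intros) (simp add: continuous_at)
  ultimately have "((\<lambda>s. - g s) \<longlongrightarrow> 0) (at 0)"
    using tendsto_cong by fastforce
  moreover have "continuous (at 0) g"
  proof -
    have "isCont (\<lambda>s. (\<chi> k. if k = i then B $ i else D $ k - s *\<^sub>R B $ k) $ j $ k) 0" for j k
      by (cases "j = i") (auto intro!: continuous_intros)
    then show ?thesis
      unfolding g_def det_def by (intro continuous_sum continuous_mult continuous_const continuous_prod)
  qed
  then have "((\<lambda>s. - g s) \<longlongrightarrow> - g 0) (at 0)"
    by (intro tendsto_minus) (simp add: continuous_at)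
  ultimately have "- g 0 = 0" using tendsto_unique[OF trivial_limit_at] by blast
  then show ?thesis by (simp add: g_def cong: if_cong)
qed

text \<open>First-order perturbation: the eigenvalues of \<open>Lam + s B\<close> depend on
  \<open>s^2\<close> only, so their derivatives at 0, the diagonal entries of \<open>B\<close>,
  vanish. At an eigenvalue \<open>x\<close> of \<open>Lam\<close> the linear coefficient is, up to
  sign, one diagonal entry times a nonzero product.\<close>

lemma diagonal_eq_0:
  fixes B :: "real^5^5"
  assumes "isospectral_pencil Lam B"
  shows "B$1$1 = 0" "B$2$2 = 0" "B$3$3 = 0" "B$4$4 = 0" "B$5$5 = 0"
proof -
  have D: "det (x *\<^sub>R mat 1 - Lam - s *\<^sub>R B) = x * (x^2 - (1 + s^2)) * (x^2 - 9 * (1 + s^2))" for x s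
    using isospectral_pencilD[OF assms, of x 1 s] by (simp add: diff_diff_eq)
  have zero: "det (\<chi> k. if k = i then B $ i else (x *\<^sub>R mat 1 - Lam) $ k) = 0"
    if "(x *\<^sub>R mat 1 - Lam) $ i = 0" "x * (x^2 - 1) * (x^2 - 9) = 0" for x i
  proof (rule det_linear_term_eq_0[OF that(1)])
    show "det (x *\<^sub>R mat 1 - Lam - s *\<^sub>R B) = s^2 * (x * (- 9 * (x^2 - 1) - (x^2 - 9) + 9 * s^2))" for s
      using that(2) unfolding D by algebra
    show "continuous (at 0) (\<lambda>s. x * (- 9 * (x^2 - 1) - (x^2 - 9) + 9 * s^2))"
      by (intro continuous_intros)
  qed
  note ev = det_5 mat_def Lam_entries vector_5
  show "B$1$1 = 0" using zero[of 3 1] by (simp add: vec_eq_5 ev)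
  show "B$2$2 = 0" using zero[of 1 2] by (simp add: vec_eq_5 ev)
  show "B$3$3 = 0" using zero[of 0 3] by (simp add: vec_eq_5 ev)
  show "B$4$4 = 0" using zero[of "-1" 4] by (simp add: vec_eq_5 ev)
  show "B$5$5 = 0" using zero[of "-3" 5] by (simp add: vec_eq_5 ev)
qed

text \<open>A Schur complement with respect to the third index. Let T be the inverse of
  \<open>Lam\<close> times \<open>B\<close> on the other four indices, where \<open>Lam\<close> has
  determinant 9. The determinant is \<open>- 9 s^2\<close> times \<open>det (1 + s T)\<close> times
  the sum of \<open>(-s)^j * Kj\<close>, where \<open>Kj\<close> is the inner product of
  \<open>h\<close> with \<open>Lam T^j h\<close>; \<open>t2\<close> and \<open>t3\<close> are
  coefficients of \<open>det (1 + s T)\<close>, and T has trace 0. The border is written as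
  \<open>Lam h\<close>, whence the factors 3 and the signs.\<close>

lemma det_bordered:
  fixes a b c d e f h1 h2 h4 h5 s :: real
  defines "K0 \<equiv> 3 * h1^2 + h2^2 - h4^2 - 3 * h5^2"
    and "w1 \<equiv> a * h2 + b * h4 + c * h5" and "w2 \<equiv> a * h1 + d * h4 + e * h5"
    and "w4 \<equiv> b * h1 + d * h2 + f * h5" and "w5 \<equiv> c * h1 + e * h2 + f * h4"
  defines "K1 \<equiv> h1 * w1 + h2 * w2 + h4 * w4 + h5 * w5"
    and "K2 \<equiv> w1^2 / 3 + w2^2 - w4^2 - w5^2 / 3"
    and "K3 \<equiv> 2 * (a * w1 * w2 / 3 - b * w1 * w4 / 3 - c * w1 * w5 / 9 - d * w2 * w4 - e * w2 * w5 / 3 + f * w4 * w5 / 3)"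
    and "t2 \<equiv> - (a^2 / 3 - b^2 / 3 - c^2 / 9 - d^2 - e^2 / 3 + f^2 / 3)"
    and "t3 \<equiv> 2 * (- a * b * d / 3 - a * c * e / 9 + b * c * f / 9 + d * e * f / 3)"
  shows "det (Lam + s *\<^sub>R (vector [vector [0, a, 3 * h1, b, c], vector [a, 0, h2, d, e],
      vector [3 * h1, h2, 0, - h4, - 3 * h5], vector [b, d, - h4, 0, f], vector [c, e, - 3 * h5, f, 0]]))
    = - 9 * (K0 * s^2 - K1 * s^3 + (K2 + t2 * K0) * s^4 - (K3 + t2 * K1 - t3 * K0) * s^5)"
  unfolding K0_def K1_def K2_def K3_def t2_def t3_def w1_def w2_def w4_def w5_def
  by (simp add: det_5 vector_5 Lam_entries, simp add: field_simps eval_nat_numeral)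

section \<open>Conjugation and spans of kernels\<close>

lemma orthogonal_matrix_inv:
  fixes A :: "real^'n^'n"
  assumes "orthogonal_matrix A"
  shows "matrix_inv A = transpose A"
proof -
  have A: "A ** transpose A = mat 1" "transpose A ** A = mat 1"
    using assms by (simp_all add: orthogonal_matrix_def)
  then have "\<exists>A'. A ** A' = mat 1 \<and> A' ** A = mat 1" by blast
  then have "matrix_inv A ** A = mat 1"
    unfolding matrix_inv_def by (rule someI2_ex) simp
  then have "matrix_inv A ** A ** transpose A = transpose A" by simp
  then show ?thesis unfolding matrix_mul_assoc[symmetric] A by simp
qed

text \<open>The diagonal matrix of the signs \<open>e\<close> commutes with the diagonal matrix
  \<open>L0\<close>. As the eigenvalues of \<open>L0\<close> are distinct, there are no other
  orthogonal matrices to choose from.\<close>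

lemma conj_fixing_L0_by_signs:
  fixes L M :: "real^5^5" and e :: "5 \<Rightarrow> real"
  assumes e: "\<And>i. e i * e i = 1" and M: "\<And>i j. e i * L $ i $ j * e j = M $ i $ j"
  shows "conj_fixing_L0 L M"
proof -
  define A :: "real^5^5" where "A = (\<chi> i j. if i = j then e i else 0)"
  have t: "transpose A = A" by (auto simp: A_def transpose_def vec_eq_iff)
  have ent: "(A ** X ** A) $ i $ j = e i * X $ i $ j * e j" for X i j
    by (simp add: matrix_matrix_mult_def A_def if_distrib if_distribR sum.delta sum.delta' cong: if_cong)
  have "(A ** mat 1 ** A) $ i $ j = (mat 1 :: real^5^5) $ i $ j" for i j
    unfolding ent using e by (simp add: mat_def)
  then have AA: "A ** A = mat 1" by (simp add: vec_eq_iff)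
  then have orth: "orthogonal_matrix A" by (simp add: orthogonal_matrix_def t)
  have "L0 $ i $ j = (if i = j then L0 $ i $ i else 0)" for i j
  proof -
    have "\<forall>i j. L0 $ i $ j = (if i = j then L0 $ i $ i else 0)"
      unfolding forall_5 by (simp add: L0_entries vector_5)
    then show ?thesis by blast
  qed
  then have "(A ** L0 ** A) $ i $ j = L0 $ i $ j" for i j
  proof (cases "i = j")
    case True
    then show ?thesis unfolding ent using e[of i] by (simp add: mult.assoc mult.left_commute[of "e j"])
  next
    case False
    then show ?thesis unfolding ent using \<open>\<And>i j. L0 $ i $ j = (if i = j then L0 $ i $ i else 0)\<close>[of i j] by simp
  qed
  then have "A ** L0 ** A = L0" by (simp add: vec_eq_iff)
  moreover have "A ** L ** A = M" by (simp add: vec_eq_iff ent M)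
  ultimately show ?thesis unfolding conj_fixing_L0_def
    using orth unfolding orthogonal_matrix_inv[OF orth] t
    by (intro exI[of _ A]) (simp add: orthogonal_matrix_inv t)
qed

text \<open>One and the same \<open>A\<close> conjugates the families at every \<open>t\<close>, so
  it carries kernel to kernel and hence span to span injectively. The dimensions then need to be
  found for the six model matrices alone.\<close>

lemma dim_kernel_span_conj:
  assumes "conj_fixing_L0 L M"
  shows "dim (kernel_span (family L)) = dim (kernel_span (family M))"
proof -
  obtain A where A': "orthogonal_matrix A" "A ** L0 ** matrix_inv A = L0" "A ** L ** matrix_inv A = M"
    using assms unfolding conj_fixing_L0_def by blast
  note A = A'[unfolded orthogonal_matrix_inv[OF A'(1)]]
  have AA: "transpose A ** A = mat 1" "A ** transpose A = mat 1"
    using A(1) by (simp_all add: orthogonal_matrix_def)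
  have fam: "family M t = A ** family L t ** transpose A" for t
  proof -
    have "A ** family L t ** transpose A = cos t *\<^sub>R (A ** L0 ** transpose A) + sin t *\<^sub>R (A ** L ** transpose A)"
      by (simp add: family_def matrix_eq matrix_vector_mul_assoc[symmetric] matrix_vector_mult_add_rdistrib
          matrix_vector_right_distrib scaleR_matrix_vector_assoc[symmetric] matrix_vector_mult_scaleR)
    then show ?thesis unfolding A(2,3) family_def by simp
  qed
  have "kernel (family M t) = (*v) A ` kernel (family L t)" for t
  proof (intro equalityI subsetI)
    fix v assume "v \<in> kernel (family M t)"
    then have "transpose A *v ((A ** family L t ** transpose A) *v v) = 0"
      by (simp add: kernel_def fam)
    then have "family L t *v (transpose A *v v) = 0"
      by (simp only: matrix_vector_mul_assoc matrix_mul_assoc AA matrix_mul_lid)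
    moreover have "v = A *v (transpose A *v v)"
      by (simp only: matrix_vector_mul_assoc AA matrix_vector_mul_lid)
    ultimately show "v \<in> (*v) A ` kernel (family L t)" by (auto simp: kernel_def)
  next
    fix v assume "v \<in> (*v) A ` kernel (family L t)"
    then obtain u where u: "v = A *v u" "family L t *v u = 0" by (auto simp: kernel_def)
    have "family M t *v v = A *v (family L t *v ((transpose A ** A) *v u))"
      unfolding fam u(1) by (simp add: matrix_vector_mul_assoc matrix_mul_assoc)
    then show "v \<in> kernel (family M t)" by (simp add: kernel_def AA u(2))
  qed
  then have "(\<Union>t. kernel (family M t)) = (*v) A ` (\<Union>t. kernel (family L t))" by auto
  then have "kernel_span (family M) = (*v) A ` kernel_span (family L)"
    unfolding kernel_span_def by (simp add: linear_span_image)
  moreover have "inj ((*v) A)"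
    using AA(1) by (intro matrix_left_invertible_injective[THEN iffD1]) blast
  ultimately show ?thesis by (simp add: dim_image_eq inj_on_subset)
qed

lemma dim_kernel_spanI:
  assumes "\<And>t. kernel (family M t) \<subseteq> span S" and "\<And>v. v \<in> S \<Longrightarrow> v \<in> kernel_span (family M)"
    and "independent S"
  shows "dim (kernel_span (family M)) = card S"
proof -
  have "kernel_span (family M) = span S"
  proof
    show "kernel_span (family M) \<subseteq> span S"
      unfolding kernel_span_def using assms(1) by (intro span_minimal) auto
    show "span S \<subseteq> kernel_span (family M)"
      unfolding kernel_span_def using assms(2) by (intro span_minimal) (auto simp: kernel_span_def)
  qed
  then show ?thesis using dim_eq_card_independent[OF assms(3)] by (simp add: dim_span)
qed

section \<open>The span of the kernels for the six matrices\<close>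

lemma M_entries:
  "sqrt 3 *\<^sub>R M1 = (1/3) *\<^sub>R vector [vector [0, 5, 0, 2, 0], vector [5, 0, 4, 0, 2], vector [0, 4, 0, 4, 0], vector [2, 0, 4, 0, 5], vector [0, 2, 0, 5, 0]]"
  "sqrt 3 *\<^sub>R M2 = vector [vector [0, 0, 0, 0, 3], vector [0, 0, 1 / sqrt 2, 0, 0], vector [0, 1 / sqrt 2, 0, 1 / sqrt 2, 0], vector [0, 0, 1 / sqrt 2, 0, 0], vector [3, 0, 0, 0, 0]]"
  "sqrt 3 *\<^sub>R M3 = vector [vector [0, 0, 3 / sqrt 2, 0, 0], vector [0, 0, 0, 1, 0], vector [3 / sqrt 2, 0, 0, 0, 3 / sqrt 2], vector [0, 1, 0, 0, 0], vector [0, 0, 3 / sqrt 2, 0, 0]]"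
  "sqrt 3 *\<^sub>R M4 = vector [vector [0, 1, 0, 2, 0], vector [1, 0, 0, 0, 2], vector [0, 0, 0, 0, 0], vector [2, 0, 0, 0, 1], vector [0, 2, 0, 1, 0]]"
  "sqrt 3 *\<^sub>R M5 = vector [vector [0, sqrt 3, 0, 0, 0], vector [sqrt 3, 0, 0, 2, 0], vector [0, 0, 0, 0, 0], vector [0, 2, 0, 0, sqrt 3], vector [0, 0, 0, sqrt 3, 0]]"
  "sqrt 3 *\<^sub>R M6 = vector [vector [0, 0, 0, 0, 3], vector [0, 0, 0, 1, 0], vector [0, 0, 0, 0, 0], vector [0, 1, 0, 0, 0], vector [3, 0, 0, 0, 0]]"
proof -
  have s6: "sqrt 6 = sqrt 3 * sqrt 2" by (simp flip: real_sqrt_mult)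
  show "sqrt 3 *\<^sub>R M1 = (1/3) *\<^sub>R vector [vector [0, 5, 0, 2, 0], vector [5, 0, 4, 0, 2], vector [0, 4, 0, 4, 0], vector [2, 0, 4, 0, 5], vector [0, 2, 0, 5, 0]]"
    by (simp add: M1_def)
  show "sqrt 3 *\<^sub>R M2 = vector [vector [0, 0, 0, 0, 3], vector [0, 0, 1 / sqrt 2, 0, 0], vector [0, 1 / sqrt 2, 0, 1 / sqrt 2, 0], vector [0, 0, 1 / sqrt 2, 0, 0], vector [3, 0, 0, 0, 0]]"
    by (simp add: M2_def s6 vec_eq_5 vector_5)
  show "sqrt 3 *\<^sub>R M3 = vector [vector [0, 0, 3 / sqrt 2, 0, 0], vector [0, 0, 0, 1, 0], vector [3 / sqrt 2, 0, 0, 0, 3 / sqrt 2], vector [0, 1, 0, 0, 0], vector [0, 0, 3 / sqrt 2, 0, 0]]"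
    by (simp add: M3_def s6 vec_eq_5 vector_5)
qed (simp_all add: M4_def M5_def M6_def vec_eq_5 vector_5)

lemma kernel_family_iff:
  "v \<in> kernel (family L t) \<longleftrightarrow> cos t *\<^sub>R (Lam *v v) + sin t *\<^sub>R ((sqrt 3 *\<^sub>R L) *v v) = 0"
proof -
  have "cos t *\<^sub>R (Lam *v v) + sin t *\<^sub>R ((sqrt 3 *\<^sub>R L) *v v) = sqrt 3 *\<^sub>R (family L t *v v)"
    unfolding Lam_eq_L0[symmetric] family_def
    by (simp add: matrix_vector_mult_add_rdistrib scaleR_matrix_vector_assoc[symmetric] scaleR_add_right mult.commute)
  then show ?thesis by (simp add: kernel_def)
qed

lemma kernel_family_components:
  "(v::real^5) \<in> kernel (family M t) \<longleftrightarrow>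
    (let B = sqrt 3 *\<^sub>R M; w = B *v v in
      3 * cos t * v$1 + sin t * w$1 = 0 \<and> cos t * v$2 + sin t * w$2 = 0 \<and> sin t * w$3 = 0 \<and>
      - cos t * v$4 + sin t * w$4 = 0 \<and> - 3 * cos t * v$5 + sin t * w$5 = 0)"
  unfolding kernel_family_iff Let_def by (simp add: vec_eq_5 Lam_mult mult.commute mult.left_commute)

lemma mult_vec_5: "((A::real^5^5) *v v) $ i = A$i$1 * v$1 + A$i$2 * v$2 + A$i$3 * v$3 + A$i$4 * v$4 + A$i$5 * v$5"
  by (simp add: matrix_vector_mult_def sum_5)

lemma unit_complex_mult_eq_0:
  fixes c s x y :: real
  assumes "c^2 + s^2 = 1" "c * x + s * y = 0" "s * x - c * y = 0"
  shows "x = 0" "y = 0"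
  using assms by algebra+

lemma axis_3_in_kernel_span: "axis 3 1 \<in> kernel_span (family M)"
proof -
  have "axis 3 1 \<in> kernel (family M 0)"
    by (simp add: kernel_family_iff vec_eq_5 Lam_mult axis_def)
  then show ?thesis unfolding kernel_span_def by (intro span_base) blast
qed

lemma dim_kernel_span_1:
  assumes "\<And>t v. v \<in> kernel (family M t) \<Longrightarrow> v$1 = 0 \<and> v$2 = 0 \<and> v$4 = 0 \<and> v$5 = 0"
  shows "dim (kernel_span (family M)) = 1"
proof -
  have "dim (kernel_span (family M)) = card {axis 3 (1::real) :: real^5}"
  proof (rule dim_kernel_spanI)
    show "kernel (family M t) \<subseteq> span {axis 3 1}" for t
    proof
      fix v assume "v \<in> kernel (family M t)"
      then have "v = v$3 *\<^sub>R axis 3 1" using assms by (simp add: vec_eq_5 axis_def)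
      then show "v \<in> span {axis 3 1}" by (metis span_base span_scale singletonI)
    qed
    show "independent {axis 3 (1::real) :: real^5}" by (simp add: axis_eq_0_iff)
  qed (simp add: axis_3_in_kernel_span)
  then show ?thesis by simp
qed

lemma dim_kernel_span_M6: "dim (kernel_span (family M6)) = 1"
proof (rule dim_kernel_span_1)
  fix t and v :: "real^5" assume "v \<in> kernel (family M6 t)"
  then have k: "3 * cos t * v$1 + sin t * (3 * v$5) = 0" "cos t * v$2 + sin t * v$4 = 0"
    "- cos t * v$4 + sin t * v$2 = 0" "- 3 * cos t * v$5 + sin t * (3 * v$1) = 0"
    unfolding kernel_family_components M_entries Let_def by (simp_all add: mult_vec_5 vector_5)
  have "cos t * v$1 + sin t * v$5 = 0" "sin t * v$1 - cos t * v$5 = 0"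
    and "cos t * v$2 + sin t * v$4 = 0" "sin t * v$2 - cos t * v$4 = 0"
    using k by argo+
  then show "v$1 = 0 \<and> v$2 = 0 \<and> v$4 = 0 \<and> v$5 = 0"
    using unit_complex_mult_eq_0[OF sin_cos_squared_add2[of t]] by blast
qed

lemma dim_kernel_span_M4: "dim (kernel_span (family M4)) = 1"
proof (rule dim_kernel_span_1)
  fix t and v :: "real^5" assume "v \<in> kernel (family M4 t)"
  then have k: "3 * cos t * v$1 + sin t * (v$2 + 2 * v$4) = 0" "cos t * v$2 + sin t * (v$1 + 2 * v$5) = 0"
    "- cos t * v$4 + sin t * (2 * v$1 + v$5) = 0" "- 3 * cos t * v$5 + sin t * (2 * v$2 + v$4) = 0"
    unfolding kernel_family_components M_entries Let_def by (simp_all add: mult_vec_5 vector_5)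
  \<comment> \<open>The linear system for these four coordinates has determinant
    \<open>9 (cos t ^ 2 + sin t ^ 2)^2 = 9\<close>.\<close>
  have "v$1 = 0" "v$2 = 0" "v$4 = 0" "v$5 = 0"
    using k sin_cos_squared_add[of t] by algebra+
  then show "v$1 = 0 \<and> v$2 = 0 \<and> v$4 = 0 \<and> v$5 = 0" by simp
qed

lemma dim_kernel_span_M5: "dim (kernel_span (family M5)) = 1"
proof (rule dim_kernel_span_1)
  fix t and v :: "real^5" assume "v \<in> kernel (family M5 t)"
  then have k: "3 * cos t * v$1 + sin t * (sqrt 3 * v$2) = 0" "cos t * v$2 + sin t * (sqrt 3 * v$1 + 2 * v$4) = 0"
    "- cos t * v$4 + sin t * (2 * v$2 + sqrt 3 * v$5) = 0" "- 3 * cos t * v$5 + sin t * (sqrt 3 * v$4) = 0"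
    unfolding kernel_family_components M_entries Let_def by (simp_all add: mult_vec_5 vector_5)
  have q: "sqrt 3 * sqrt 3 = (3::real)" by simp
  \<comment> \<open>Rescaling the outer coordinates clears the root and leaves a system with integer
    coefficients for \<open>algebra\<close>.\<close>
  define a e where "a = sqrt 3 * v$1" and "e = sqrt 3 * v$5"
  have "sqrt 3 * (cos t * a + sin t * v$2) = 0" "sqrt 3 * (- cos t * e + sin t * v$4) = 0"
    using k(1,4) q unfolding a_def e_def by (simp_all add: algebra_simps)
  then have "cos t * a + sin t * v$2 = 0" "- cos t * e + sin t * v$4 = 0" by simp_all
  moreover have "cos t * v$2 + sin t * (a + 2 * v$4) = 0" "- cos t * v$4 + sin t * (2 * v$2 + e) = 0"
    using k(2,3) unfolding a_def e_def .
  ultimately have "a = 0" "v$2 = 0" "v$4 = 0" "e = 0"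
    using sin_cos_squared_add[of t] by algebra+
  then show "v$1 = 0 \<and> v$2 = 0 \<and> v$4 = 0 \<and> v$5 = 0" by (simp add: a_def e_def)
qed

lemma kernel_in_kernel_span: "v \<in> kernel (family M t) \<Longrightarrow> v \<in> kernel_span (family M)"
  unfolding kernel_span_def by (intro span_base) blast

lemma dim_kernel_span_M2: "dim (kernel_span (family M2)) = 2"
proof -
  \<comment> \<open>The kernel at \<open>t\<close> is spanned by \<open>sqrt 2 * cos t\<close> times
    the third axis minus \<open>sin t\<close> times \<open>?w\<close>, so its values at 0 and
    \<open>pi/2\<close> already span E.\<close>
  let ?w = "vector [0, 1, 0, -1, 0] :: real^5"
  have ne: "axis 3 1 \<noteq> ?w" by (simp add: vec_eq_5 vector_5 axis_def)
  have "dim (kernel_span (family M2)) = card {axis 3 1, ?w}"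
  proof (rule dim_kernel_spanI)
    show "kernel (family M2 t) \<subseteq> span {axis 3 1, ?w}" for t
    proof
      fix v assume "v \<in> kernel (family M2 t)"
      then have k: "3 * cos t * v$1 + sin t * (3 * v$5) = 0" "cos t * v$2 + sin t * (v$3 / sqrt 2) = 0"
        "sin t * (v$2 / sqrt 2 + v$4 / sqrt 2) = 0"
        "- cos t * v$4 + sin t * (v$3 / sqrt 2) = 0" "- 3 * cos t * v$5 + sin t * (3 * v$1) = 0"
        unfolding kernel_family_components M_entries Let_def by (simp_all add: mult_vec_5 vector_5)
      have "sin t * (v$2 + v$4) = 0" using k(3) by (simp flip: add_divide_distrib)
      moreover have "cos t * (v$2 + v$4) = 0" using k(2,4) by (simp add: algebra_simps)
      ultimately have o: "v$4 = - v$2"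
        using unit_complex_mult_eq_0[of "cos t" "sin t" "v$2 + v$4" 0] by simp
      have z: "cos t * v$1 + sin t * v$5 = 0" "sin t * v$1 - cos t * v$5 = 0" using k(1,5) by argo+
      have eq: "v = v$3 *\<^sub>R axis 3 1 + v$2 *\<^sub>R ?w" using o unit_complex_mult_eq_0[OF sin_cos_squared_add2 z]
        by (simp add: vec_eq_5 vector_5 axis_def)
      show "v \<in> span {axis 3 1, ?w}"
        by (subst eq, intro span_add span_scale span_base) simp_all
    qed
    have "?w \<in> kernel (family M2 (pi/2))"
      unfolding kernel_family_components M_entries Let_def by (simp_all add: mult_vec_5 vector_5)
    then show "v \<in> kernel_span (family M2)" if "v \<in> {axis 3 1, ?w}" for v
      using that axis_3_in_kernel_span kernel_in_kernel_span by blast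
    show "independent {axis 3 1, ?w}"
      unfolding independent_insert span_singleton using ne by (auto simp: independent_empty vec_eq_5 vector_5 axis_def)
  qed
  then show ?thesis using ne by simp
qed

lemma dim_kernel_span_M3: "dim (kernel_span (family M3)) = 2"
proof -
  let ?w = "vector [1, 0, 0, 0, -1] :: real^5"
  have ne: "axis 3 1 \<noteq> ?w" by (simp add: vec_eq_5 vector_5 axis_def)
  have "dim (kernel_span (family M3)) = card {axis 3 1, ?w}"
  proof (rule dim_kernel_spanI)
    show "kernel (family M3 t) \<subseteq> span {axis 3 1, ?w}" for t
    proof
      fix v assume "v \<in> kernel (family M3 t)"
      then have k: "3 * cos t * v$1 + sin t * (3 * v$3 / sqrt 2) = 0" "cos t * v$2 + sin t * v$4 = 0"
        "sin t * (3 * v$1 / sqrt 2 + 3 * v$5 / sqrt 2) = 0"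
        "- cos t * v$4 + sin t * v$2 = 0" "- 3 * cos t * v$5 + sin t * (3 * v$3 / sqrt 2) = 0"
        unfolding kernel_family_components M_entries Let_def by (simp_all add: mult_vec_5 vector_5)
      have "sin t * (3 * v$1 / sqrt 2 + 3 * v$5 / sqrt 2) = (3 / sqrt 2) * (sin t * (v$1 + v$5))"
        by (simp add: algebra_simps add_divide_distrib)
      then have "sin t * (v$1 + v$5) = 0" using k(3) by simp
      moreover have "3 * (cos t * (v$1 + v$5)) = (3 * cos t * v$1 + sin t * (3 * v$3 / sqrt 2))
          - (- 3 * cos t * v$5 + sin t * (3 * v$3 / sqrt 2))"
        by (simp add: algebra_simps)
      then have "cos t * (v$1 + v$5) = 0" unfolding k(1,5) by simp
      ultimately have o: "v$5 = - v$1"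
        using unit_complex_mult_eq_0[of "cos t" "sin t" "v$1 + v$5" 0] by simp
      have z: "cos t * v$2 + sin t * v$4 = 0" "sin t * v$2 - cos t * v$4 = 0" using k(2,4) by argo+
      have eq: "v = v$3 *\<^sub>R axis 3 1 + v$1 *\<^sub>R ?w" using o unit_complex_mult_eq_0[OF sin_cos_squared_add2 z]
        by (simp add: vec_eq_5 vector_5 axis_def)
      show "v \<in> span {axis 3 1, ?w}"
        by (subst eq, intro span_add span_scale span_base) simp_all
    qed
    have "?w \<in> kernel (family M3 (pi/2))"
      unfolding kernel_family_components M_entries Let_def by (simp_all add: mult_vec_5 vector_5)
    then show "v \<in> kernel_span (family M3)" if "v \<in> {axis 3 1, ?w}" for v
      using that axis_3_in_kernel_span kernel_in_kernel_span by blast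
    show "independent {axis 3 1, ?w}"
      unfolding independent_insert span_singleton using ne by (auto simp: independent_empty vec_eq_5 vector_5 axis_def)
  qed
  then show ?thesis using ne by simp
qed

lemma dim_kernel_span_M1: "dim (kernel_span (family M1)) = 3"
proof -
  let ?u = "vector [0, 1, 0, -1, 0] :: real^5" and ?w = "vector [1, 0, 0, 0, 1] :: real^5"
  have ne: "axis 3 1 \<noteq> ?w" "axis 3 1 \<noteq> ?u" "?u \<noteq> ?w" by (simp_all add: vec_eq_5 vector_5 axis_def)
  have m: "((sqrt 3 *\<^sub>R M1) *v v) $ 1 = (5 * v$2 + 2 * v$4) / 3"
    "((sqrt 3 *\<^sub>R M1) *v v) $ 2 = (5 * v$1 + 4 * v$3 + 2 * v$5) / 3"
    "((sqrt 3 *\<^sub>R M1) *v v) $ 3 = (4 * v$2 + 4 * v$4) / 3"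
    "((sqrt 3 *\<^sub>R M1) *v v) $ 4 = (2 * v$1 + 4 * v$3 + 5 * v$5) / 3"
    "((sqrt 3 *\<^sub>R M1) *v v) $ 5 = (2 * v$2 + 5 * v$4) / 3" for v
    unfolding M_entries by (simp_all add: mult_vec_5 vector_5)
  have "dim (kernel_span (family M1)) = card {axis 3 1, ?u, ?w}"
  proof (rule dim_kernel_spanI)
    show "kernel (family M1 t) \<subseteq> span {axis 3 1, ?u, ?w}" for t
    proof
      fix v assume "v \<in> kernel (family M1 t)"
      note k = this[unfolded kernel_family_components Let_def m]
      \<comment> \<open>\<open>y\<close> and \<open>z\<close> are the linear forms that cut out E.
        The third row, the sum of rows 1 and 5 and the difference of rows 2 and 4 form a closed
        system in them.\<close>
      define c s y z where "c = cos t" and "s = sin t" and "y = v$2 + v$4" and "z = v$1 - v$5"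
      have cs: "c^2 + s^2 = 1" by (simp add: c_def s_def)
      have r: "c * y + s * z = 0" "s * y = 0" "9 * (c * z) + 7 * (s * y) = 0"
        using k unfolding y_def z_def c_def[symmetric] s_def[symmetric]
        by (simp_all add: algebra_simps add_divide_distrib)
      then have "y = 0" "z = 0" using cs by algebra+
      then have eq: "v = v$3 *\<^sub>R axis 3 1 + v$2 *\<^sub>R ?u + v$1 *\<^sub>R ?w"
        unfolding y_def z_def by (simp add: vec_eq_5 vector_5 axis_def)
      show "v \<in> span {axis 3 1, ?u, ?w}"
        by (subst eq, intro span_add span_scale span_base) simp_all
    qed
    have sub: "subspace (kernel_span (family M1))" by (simp add: kernel_span_def)
    \<comment> \<open>The kernel is quadratic in \<open>cos t\<close> and \<open>sin t\<close>, so
      three angles are used: 0, \<open>pi/2\<close> and \<open>pi/4\<close>, all with rational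
      kernel directions.\<close>
    have "vector [4, 0, -7, 0, 4] \<in> kernel (family M1 (pi/2))"
      unfolding kernel_family_components Let_def m by (simp add: vector_5)
    moreover have "?w = (1/4) *\<^sub>R vector [4, 0, -7, 0, 4] + (7/4) *\<^sub>R axis 3 1"
      by (simp add: vec_eq_5 vector_5 axis_def)
    ultimately have w: "?w \<in> kernel_span (family M1)"
      using sub by (metis axis_3_in_kernel_span kernel_in_kernel_span subspace_add subspace_scale)
    have "vector [2, -6, 1, 6, 2] \<in> kernel (family M1 (pi/4))"
      unfolding kernel_family_components Let_def m by (simp add: vector_5 cos_45 sin_45)
    moreover have "?u = (1/3) *\<^sub>R ?w + (1/6) *\<^sub>R axis 3 1 + (-1/6) *\<^sub>R vector [2, -6, 1, 6, 2]"
      by (simp add: vec_eq_5 vector_5 axis_def)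
    ultimately have u: "?u \<in> kernel_span (family M1)"
      using sub w by (metis axis_3_in_kernel_span kernel_in_kernel_span subspace_add subspace_scale)
    show "v \<in> kernel_span (family M1)" if "v \<in> {axis 3 1, ?u, ?w}" for v
      using that u w axis_3_in_kernel_span by blast
    show "independent {axis 3 1, ?u, ?w}"
    proof -
      have "\<not> (\<exists>k l. axis 3 1 = k *\<^sub>R ?u + l *\<^sub>R ?w)" "\<not> (\<exists>l. ?u = l *\<^sub>R ?w)" "?w \<noteq> 0"
        by (simp_all add: vec_eq_5 vector_5 axis_def)
      then show ?thesis using ne
        unfolding independent_insert
        by (auto simp: independent_empty span_insert algebra_simps) 
    qed
  qed
  then show ?thesis using ne by simp
qed

section \<open>The Krylov space of the kernel\<close>

lemma inner_symmetric_matrix: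
  fixes S :: "real^'n^'n"
  assumes "transpose S = S"
  shows "x \<bullet> (S *v y) = (S *v x) \<bullet> y"
  using assms by (metis dot_lmul_matrix transpose_matrix_vector)

lemma transpose_Lam: "transpose Lam = Lam"
  by (simp add: transpose_def vec_eq_5 Lam_entries vector_5)

lemma Lam_axis_3 [simp]: "Lam *v axis 3 1 = 0"
  by (simp add: vec_eq_5 Lam_mult axis_def)

lemma quintic_coeffs:
  fixes a2 a3 a4 a5 :: real
  assumes "\<And>s. a2 * s^2 - a3 * s^3 + a4 * s^4 - a5 * s^5 = 0"
  shows "a2 = 0" "a3 = 0" "a4 = 0" "a5 = 0"
  using assms[of 1] assms[of "-1"] assms[of 2] assms[of "-2"] by simp_all

definition Lam_pinv :: "real^5 \<Rightarrow> real^5" where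
  "Lam_pinv v = vector [v$1 / 3, v$2, 0, - v$4, - v$5 / 3]"

lemma Lam_pinv_nth:
  "Lam_pinv v $ 1 = v$1 / 3" "Lam_pinv v $ 2 = v$2" "Lam_pinv v $ 3 = 0"
  "Lam_pinv v $ 4 = - v$4" "Lam_pinv v $ 5 = - v$5 / 3"
  unfolding Lam_pinv_def by (simp_all add: vector_5)

lemma Lam_Lam_pinv: "v$3 = 0 \<Longrightarrow> Lam *v Lam_pinv v = v"
  by (simp add: vec_eq_5 Lam_mult Lam_pinv_nth)

text \<open>If \<open>w(s)\<close> spans the kernel of \<open>Lam + s B\<close>, then normalising its third coordinate to 1 turns
  \<open>(Lam + s B) w(s) = 0\<close> into a Neumann series in \<open>T = Lam_pinv B\<close>, whose solvability says that the
  Krylov space of \<open>h\<close> under \<open>T\<close> is isotropic for the quadratic form of \<open>Lam\<close>. Since the form has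
  signature (2, 2) on the complement of the third axis, this space has dimension at most 2.\<close>

lemma krylov_isotropic:
  fixes B :: "real^5^5"
  assumes iso: "isospectral_pencil Lam B" and sym: "transpose B = B"
  defines "h \<equiv> Lam_pinv (B *v axis 3 1)"
  defines "e \<equiv> Lam_pinv (B *v h)"
  defines "g \<equiv> Lam_pinv (B *v e)"
  shows "Lam *v h = B *v axis 3 1" "Lam *v e = B *v h" "Lam *v g = B *v e"
    "h \<bullet> (Lam *v h) = 0" "h \<bullet> (Lam *v e) = 0" "e \<bullet> (Lam *v e) = 0" "e \<bullet> (Lam *v g) = 0"
proof -
  define a b c d k f where "a = B$1$2" and "b = B$1$4" and "c = B$1$5" and "d = B$2$4" and "k = B$2$5" and "f = B$4$5"
  define h1 h2 h4 h5 where "h1 = B$1$3 / 3" and "h2 = B$2$3" and "h4 = - B$3$4" and "h5 = - B$3$5 / 3"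
  have B: "B = vector [vector [0, a, 3 * h1, b, c], vector [a, 0, h2, d, k],
      vector [3 * h1, h2, 0, - h4, - 3 * h5], vector [b, d, - h4, 0, f], vector [c, k, - 3 * h5, f, 0]]"
    by (subst symmetric_5_eq[OF sym])
      (simp add: diagonal_eq_0[OF iso] a_def b_def c_def d_def k_def f_def h1_def h2_def h4_def h5_def)
  define K0 where "K0 = 3 * h1^2 + h2^2 - h4^2 - 3 * h5^2"
  define w1 w2 w4 w5 where "w1 = a * h2 + b * h4 + c * h5" and "w2 = a * h1 + d * h4 + k * h5"
    and "w4 = b * h1 + d * h2 + f * h5" and "w5 = c * h1 + k * h2 + f * h4"
  define K1 K2 K3 where "K1 = h1 * w1 + h2 * w2 + h4 * w4 + h5 * w5"
    and "K2 = w1^2 / 3 + w2^2 - w4^2 - w5^2 / 3"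
    and "K3 = 2 * (a * w1 * w2 / 3 - b * w1 * w4 / 3 - c * w1 * w5 / 9 - d * w2 * w4 - k * w2 * w5 / 3 + f * w4 * w5 / 3)"
  define t2 t3 where "t2 = - (a^2 / 3 - b^2 / 3 - c^2 / 9 - d^2 - k^2 / 3 + f^2 / 3)"
    and "t3 = 2 * (- a * b * d / 3 - a * c * k / 9 + b * c * f / 9 + d * k * f / 3)"
  have det: "det (Lam + s *\<^sub>R B) = - 9 * (K0 * s^2 - K1 * s^3 + (K2 + t2 * K0) * s^4 - (K3 + t2 * K1 - t3 * K0) * s^5)" for s
    unfolding K0_def K1_def K2_def K3_def t2_def t3_def w1_def w2_def w4_def w5_def
    by (subst B) (rule det_bordered)
  have "K0 * s^2 - K1 * s^3 + (K2 + t2 * K0) * s^4 - (K3 + t2 * K1 - t3 * K0) * s^5 = 0" for s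
  proof -
    have "det (Lam + s *\<^sub>R B) = 0"
      using isospectral_pencilD[OF iso, of 0 "-1" "-s"] by (simp add: add.commute)
    then show ?thesis unfolding det by (simp only: mult_eq_0_iff) simp
  qed
  note co = quintic_coeffs[OF this]
  have K: "K0 = 0" "K1 = 0" "K2 = 0" "K3 = 0" using co by auto
  have Brow: "B $ 1 = vector [0, a, 3 * h1, b, c]" "B $ 2 = vector [a, 0, h2, d, k]"
    "B $ 3 = vector [3 * h1, h2, 0, - h4, - 3 * h5]" "B $ 4 = vector [b, d, - h4, 0, f]" "B $ 5 = vector [c, k, - 3 * h5, f, 0]"
    by (subst B, simp add: vector_5)+
  have Bv: "(B *v v) $ 1 = a * v$2 + 3 * h1 * v$3 + b * v$4 + c * v$5"
    "(B *v v) $ 2 = a * v$1 + h2 * v$3 + d * v$4 + k * v$5"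
    "(B *v v) $ 3 = 3 * h1 * v$1 + h2 * v$2 - h4 * v$4 - 3 * h5 * v$5"
    "(B *v v) $ 4 = b * v$1 + d * v$2 - h4 * v$3 + f * v$5"
    "(B *v v) $ 5 = c * v$1 + k * v$2 - 3 * h5 * v$3 + f * v$4" for v
    unfolding mult_vec_5 Brow by (simp_all add: vector_5)
  have hc: "h$1 = h1" "h$2 = h2" "h$3 = 0" "h$4 = h4" "h$5 = h5"
    unfolding h_def Lam_pinv_nth Bv by (simp_all add: axis_def)
  \<comment> \<open>The third entry of \<open>B h\<close> is \<open>K0\<close>. Since the image of
    \<open>Lam\<close> consists of the vectors with third entry 0, the vanishing of
    \<open>K0\<close> is exactly the solvability of \<open>Lam e = B h\<close>; \<open>K1\<close>
    plays the same part for \<open>g\<close>.\<close>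
  have Bh: "(B *v h) $ 1 = w1" "(B *v h) $ 2 = w2" "(B *v h) $ 3 = K0" "(B *v h) $ 4 = w4" "(B *v h) $ 5 = w5"
    unfolding Bv hc w1_def w2_def w4_def w5_def K0_def by (simp_all add: power2_eq_square)
  have ec: "e$1 = w1 / 3" "e$2 = w2" "e$3 = 0" "e$4 = - w4" "e$5 = - w5 / 3"
    unfolding e_def Lam_pinv_nth Bh by simp_all
  have Be3: "(B *v e) $ 3 = K1" unfolding Bv ec K1_def by simp
  show h: "Lam *v h = B *v axis 3 1"
    unfolding h_def by (rule Lam_Lam_pinv) (simp add: Bv axis_def)
  show e: "Lam *v e = B *v h"
    unfolding e_def by (rule Lam_Lam_pinv) (simp add: Bh K)
  show g: "Lam *v g = B *v e"
    unfolding g_def by (rule Lam_Lam_pinv) (simp add: Be3 K)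
  show "h \<bullet> (Lam *v h) = 0" 
    using K(1) unfolding K0_def inner_5 Lam_mult hc by (simp add: power2_eq_square algebra_simps)
  show "h \<bullet> (Lam *v e) = 0"
    using K(2) unfolding K1_def e inner_5 Bh hc by simp
  show "e \<bullet> (Lam *v e) = 0"
    using K(3) unfolding K2_def inner_5 Lam_mult ec by (simp add: power2_eq_square algebra_simps)
  show "e \<bullet> (Lam *v g) = 0"
    using K(4) unfolding K3_def g inner_5 Bv ec by (simp add: algebra_simps)
qed

section \<open>Kernels of degree two and one in adapted frames\<close>

lemma frame_entry_sym:
  fixes S :: "real^5^5"
  assumes "transpose S = S"
  shows "x \<bullet> (S *v y) = y \<bullet> (S *v x)"
  by (subst inner_symmetric_matrix[OF assms]) (rule inner_commute)

lemma orthogonal_matrix_rows_inner: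
  fixes g1 g2 g3 g4 g5 :: "real^5"
  assumes "orthogonal_matrix (vector [g1, g2, g3, g4, g5] :: real^5^5)"
  shows "g1 \<bullet> g1 = 1" "g2 \<bullet> g2 = 1" "g3 \<bullet> g3 = 1" "g4 \<bullet> g4 = 1" "g5 \<bullet> g5 = 1"
    "g1 \<bullet> g2 = 0" "g1 \<bullet> g3 = 0" "g1 \<bullet> g4 = 0" "g1 \<bullet> g5 = 0" "g2 \<bullet> g3 = 0"
    "g2 \<bullet> g4 = 0" "g2 \<bullet> g5 = 0" "g3 \<bullet> g4 = 0" "g3 \<bullet> g5 = 0" "g4 \<bullet> g5 = 0"
    "g2 \<bullet> g1 = 0" "g3 \<bullet> g1 = 0" "g4 \<bullet> g1 = 0" "g5 \<bullet> g1 = 0" "g3 \<bullet> g2 = 0"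
    "g4 \<bullet> g2 = 0" "g5 \<bullet> g2 = 0" "g4 \<bullet> g3 = 0" "g5 \<bullet> g3 = 0" "g5 \<bullet> g4 = 0"
proof -
  let ?A = "vector [g1, g2, g3, g4, g5] :: real^5^5"
  have "?A ** mat 1 ** transpose ?A = mat 1" using assms by (simp add: orthogonal_matrix_def)
  then have i: "?A $ i \<bullet> ?A $ j = (if i = j then 1 else 0)" for i j
    using conj_entry[of ?A "mat 1" i j, symmetric]
    unfolding \<open>?A ** mat 1 ** transpose ?A = mat 1\<close> matrix_vector_mul_lid by (simp add: mat_def)
  note i[of 1 1] i[of 2 2] i[of 3 3] i[of 4 4] i[of 5 5] i[of 1 2] i[of 1 3] i[of 1 4] i[of 1 5] i[of 2 3]
    i[of 2 4] i[of 2 5] i[of 3 4] i[of 3 5] i[of 4 5]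
  then show "g1 \<bullet> g1 = 1" "g2 \<bullet> g2 = 1" "g3 \<bullet> g3 = 1" "g4 \<bullet> g4 = 1" "g5 \<bullet> g5 = 1"
    "g1 \<bullet> g2 = 0" "g1 \<bullet> g3 = 0" "g1 \<bullet> g4 = 0" "g1 \<bullet> g5 = 0" "g2 \<bullet> g3 = 0"
    "g2 \<bullet> g4 = 0" "g2 \<bullet> g5 = 0" "g3 \<bullet> g4 = 0" "g3 \<bullet> g5 = 0" "g4 \<bullet> g5 = 0"
    by (simp_all add: vector_5)
  then show "g2 \<bullet> g1 = 0" "g3 \<bullet> g1 = 0" "g4 \<bullet> g1 = 0" "g5 \<bullet> g1 = 0" "g3 \<bullet> g2 = 0"
    "g4 \<bullet> g2 = 0" "g5 \<bullet> g2 = 0" "g4 \<bullet> g3 = 0" "g5 \<bullet> g3 = 0" "g5 \<bullet> g4 = 0"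
    by (simp_all only: inner_commute[of g2 g1] inner_commute[of g3 g1] inner_commute[of g4 g1] inner_commute[of g5 g1]
      inner_commute[of g3 g2] inner_commute[of g4 g2] inner_commute[of g5 g2] inner_commute[of g4 g3]
      inner_commute[of g5 g3] inner_commute[of g5 g4])
qed

lemma frame_matrix_eq:
  fixes S :: "real^5^5" and g1 g2 g3 g4 g5 :: "real^5"
  assumes "transpose S = S"
  defines "A \<equiv> vector [g1, g2, g3, g4, g5] :: real^5^5"
  shows "A ** S ** transpose A = vector [
    vector [g1 \<bullet> (S *v g1), g2 \<bullet> (S *v g1), g3 \<bullet> (S *v g1), g4 \<bullet> (S *v g1), g5 \<bullet> (S *v g1)],
    vector [g2 \<bullet> (S *v g1), g2 \<bullet> (S *v g2), g3 \<bullet> (S *v g2), g4 \<bullet> (S *v g2), g5 \<bullet> (S *v g2)],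
    vector [g3 \<bullet> (S *v g1), g3 \<bullet> (S *v g2), g3 \<bullet> (S *v g3), g3 \<bullet> (S *v g4), g3 \<bullet> (S *v g5)],
    vector [g4 \<bullet> (S *v g1), g4 \<bullet> (S *v g2), g3 \<bullet> (S *v g4), g4 \<bullet> (S *v g4), g4 \<bullet> (S *v g5)],
    vector [g5 \<bullet> (S *v g1), g5 \<bullet> (S *v g2), g3 \<bullet> (S *v g5), g4 \<bullet> (S *v g5), g5 \<bullet> (S *v g5)]]"
  unfolding A_def vec_eq_5 conj_entry vector_5
  by (simp add: frame_entry_sym[OF assms(1), of g1 g2] frame_entry_sym[OF assms(1), of g1 g3]
      frame_entry_sym[OF assms(1), of g1 g4] frame_entry_sym[OF assms(1), of g1 g5] frame_entry_sym[OF assms(1), of g2 g3]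
      frame_entry_sym[OF assms(1), of g2 g4] frame_entry_sym[OF assms(1), of g2 g5] frame_entry_sym[OF assms(1), of g4 g3]
      frame_entry_sym[OF assms(1), of g5 g3] frame_entry_sym[OF assms(1), of g5 g4])

lemma Lam_eq_0_imp: "Lam *v v = 0 \<Longrightarrow> v$3 = 0 \<Longrightarrow> v = 0"
  by (simp add: vec_eq_5 Lam_mult)

lemma extend_to_frame_5:
  fixes g1 g2 g3 :: "real^5"
  assumes "g1 \<bullet> g1 = 1" "g2 \<bullet> g2 = 1" "g3 \<bullet> g3 = 1" "g1 \<bullet> g2 = 0" "g1 \<bullet> g3 = 0" "g2 \<bullet> g3 = 0"
  obtains g4 g5 where "orthogonal_matrix (vector [g1, g2, g3, g4, g5] :: real^5^5)"
proof -
  have c3: "card {g1, g2, g3} < 5" by (simp add: card_insert_if)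
  obtain g4 where g4: "g4 \<bullet> g4 = 1" "\<And>v. v \<in> {g1, g2, g3} \<Longrightarrow> v \<bullet> g4 = 0"
    using exists_unit_orthogonal[OF _ c3] by blast
  have c4: "card {g1, g2, g3, g4} < 5" by (simp add: card_insert_if)
  obtain g5 where g5: "g5 \<bullet> g5 = 1" "\<And>v. v \<in> {g1, g2, g3, g4} \<Longrightarrow> v \<bullet> g5 = 0"
    using exists_unit_orthogonal[OF _ c4] by blast
  show ?thesis
    by (rule that[of g4 g5], rule orthonormal_frame) (simp_all add: assms g4 g5)
qed

text \<open>Isotropy makes \<open>Lam\<close> and \<open>B\<close> send the span of
  \<open>axis 3 1\<close>, \<open>h\<close>, \<open>e\<close> into its two-dimensional orthogonal
  complement. In a frame adapted to this splitting the constant coefficient of the characteristic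
  polynomial fixes the relative position of \<open>h\<close>, \<open>e\<close>, \<open>g\<close> up
  to one number \<open>\<nu>\<close>. The other coefficients make the block on the complement vanish
  and give \<open>\<nu> = 7/9\<close>. The first two conclusions later locate \<open>h\<close> and
  \<open>e\<close> in the coordinate planes.\<close>

lemma kernel_conic_case:
  fixes B :: "real^5^5"
  assumes iso: "isospectral_pencil Lam B" and sym: "transpose B = B"
    and h: "Lam *v h = B *v axis 3 1" and e: "Lam *v e = B *v h" and g: "Lam *v g = B *v e"
    and z: "h$3 = 0" "e$3 = 0" "g$3 = 0"
    and i: "h \<bullet> (Lam *v h) = 0" "h \<bullet> (Lam *v e) = 0" "e \<bullet> (Lam *v e) = 0" "e \<bullet> (Lam *v g) = 0"
    and ind: "h \<noteq> 0" "\<And>r. e \<noteq> r *\<^sub>R h"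
  shows "Lam *v (Lam *v h) = h" "Lam *v (Lam *v e) = 9 *\<^sub>R e"
    "B *v (Lam *v h) = (32/9) *\<^sub>R axis 3 1 + 7 *\<^sub>R e" "B *v (Lam *v e) = h"
    "h \<bullet> h = 32/9" "e \<bullet> e = 32/81"
proof -
  note SL = frame_entry_sym[OF transpose_Lam] and SB = frame_entry_sym[OF sym]
  define n a where "n = norm h" and "a = (e \<bullet> h) / (n^2)"
  have n: "n > 0" "h \<bullet> h = n^2" using ind(1) by (simp_all add: n_def dot_square_norm)
  define e' where "e' = e - a *\<^sub>R h"
  define m where "m = norm e'"
  have "e' \<noteq> 0" using ind(2)[of a] by (simp add: e'_def)
  then have m: "m > 0" "e' \<bullet> e' = m^2" by (simp_all add: m_def dot_square_norm)
  define g1 :: "real^5" where "g1 = axis 3 1"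
  define g2 g3 where "g2 = (1/n) *\<^sub>R h" and "g3 = (1/m) *\<^sub>R e'"
  have hg: "h = n *\<^sub>R g2" "e = (a * n) *\<^sub>R g2 + m *\<^sub>R g3"
    using n m unfolding g2_def g3_def e'_def by (simp_all add: algebra_simps)
  have he': "h \<bullet> e' = 0" using n by (simp add: e'_def a_def inner_diff_right inner_commute)
  obtain g4 g5 where orth: "orthogonal_matrix (vector [g1, g2, g3, g4, g5] :: real^5^5)"
  proof (rule extend_to_frame_5)
    show "g1 \<bullet> g1 = 1" by (simp add: g1_def inner_axis_axis)
    show "g2 \<bullet> g2 = 1" using n by (simp add: g2_def power2_eq_square)
    show "g3 \<bullet> g3 = 1" using m by (simp add: g3_def power2_eq_square)
    show "g1 \<bullet> g2 = 0" "g1 \<bullet> g3 = 0" using z by (simp_all add: g1_def g2_def g3_def e'_def inner_axis')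
    show "g2 \<bullet> g3 = 0" using he' by (simp add: g2_def g3_def)
  qed
  note gg = orthogonal_matrix_rows_inner[OF orth]
  note ex = frame_expansion[OF orth, unfolded vector_5]
  have t3: "g1 \<bullet> (Lam *v v) = 0" for v by (simp add: g1_def inner_axis' Lam_mult)
  have e'L: "e' \<bullet> (Lam *v h) = 0" "e' \<bullet> (Lam *v e) = 0"
    using i SL[of e h] unfolding e'_def by (simp_all add: inner_diff_left)
  define p1 p2 q1 q2 where "p1 = g4 \<bullet> (Lam *v h)" and "p2 = g5 \<bullet> (Lam *v h)"
    and "q1 = g4 \<bullet> (Lam *v e)" and "q2 = g5 \<bullet> (Lam *v e)"
  have Lh: "Lam *v h = p1 *\<^sub>R g4 + p2 *\<^sub>R g5"
    using ex[of "Lam *v h"] i(1) e'L t3 by (simp add: g2_def g3_def p1_def p2_def)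
  have Le: "Lam *v e = q1 *\<^sub>R g4 + q2 *\<^sub>R g5"
    using ex[of "Lam *v e"] i(2) e'L t3 by (simp add: g2_def g3_def q1_def q2_def)
  have D: "p1 * q2 - p2 * q1 \<noteq> 0"
  proof
    assume D0: "p1 * q2 - p2 * q1 = 0"
    have "Lam *v (p1 *\<^sub>R e - q1 *\<^sub>R h) = (p1 * q2 - p2 * q1) *\<^sub>R g5"
      by (simp add: matrix_vector_mult_diff_distrib matrix_vector_mult_scaleR Lh Le algebra_simps)
    then have "Lam *v (p1 *\<^sub>R e - q1 *\<^sub>R h) = 0" unfolding D0 by simp
    then have 1: "p1 *\<^sub>R e - q1 *\<^sub>R h = 0" by (rule Lam_eq_0_imp) (simp add: z)
    have "Lam *v (p2 *\<^sub>R e - q2 *\<^sub>R h) = - (p1 * q2 - p2 * q1) *\<^sub>R g4"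
      by (simp add: matrix_vector_mult_diff_distrib matrix_vector_mult_scaleR Lh Le algebra_simps)
    then have "Lam *v (p2 *\<^sub>R e - q2 *\<^sub>R h) = 0" unfolding D0 by simp
    then have 2: "p2 *\<^sub>R e - q2 *\<^sub>R h = 0" by (rule Lam_eq_0_imp) (simp add: z)
    have "p = 0" if "p *\<^sub>R e - q *\<^sub>R h = 0" for p q
    proof (rule ccontr)
      assume "p \<noteq> 0"
      then have "e = (q / p) *\<^sub>R h" using that by (simp add: vec_eq_iff field_simps)
      then show False using ind(2) by blast
    qed
    then have "p1 = 0" "p2 = 0" using 1 2 by blast+
    then have "Lam *v h = 0" unfolding Lh by simp
    then have "h = 0" by (rule Lam_eq_0_imp) (rule z)
    then show False using ind(1) by simp
  qed
  \<comment> \<open>\<open>Lam h\<close> and \<open>Lam e\<close> span the plane of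
    \<open>g4\<close>, \<open>g5\<close>, so \<open>g\<close> has no component there and lies in the
    span of \<open>h\<close> and \<open>e\<close>: the Krylov space closes at dimension 2.\<close>
  have "g \<bullet> (Lam *v h) = 0"
    using i(3) SL[of g h] SB[of h e] unfolding g e by (simp add: inner_commute)
  moreover have "g \<bullet> (Lam *v e) = 0" using i(4) SL[of g e] by simp
  ultimately have "p1 * (g \<bullet> g4) + p2 * (g \<bullet> g5) = 0" "q1 * (g \<bullet> g4) + q2 * (g \<bullet> g5) = 0"
    unfolding Lh Le by (simp_all add: inner_add_right)
  then have "(p1 * q2 - p2 * q1) * (g \<bullet> g4) = 0" "(p1 * q2 - p2 * q1) * (g \<bullet> g5) = 0" by algebra+
  then have "g4 \<bullet> g = 0" "g5 \<bullet> g = 0" using D by (simp_all add: inner_commute)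
  moreover have "g1 \<bullet> g = 0" using z by (simp add: g1_def inner_axis')
  ultimately have gexp: "g = (g2 \<bullet> g) *\<^sub>R g2 + (g3 \<bullet> g) *\<^sub>R g3" using ex[of g] by simp
  define \<mu> \<nu> where "\<mu> = (g3 \<bullet> g) / m" and "\<nu> = (g2 \<bullet> g) / n - \<mu> * a"
  have "g = \<mu> *\<^sub>R e + \<nu> *\<^sub>R h"
    by (subst gexp) (use n m in \<open>simp add: hg \<mu>_def \<nu>_def algebra_simps\<close>)
  then have Lg: "Lam *v g = \<mu> *\<^sub>R (Lam *v e) + \<nu> *\<^sub>R (Lam *v h)"
    by (simp add: matrix_vector_right_distrib matrix_vector_mult_scaleR)
  have L1: "Lam *v g1 = 0" by (simp add: g1_def)
  have L2: "Lam *v g2 = (1/n) *\<^sub>R (p1 *\<^sub>R g4 + p2 *\<^sub>R g5)"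
    by (simp add: g2_def matrix_vector_mult_scaleR Lh)
  have L3: "Lam *v g3 = (1/m) *\<^sub>R ((q1 - a * p1) *\<^sub>R g4 + (q2 - a * p2) *\<^sub>R g5)"
    by (simp add: g3_def e'_def matrix_vector_mult_scaleR matrix_vector_mult_diff_distrib Lh Le algebra_simps)
  have B1: "B *v g1 = p1 *\<^sub>R g4 + p2 *\<^sub>R g5" by (simp add: g1_def Lh flip: h)
  have B2: "B *v g2 = (1/n) *\<^sub>R (q1 *\<^sub>R g4 + q2 *\<^sub>R g5)"
    by (simp add: g2_def matrix_vector_mult_scaleR Le flip: e)
  have B3: "B *v g3 = (1/m) *\<^sub>R (((\<mu> - a) * q1 + \<nu> * p1) *\<^sub>R g4 + ((\<mu> - a) * q2 + \<nu> * p2) *\<^sub>R g5)"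
    unfolding g3_def e'_def matrix_vector_mult_scaleR matrix_vector_mult_diff_distrib e[symmetric] g[symmetric] Lg Lh Le
    by (simp add: algebra_simps)
  let ?A = "vector [g1, g2, g3, g4, g5] :: real^5^5"
  note iso' = isospectral_pencil_conj[OF iso orth]
  have pat: "c *\<^sub>R (?A ** Lam ** transpose ?A) + s *\<^sub>R (?A ** B ** transpose ?A) = vector [
      vector [0, 0, 0, s * p1, s * p2],
      vector [0, 0, 0, (c * p1 + s * q1) / n, (c * p2 + s * q2) / n],
      vector [0, 0, 0, (c * (q1 - a * p1) + s * ((\<mu> - a) * q1 + \<nu> * p1)) / m, (c * (q2 - a * p2) + s * ((\<mu> - a) * q2 + \<nu> * p2)) / m],
      vector [s * p1, (c * p1 + s * q1) / n, (c * (q1 - a * p1) + s * ((\<mu> - a) * q1 + \<nu> * p1)) / m,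
        c * (g4 \<bullet> (Lam *v g4)) + s * (g4 \<bullet> (B *v g4)), c * (g4 \<bullet> (Lam *v g5)) + s * (g4 \<bullet> (B *v g5))],
      vector [s * p2, (c * p2 + s * q2) / n, (c * (q2 - a * p2) + s * ((\<mu> - a) * q2 + \<nu> * p2)) / m,
        c * (g4 \<bullet> (Lam *v g5)) + s * (g4 \<bullet> (B *v g5)), c * (g5 \<bullet> (Lam *v g5)) + s * (g5 \<bullet> (B *v g5))]]" for c s
    unfolding frame_matrix_eq[OF transpose_Lam] frame_matrix_eq[OF sym] SL[of g3 g4] SL[of g3 g5] SB[of g3 g4] SB[of g3 g5]
      L1 L2 L3 B1 B2 B3
    by (simp add: vec_eq_5 vector_5 inner_add_right gg add_divide_distrib distrib_left)
  note blk = isospectral_pencil_block_3_2[OF iso' pat]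
  define d where "d = (p1 * q2 - p2 * q1)^2"
  have d: "d > 0" using D by (simp add: d_def)
  have "(d - 9 * n^2 * m^2) * c^4 + (2 * \<mu> * d) * (c^3 * s) + (d * (n^2 + \<mu>^2 - 2 * \<nu>) - 18 * n^2 * m^2) * (c^2 * s^2)
    + (d * (2 * n^2 * (\<mu> - a) - 2 * \<mu> * \<nu>)) * (c * s^3) + (d * (m^2 + n^2 * (\<mu> - a)^2 + \<nu>^2) - 9 * n^2 * m^2) * s^4 = 0" for c s
  proof -
    define x1 x2 y1 y2 where "x1 = c * p1 + s * q1" and "x2 = c * p2 + s * q2"
      and "y1 = c * (q1 - a * p1) + s * ((\<mu> - a) * q1 + \<nu> * p1)" and "y2 = c * (q2 - a * p2) + s * ((\<mu> - a) * q2 + \<nu> * p2)"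
    have "((s * p1)^2 + (x1 / n)^2 + (y1 / m)^2) * ((s * p2)^2 + (x2 / n)^2 + (y2 / m)^2)
       - (s * p1 * (s * p2) + x1 / n * (x2 / n) + y1 / m * (y2 / m))^2 = 9 * (c^2 + s^2)^2"
      using blk(4)[of s c] unfolding x1_def x2_def y1_def y2_def .
    \<comment> \<open>Lagrange's identity: the Gram determinant of two vectors in three-space is the
      sum of their squared two by two minors. Each minor is a form in \<open>c\<close>,
      \<open>s\<close> times \<open>p1 * q2 - p2 * q1\<close>.\<close>
    moreover have "((s * p1)^2 + (x1 / n)^2 + (y1 / m)^2) * ((s * p2)^2 + (x2 / n)^2 + (y2 / m)^2)
       - (s * p1 * (s * p2) + x1 / n * (x2 / n) + y1 / m * (y2 / m))^2
       = ((s * (p1 * x2 - p2 * x1))^2 * m^2 + (s * (p1 * y2 - p2 * y1))^2 * n^2 + (x1 * y2 - x2 * y1)^2) / (n^2 * m^2)"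
      using n(1) m(1) by (simp add: field_simps power2_eq_square)
    ultimately have "(s * (p1 * x2 - p2 * x1))^2 * m^2 + (s * (p1 * y2 - p2 * y1))^2 * n^2 + (x1 * y2 - x2 * y1)^2
        = 9 * (c^2 + s^2)^2 * (n^2 * m^2)"
      using n(1) m(1) by (simp add: field_simps)
    moreover have "p1 * x2 - p2 * x1 = s * (p1 * q2 - p2 * q1)"
      "p1 * y2 - p2 * y1 = (c + s * (\<mu> - a)) * (p1 * q2 - p2 * q1)"
      "x1 * y2 - x2 * y1 = (c^2 + \<mu> * c * s - \<nu> * s^2) * (p1 * q2 - p2 * q1)"
      unfolding x1_def x2_def y1_def y2_def by algebra+
    ultimately have "(s * (s * (p1 * q2 - p2 * q1)))^2 * m^2 + (s * ((c + s * (\<mu> - a)) * (p1 * q2 - p2 * q1)))^2 * n^2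
        + ((c^2 + \<mu> * c * s - \<nu> * s^2) * (p1 * q2 - p2 * q1))^2 = 9 * (c^2 + s^2)^2 * (n^2 * m^2)" by simp
    then show ?thesis unfolding d_def by algebra
  qed
  note f = quartic_form_coeffs[OF this]
  have mu: "\<mu> = 0" using f(2) d by simp
  then have a: "a = 0" using f(4) d n by simp
  have dn: "d = 9 * n^2 * m^2" using f(1) by simp
  have n2: "n^2 = 2 * (1 + \<nu>)"
  proof -
    have "d * (n^2 - 2 * \<nu> - 2) = 0" using f(3) mu dn by algebra
    then show ?thesis using d by simp
  qed
  have m2: "m^2 = (1 - \<nu>) * (1 + \<nu>)"
  proof -
    have "d * (m^2 + \<nu>^2 - 1) = 0" using f(5) mu a dn by algebra
    then have "m^2 + \<nu>^2 - 1 = 0" using d by simp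
    then show ?thesis by algebra
  qed
  have "0 < n^2" "0 < m^2" using n(1) m(1) by simp_all
  then have nu: "- 1 < \<nu>" "\<nu> < 1" unfolding n2 m2 by (simp_all add: zero_less_mult_iff)
  \<comment> \<open>\<open>A\<close> is \<open>1 / n^2\<close> and \<open>4 * A * D\<close> is
    \<open>1 / m^2\<close>. \<open>D\<close> is chosen for the splitting in \<open>sq\<close> and
    \<open>mx\<close>: a part proportional to \<open>c^2 + s^2\<close> with weight \<open>A\<close>,
    and a part in \<open>c q + s p\<close> with weight \<open>D\<close>.\<close>
  define A D where "A = 1 / (2 * (1 + \<nu>))" and "D = 1 / (2 * (1 - \<nu>))"
  have AD: "A > 0" "D > 0" "2 * A * (1 + \<nu>) = 1" "2 * D * (1 - \<nu>) = 1"
    using nu by (simp_all add: A_def D_def)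
  have AD': "A + D = 4 * A * D" "D - A = 4 * A * D * \<nu>" "4 * A * D * (1 - \<nu>^2) = 1"
    using AD(3,4) by algebra+
  have nA: "x / n * (y / n) = A * (x * y)" for x y
    using n(1) n2 by (simp add: A_def power2_eq_square)
  have mA: "x / m * (y / m) = 4 * A * D * (x * y)" for x y
  proof -
    have "4 * A * D * m^2 = 1" using AD(3,4) m2 by algebra
    then have "4 * A * D = 1 / m^2" using m(1) by (simp add: field_simps)
    then show ?thesis by (simp add: power2_eq_square)
  qed
  define l0 l1 k0 k1 where "l0 = g4 \<bullet> (Lam *v g5)" and "l1 = g4 \<bullet> (B *v g5)"
    and "k0 = g4 \<bullet> (Lam *v g4)" and "k1 = g4 \<bullet> (B *v g4)"
  have sq: "(s * x)^2 + ((c * x + s * y) / n)^2 + ((c * y + s * (\<nu> * x)) / m)^2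
      = A * (c^2+s^2) * (x^2 + y^2) + D * (c * y + s * x)^2" for c s x y
  proof -
    have "(s * x)^2 + ((c * x + s * y) / n)^2 + ((c * y + s * (\<nu> * x)) / m)^2
      = (s * x)^2 + A * (c * x + s * y)^2 + 4 * A * D * (c * y + s * (\<nu> * x))^2"
      unfolding power2_eq_square nA mA ..
    also have "\<dots> = A * (c^2+s^2) * (x^2 + y^2) + D * (c * y + s * x)^2" using AD' by algebra
    finally show ?thesis .
  qed
  have mx: "s * p1 * (s * p2) + (c * p1 + s * q1) / n * ((c * p2 + s * q2) / n) + (c * q1 + s * (\<nu> * p1)) / m * ((c * q2 + s * (\<nu> * p2)) / m)
      = A * (c^2+s^2) * (p1 * p2 + q1 * q2) + D * ((c * q1 + s * p1) * (c * q2 + s * p2))" for c s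
    unfolding nA mA using AD' by algebra
  have y: "c * (x - a * z) + s * ((\<mu> - a) * x + \<nu> * z) = c * x + s * (\<nu> * z)" for c s x z
    unfolding mu a by simp
  have k22: "c * (g5 \<bullet> (Lam *v g5)) + s * (g5 \<bullet> (B *v g5)) = - (c * k0 + s * k1)" for c s
    using blk(1)[of c s] unfolding k0_def k1_def by simp
  note blk' = blk[unfolded y sq mx k22, folded k0_def k1_def l0_def l1_def]
  have sc: "A * (c^2+s^2) * (p1^2 + p2^2 + q1^2 + q2^2) + D * ((c * q1 + s * p1)^2 + (c * q2 + s * p2)^2)
      + (c * k0 + s * k1)^2 + (c * l0 + s * l1)^2 = 10 * (c^2 + s^2)"
    "(c * k0 + s * k1) * (A * (c^2+s^2) * (p1^2 - p2^2 + q1^2 - q2^2) + D * ((c * q1 + s * p1)^2 - (c * q2 + s * p2)^2))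
      + 2 * (c * l0 + s * l1) * (A * (c^2+s^2) * (p1 * p2 + q1 * q2) + D * ((c * q1 + s * p1) * (c * q2 + s * p2))) = 0" for c s
    using blk'(2)[of c s] blk'(3)[of c s] by algebra+
  note fin = kernel_conic_scalar[OF AD(1,2) D sc]
  \<comment> \<open>\<open>p\<close> and \<open>q\<close> are orthogonal with the same squared
    length \<open>r\<close>, so their determinant is plus or minus \<open>r\<close>.\<close>
  define r where "r = p1^2 + p2^2"
  have "r^2 = d" unfolding r_def d_def using fin(5,6) by algebra
  then have "r^2 = 18 * (1 + \<nu>)^2 * (1 - \<nu>)" unfolding dn n2 m2 by algebra
  moreover have "(1 / (1 + \<nu>) + 1 / (2 * (1 - \<nu>))) * r = 10"
  proof -
    have "2 * A = 1 / (1 + \<nu>)" using nu by (simp add: A_def field_simps)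
    then show ?thesis using fin(7) unfolding r_def D_def by simp
  qed
  ultimately have nur: "\<nu> = 7/9" "r = 32/9"
    using minimal_index_two_parameter[OF nu] by blast+
  have nm: "n^2 = 32/9" "m^2 = 32/81" unfolding n2 m2 nur by simp_all
  have e': "e = m *\<^sub>R g3" using hg(2) a by simp
  have kl: "g4 \<bullet> (Lam *v g4) = 0" "g4 \<bullet> (Lam *v g5) = 0" "g5 \<bullet> (Lam *v g4) = 0" "g5 \<bullet> (Lam *v g5) = 0"
    "g4 \<bullet> (B *v g4) = 0" "g4 \<bullet> (B *v g5) = 0" "g5 \<bullet> (B *v g4) = 0" "g5 \<bullet> (B *v g5) = 0"
    using fin(1-4) k22[of 1 0] k22[of 0 1] SL[of g5 g4] SB[of g5 g4] unfolding k0_def k1_def l0_def l1_def by simp_all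
  have fin': "p1 * p1 + p2 * p2 = r" "q1 * q1 + q2 * q2 = r" "q1 * p1 + q2 * p2 = 0" "p1 * q1 + p2 * q2 = 0"
    using fin(5,6) unfolding r_def by (simp_all add: power2_eq_square mult.commute)
  show "h \<bullet> h = 32/9" using n(2) nm(1) by simp
  show "e \<bullet> e = 32/81" using nm(2) gg(3) by (simp add: e' power2_eq_square)
  \<comment> \<open>With the block on \<open>g4\<close>, \<open>g5\<close> gone, both matrices send
    this plane back into the span of the first three frame vectors, and by symmetry the components
    there are already known.\<close>
  have img: "S *v w = (g1 \<bullet> (S *v w)) *\<^sub>R g1 + (g2 \<bullet> (S *v w)) *\<^sub>R g2 + (g3 \<bullet> (S *v w)) *\<^sub>R g3"
    if "g4 \<bullet> (S *v w) = 0" "g5 \<bullet> (S *v w) = 0" for S w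
    using ex[of "S *v w"] that by simp
  have sL: "g2 \<bullet> (Lam *v w) = (Lam *v g2) \<bullet> w" "g3 \<bullet> (Lam *v w) = (Lam *v g3) \<bullet> w" for w
    using inner_symmetric_matrix[OF transpose_Lam] by blast+
  have sB: "g1 \<bullet> (B *v w) = (B *v g1) \<bullet> w" "g2 \<bullet> (B *v w) = (B *v g2) \<bullet> w" "g3 \<bullet> (B *v w) = (B *v g3) \<bullet> w" for w
    using inner_symmetric_matrix[OF sym] by blast+
  have LF: "Lam *v (x *\<^sub>R g4 + y *\<^sub>R g5) = ((p1 * x + p2 * y) / n) *\<^sub>R g2 + ((q1 * x + q2 * y) / m) *\<^sub>R g3" for x y
  proof -
    have w: "g4 \<bullet> (Lam *v (x *\<^sub>R g4 + y *\<^sub>R g5)) = 0" "g5 \<bullet> (Lam *v (x *\<^sub>R g4 + y *\<^sub>R g5)) = 0"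
      by (simp_all add: matrix_vector_right_distrib matrix_vector_mult_scaleR inner_add_right kl)
    show ?thesis
      by (subst img[OF w], unfold sL L2 L3 t3 a)
        (simp add: inner_add_left inner_add_right gg add_divide_distrib mult_ac)
  qed
  have BF: "B *v (x *\<^sub>R g4 + y *\<^sub>R g5) = (p1 * x + p2 * y) *\<^sub>R g1 + ((q1 * x + q2 * y) / n) *\<^sub>R g2
      + (\<nu> * (p1 * x + p2 * y) / m) *\<^sub>R g3" for x y
  proof -
    have w: "g4 \<bullet> (B *v (x *\<^sub>R g4 + y *\<^sub>R g5)) = 0" "g5 \<bullet> (B *v (x *\<^sub>R g4 + y *\<^sub>R g5)) = 0"
      by (simp_all add: matrix_vector_right_distrib matrix_vector_mult_scaleR inner_add_right kl)
    show ?thesis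
      by (subst img[OF w], unfold sB B1 B2 B3 a mu)
        (simp add: inner_add_left inner_add_right gg add_divide_distrib distrib_left mult_ac)
  qed
  have rn: "r / n = n" "r / m = 9 * m" "\<nu> * r / m = 7 * m"
    using nm n(1) m(1) unfolding nur by (simp_all add: field_simps power2_eq_square)
  show "Lam *v (Lam *v h) = h" "Lam *v (Lam *v e) = 9 *\<^sub>R e"
    unfolding Lh Le LF fin' rn using hg(1) e' by simp_all
  show "B *v (Lam *v h) = (32/9) *\<^sub>R axis 3 1 + 7 *\<^sub>R e" "B *v (Lam *v e) = h"
    unfolding Lh Le BF fin' rn using hg(1) e' by (simp_all add: nur(2) g1_def)
qed

text \<open>Over the reals \<open>c^2 + s^2\<close> is irreducible, so a quadratic factor of its
  square is a multiple of it. The coefficient proof eliminates \<open>y\<close>; the possibility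
  \<open>w = - u\<close> fails because \<open>36 u^2 + 9 v^2\<close> is positive.\<close>

lemma definite_factor_of_square:
  fixes u v w x y z :: real
  assumes "\<And>c s. (u * c^2 + v * (c * s) + w * s^2) * (x * c^2 + y * (c * s) + z * s^2) = 9 * (c^2 + s^2)^2"
  shows "v = 0" "u = w"
proof -
  have "(u * x - 9) * c^4 + (u * y + v * x) * (c^3 * s) + (u * z + v * y + w * x - 18) * (c^2 * s^2)
      + (v * z + w * y) * (c * s^3) + (w * z - 9) * s^4 = 0" for c s
    using assms[of c s] by algebra
  note f = quartic_form_coeffs[OF this]
  have nz: "u \<noteq> 0" "w \<noteq> 0" using f(1,5) by auto
  have x: "u * x = 9" and z: "w * z = 9" using f(1,5) by simp_all
  have a1: "u^2 * y = - 9 * v" using f(2) x by algebra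
  have a2: "w^2 * y = - 9 * v" using f(4) z by algebra
  have a3: "9 * (u - w)^2 + u * w * v * y = 0"
  proof -
    have "u * w * (u * z + v * y + w * x - 18) = 0" using f(3) by simp
    then show ?thesis using x z by algebra
  qed
  have y: "y = 0"
  proof (rule ccontr)
    assume y: "y \<noteq> 0"
    have "(u - w) * (u + w) * y = 0" using a1 a2 by algebra
    then consider "u = w" | "w = - u" using y by (auto simp: eq_neg_iff_add_eq_0 add.commute)
    then show False
    proof cases
      case 1
      then have "u^2 * v * y = 0" using a3 by (simp add: power2_eq_square mult.assoc)
      then show False using nz y a1 by auto
    next
      case 2
      have "u^2 * (36 * u^2 + 9 * v^2) = 0" using a3 a1 unfolding 2 by algebra
      moreover have "36 * u^2 + 9 * v^2 > 0" using nz by (simp add: add_pos_nonneg)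
      ultimately show False using nz by simp
    qed
  qed
  then show "v = 0" using a1 by simp
  then show "u = w" using a3 by simp
qed

text \<open>The span of \<open>axis 3 1\<close> and \<open>h\<close> is sent into the line of
  \<open>Lam h\<close>. The constant coefficient of the characteristic polynomial makes this line
  grow like \<open>c^2 + s^2\<close>, hence \<open>\<mu> = 0\<close> and \<open>h\<close> is a unit
  vector. The scalar system then uncouples \<open>Lam h\<close> from the remaining plane, so
  \<open>h\<close> is an eigenvector of the square of \<open>Lam\<close>.\<close>

lemma kernel_line_case:
  fixes B :: "real^5^5"
  assumes iso: "isospectral_pencil Lam B" and sym: "transpose B = B"
    and h: "Lam *v h = B *v axis 3 1" and e: "B *v h = \<mu> *\<^sub>R (Lam *v h)"
    and z: "h$3 = 0" and i: "h \<bullet> (Lam *v h) = 0" and ne: "h \<noteq> 0"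
  shows "\<exists>F. (F = 1 \<or> F = 9) \<and> Lam *v (Lam *v h) = F *\<^sub>R h \<and> B *v h = 0 \<and> B *v (Lam *v h) = F *\<^sub>R axis 3 1 \<and> h \<bullet> h = 1"
proof -
  note SL = frame_entry_sym[OF transpose_Lam] and SB = frame_entry_sym[OF sym]
  define n where "n = norm h"
  have n: "n > 0" "h \<bullet> h = n^2" using ne by (simp_all add: n_def dot_square_norm)
  have "Lam *v h \<noteq> 0" using Lam_eq_0_imp[of h] ne z by blast
  define p where "p = norm (Lam *v h) / n"
  have p: "p > 0" using n \<open>Lam *v h \<noteq> 0\<close> by (simp add: p_def)
  define g1 :: "real^5" where "g1 = axis 3 1"
  define g2 g3 where "g2 = (1/n) *\<^sub>R h" and "g3 = (1 / (n * p)) *\<^sub>R (Lam *v h)"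
  have np: "norm (Lam *v h) = n * p" using n by (simp add: p_def)
  obtain g4 g5 where orth: "orthogonal_matrix (vector [g1, g2, g3, g4, g5] :: real^5^5)"
  proof (rule extend_to_frame_5)
    show "g1 \<bullet> g1 = 1" by (simp add: g1_def inner_axis_axis)
    show "g2 \<bullet> g2 = 1" using n by (simp add: g2_def power2_eq_square)
    show "g3 \<bullet> g3 = 1" using np n p by (simp add: g3_def dot_square_norm power2_eq_square)
    show "g1 \<bullet> g2 = 0" "g1 \<bullet> g3 = 0" using z by (simp_all add: g1_def g2_def g3_def inner_axis' Lam_mult)
    show "g2 \<bullet> g3 = 0" using i by (simp add: g2_def g3_def)
  qed
  note gg = orthogonal_matrix_rows_inner[OF orth]
  note ex = frame_expansion[OF orth, unfolded vector_5]
  have Lh: "Lam *v h = (n * p) *\<^sub>R g3" using n p by (simp add: g3_def)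
  have L1: "Lam *v g1 = 0" by (simp add: g1_def)
  have L2: "Lam *v g2 = p *\<^sub>R g3" using n by (simp add: g2_def matrix_vector_mult_scaleR Lh)
  have B1: "B *v g1 = (n * p) *\<^sub>R g3" by (simp add: g1_def Lh flip: h)
  have B2: "B *v g2 = (\<mu> * p) *\<^sub>R g3" using n by (simp add: g2_def matrix_vector_mult_scaleR e Lh)
  let ?A = "vector [g1, g2, g3, g4, g5] :: real^5^5"
  note iso' = isospectral_pencil_conj[OF iso orth]
  define a0 b0 c0 d0 e0 f0 where "a0 = g3 \<bullet> (Lam *v g3)" and "b0 = g3 \<bullet> (Lam *v g4)" and "c0 = g3 \<bullet> (Lam *v g5)"
    and "d0 = g4 \<bullet> (Lam *v g4)" and "e0 = g4 \<bullet> (Lam *v g5)" and "f0 = g5 \<bullet> (Lam *v g5)"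
  define a1 b1 c1 d1 e1 f1 where "a1 = g3 \<bullet> (B *v g3)" and "b1 = g3 \<bullet> (B *v g4)" and "c1 = g3 \<bullet> (B *v g5)"
    and "d1 = g4 \<bullet> (B *v g4)" and "e1 = g4 \<bullet> (B *v g5)" and "f1 = g5 \<bullet> (B *v g5)"
  have pat: "c *\<^sub>R (?A ** Lam ** transpose ?A) + s *\<^sub>R (?A ** B ** transpose ?A) = vector [
      vector [0, 0, s * (n * p), 0, 0],
      vector [0, 0, c * p + s * (\<mu> * p), 0, 0],
      vector [s * (n * p), c * p + s * (\<mu> * p), c * a0 + s * a1, c * b0 + s * b1, c * c0 + s * c1],
      vector [0, 0, c * b0 + s * b1, c * d0 + s * d1, c * e0 + s * e1],
      vector [0, 0, c * c0 + s * c1, c * e0 + s * e1, c * f0 + s * f1]]" for c s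
    unfolding frame_matrix_eq[OF transpose_Lam] frame_matrix_eq[OF sym] L1 L2 B1 B2
      a0_def b0_def c0_def d0_def e0_def f0_def a1_def b1_def c1_def d1_def e1_def f1_def
    by (simp add: vec_eq_5 vector_5 inner_add_right gg)
  have blk: "c * a0 + s * a1 + (c * d0 + s * d1) + (c * f0 + s * f1) = 0"
    "(c * a0 + s * a1) * (c * d0 + s * d1) + (c * a0 + s * a1) * (c * f0 + s * f1) + (c * d0 + s * d1) * (c * f0 + s * f1)
      - (c * b0 + s * b1)^2 - (c * c0 + s * c1)^2 - (c * e0 + s * e1)^2 - ((s * (n * p))^2 + (c * p + s * (\<mu> * p))^2) = - 10 * (c^2 + s^2)"
    "((s * (n * p))^2 + (c * p + s * (\<mu> * p))^2) * (c * d0 + s * d1 + (c * f0 + s * f1))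
      - ((c * a0 + s * a1) * ((c * d0 + s * d1) * (c * f0 + s * f1) - (c * e0 + s * e1)^2)
        - (c * b0 + s * b1)^2 * (c * f0 + s * f1) - (c * c0 + s * c1)^2 * (c * d0 + s * d1)
        + 2 * (c * b0 + s * b1) * (c * c0 + s * c1) * (c * e0 + s * e1)) = 0"
    "((s * (n * p))^2 + (c * p + s * (\<mu> * p))^2) * ((c * e0 + s * e1)^2 - (c * d0 + s * d1) * (c * f0 + s * f1)) = 9 * (c^2 + s^2)^2" for c s
    by (rule isospectral_pencil_block_2_3[OF iso' pat])+
  have "(p^2 * c^2 + (2 * \<mu> * p^2) * (c * s) + (p^2 * (n^2 + \<mu>^2)) * s^2)
     * ((e0^2 - d0 * f0) * c^2 + (2 * e0 * e1 - d0 * f1 - d1 * f0) * (c * s) + (e1^2 - d1 * f1) * s^2) = 9 * (c^2 + s^2)^2" for c s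
    using blk(4)[of s c] by algebra
  note fac = definite_factor_of_square[OF this]
  have mu: "\<mu> = 0" using fac(1) p by simp
  then have n1: "n = 1" using fac(2) p n(1) by (simp add: power2_eq_1_iff)
  define F where "F = p^2"
  have F: "F > 0" using p by (simp add: F_def)
  define K where "K = 9 / F"
  have K: "K > 0" "F * K = 9" using F by (simp_all add: K_def)
  have tr: "a0 = - (d0 + f0)" "a1 = - (d1 + f1)" using blk(1)[of 1 0] blk(1)[of 0 1] by simp_all
  \<comment> \<open>The lower two by two block is split into half its trace \<open>l\<close> and its
    traceless part, with entries \<open>x\<close> and \<open>e\<close>, as
    \<open>kernel_line_scalar\<close> expects.\<close>
  define l0 l1 x0 x1 where "l0 = (d0 + f0) / 2" and "l1 = (d1 + f1) / 2" and "x0 = (d0 - f0) / 2" and "x1 = (d1 - f1) / 2"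
  have df: "c * a0 + s * a1 = - 2 * (c * l0 + s * l1)" "c * d0 + s * d1 = (c * l0 + s * l1) + (c * x0 + s * x1)"
    "c * f0 + s * f1 = (c * l0 + s * l1) - (c * x0 + s * x1)" for c s
    unfolding tr l0_def l1_def x0_def x1_def by (simp_all add: field_simps)
  have N: "(s * (n * p))^2 + (c * p + s * (\<mu> * p))^2 = F * (c^2 + s^2)" for c s
    unfolding mu n1 F_def by algebra
  note blk' = blk[unfolded N, unfolded df]
  have s1: "(c * x0 + s * x1)^2 + (c * e0 + s * e1)^2 = K * (c^2+s^2) + (c * l0 + s * l1)^2" for c s
  proof (cases "c = 0 \<and> s = 0")
    case False
    then have r: "c^2 + s^2 \<noteq> 0" by simp
    have "F * (c^2+s^2) * ((c * x0 + s * x1)^2 + (c * e0 + s * e1)^2 - (c * l0 + s * l1)^2) = F * (c^2+s^2) * (K * (c^2+s^2))"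
      using blk'(4)[of c s] K(2) by algebra
    then have "(c * x0 + s * x1)^2 + (c * e0 + s * e1)^2 - (c * l0 + s * l1)^2 = K * (c^2+s^2)"
      using False F by auto
    then show ?thesis by simp
  qed simp
  have s2: "(c * b0 + s * b1)^2 + (c * c0 + s * c1)^2 = (10 - F - K) * (c^2+s^2) - 4 * (c * l0 + s * l1)^2" for c s
    using blk'(2)[of c s] s1[of c s] by algebra
  have s3: "(c * l0 + s * l1) * ((c * b0 + s * b1)^2 + (c * c0 + s * c1)^2)
      - ((c * x0 + s * x1) * ((c * b0 + s * b1)^2 - (c * c0 + s * c1)^2) + 2 * (c * e0 + s * e1) * (c * b0 + s * b1) * (c * c0 + s * c1))
      = 2 * (c * l0 + s * l1) * (K - F) * (c^2+s^2)" for c s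
    using blk'(3)[of c s] s1[of c s] by algebra
  have fin: "l0 = 0" "l1 = 0" "b0 = 0" "b1 = 0" "c0 = 0" "c1 = 0" "F = 1 \<or> F = 9"
    using kernel_line_scalar[OF F K s1 s2 s3] by simp_all
  have a: "a0 = 0" "a1 = 0" using df(1)[of 1 0] df(1)[of 0 1] fin(1,2) by simp_all
  have Lg3: "Lam *v g3 = p *\<^sub>R g2"
    using ex[of "Lam *v g3"] SL[of g1 g3] SL[of g2 g3] SL[of g4 g3] SL[of g5 g3] a fin(3-6)
    unfolding a0_def b0_def c0_def by (simp add: L1 L2 gg)
  have Bg3: "B *v g3 = p *\<^sub>R g1"
    using ex[of "B *v g3"] SB[of g1 g3] SB[of g2 g3] SB[of g4 g3] SB[of g5 g3] a fin(3-6)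
    unfolding a1_def b1_def c1_def by (simp add: B1 B2 gg mu n1)
  have hg: "h = g2" "Lam *v h = p *\<^sub>R g3" using Lh by (simp_all add: g2_def n1)
  have "Lam *v (Lam *v h) = F *\<^sub>R h" "B *v (Lam *v h) = F *\<^sub>R axis 3 1"
    unfolding hg(2) matrix_vector_mult_scaleR Lg3 Bg3 by (simp_all add: hg(1) g1_def F_def power2_eq_square)
  then show ?thesis using fin(7) e mu n(2) n1 by auto
qed

section \<open>The classification\<close>

lemma conj_fixing_L0_from_entries:
  fixes L M :: "real^5^5"
  defines "B \<equiv> sqrt 3 *\<^sub>R L"
  assumes sym: "transpose B = B" and diag: "B$1$1 = 0" "B$2$2 = 0" "B$3$3 = 0" "B$4$4 = 0" "B$5$5 = 0"
    and s: "s1^2 = 1" "s2^2 = 1" "s3^2 = 1" "s4^2 = 1" "s5^2 = (1::real)"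
    and M: "sqrt 3 *\<^sub>R M = vector [vector [0, s1 * s2 * B$1$2, s1 * s3 * B$1$3, s1 * s4 * B$1$4, s1 * s5 * B$1$5],
      vector [s1 * s2 * B$1$2, 0, s2 * s3 * B$2$3, s2 * s4 * B$2$4, s2 * s5 * B$2$5],
      vector [s1 * s3 * B$1$3, s2 * s3 * B$2$3, 0, s3 * s4 * B$3$4, s3 * s5 * B$3$5],
      vector [s1 * s4 * B$1$4, s2 * s4 * B$2$4, s3 * s4 * B$3$4, 0, s4 * s5 * B$4$5],
      vector [s1 * s5 * B$1$5, s2 * s5 * B$2$5, s3 * s5 * B$3$5, s4 * s5 * B$4$5, 0]]"
  shows "conj_fixing_L0 L M"
proof -
  define v :: "real^5" where "v = vector [s1, s2, s3, s4, s5]"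
  have v: "v$1 = s1" "v$2 = s2" "v$3 = s3" "v$4 = s4" "v$5 = s5" by (simp_all add: v_def vector_5)
  have B: "B$2$1 = B$1$2" "B$3$1 = B$1$3" "B$4$1 = B$1$4" "B$5$1 = B$1$5" "B$3$2 = B$2$3"
    "B$4$2 = B$2$4" "B$5$2 = B$2$5" "B$4$3 = B$3$4" "B$5$3 = B$3$5" "B$5$4 = B$4$5"
    by (subst symmetric_5_eq[OF sym], simp add: vector_5)+
  have e: "\<forall>i j. v $ i * B $ i $ j * v $ j = (sqrt 3 *\<^sub>R M) $ i $ j"
    unfolding forall_5 M by (simp add: vector_5 v B diag)
  show ?thesis
  proof (rule conj_fixing_L0_by_signs[where e = "\<lambda>i. v $ i"])
    have "\<forall>i. v $ i * v $ i = 1" unfolding forall_5 v using s by (simp add: power2_eq_square)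
    then show "v $ i * v $ i = 1" for i by blast
    show "v $ i * L $ i $ j * v $ j = M $ i $ j" for i j
      using e[rule_format, of i j] by (simp add: B_def)
  qed
qed

text \<open>The third row and column vanish, so a factor \<open>x\<close> splits off. The
  coefficient of \<open>s^4\<close> is the determinant of the remaining block of \<open>B\<close>;
  the term \<open>0 * x^3\<close> keeps the pattern of \<open>quartic_coeffs\<close>.\<close>

lemma det_block_4:
  fixes a b k d e f c s x :: real
  shows "det (x *\<^sub>R mat 1 - (c *\<^sub>R Lam + s *\<^sub>R (vector [vector [0, a, 0, b, k], vector [a, 0, 0, d, e],
      vector [0, 0, 0, 0, 0], vector [b, d, 0, 0, f], vector [k, e, 0, f, 0]])))
    = x * (x^4 + 0 * x^3 + (- 10 * c^2 - (a^2 + b^2 + k^2 + d^2 + e^2 + f^2) * s^2) * x^2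
      + ((2 * e^2 + 4 * f^2 - 4 * a^2 - 2 * b^2) * (c * s^2) - 2 * (a * b * d + a * k * e + b * k * f + d * e * f) * s^3) * x
      + (9 * c^4 + (- 3 * a^2 + 3 * b^2 + k^2 + 9 * d^2 + 3 * e^2 - 3 * f^2) * (c^2 * s^2)
        + 2 * (- 3 * (a * b * d) - a * k * e + b * k * f + 3 * (d * e * f)) * (c * s^3)
        + ((a * f)^2 + (b * e)^2 + (k * d)^2 - 2 * a * f * b * e - 2 * a * f * k * d - 2 * b * e * k * d) * s^4))"
  by (simp add: det_5 vector_5 mat_def Lam_entries) (simp add: algebra_simps power2_eq_square power3_eq_cube power4_eq_xxxx)

text \<open>Comparing coefficients yields three quadratic relations, two cubic ones and a quartic
  one. Linear recombination turns them into the hypotheses of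
  \<open>isospectral_four_by_four\<close>.\<close>

lemma kernel_constant_case:
  fixes a b k d e f :: real
  assumes "isospectral_pencil Lam (vector [vector [0, a, 0, b, k], vector [a, 0, 0, d, e],
      vector [0, 0, 0, 0, 0], vector [b, d, 0, 0, f], vector [k, e, 0, f, 0]])"
  shows "(a^2 = 1 \<and> b^2 = 4 \<and> k = 0 \<and> d = 0 \<and> e^2 = 4 \<and> f^2 = 1 \<and> a * b * e * f = 4) \<or>
    (a^2 = 3 \<and> b = 0 \<and> k = 0 \<and> d^2 = 4 \<and> e = 0 \<and> f^2 = 3) \<or>
    (a = 0 \<and> b = 0 \<and> k^2 = 9 \<and> d^2 = 1 \<and> e = 0 \<and> f = 0)"
proof -
  note q = quartic_coeffs[OF isospectral_pencilD[OF assms, unfolded det_block_4]]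
  have 1: "a^2 + b^2 + k^2 + d^2 + e^2 + f^2 = 10" using q(2)[of 0 1] by simp
  have "0 * c^3 + 0 * (c^2 * s) + (2 * e^2 + 4 * f^2 - 4 * a^2 - 2 * b^2) * (c * s^2)
    + (- 2 * (a * b * d + a * k * e + b * k * f + d * e * f)) * s^3 = 0" for c s
    using q(3)[of c s] by (simp add: algebra_simps)
  note 2 = cubic_form_coeffs[OF this]
  have "0 * c^4 + 0 * (c^3 * s) + (- 3 * a^2 + 3 * b^2 + k^2 + 9 * d^2 + 3 * e^2 - 3 * f^2 - 18) * (c^2 * s^2)
     + (2 * (- 3 * (a * b * d) - a * k * e + b * k * f + 3 * (d * e * f))) * (c * s^3)
     + ((a * f)^2 + (b * e)^2 + (k * d)^2 - 2 * a * f * b * e - 2 * a * f * k * d - 2 * b * e * k * d - 9) * s^4 = 0" for c s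
    using q(4)[of c s] by (simp add: algebra_simps power2_eq_square power4_eq_xxxx power3_eq_cube)
  note 3 = quartic_form_coeffs[OF this]
  show ?thesis
  proof (rule isospectral_four_by_four)
    show "6 * a^2 + 3 * b^2 + 2 * k^2 = 18" "-2 * a^2 + 2 * d^2 + e^2 = 2" "2 * f^2 - b^2 - 2 * d^2 = -2"
      using 1 2(3) 3(3) by simp_all
    show "3 * a * b * d + 2 * a * k * e + b * k * f = 0" "-2 * a * b * d - a * k * e + d * e * f = 0"
      using 2(4) 3(4) by simp_all
    show "(a * f)^2 + (b * e)^2 + (k * d)^2 - 2 * a * f * b * e - 2 * a * f * k * d - 2 * b * e * k * d = 9"
      using 3(5) by simp
  qed
qed

lemma sqrt_3_M1:
  "sqrt 3 *\<^sub>R M1 = vector [vector [0, 5/3, 0, 2/3, 0], vector [5/3, 0, 4/3, 0, 2/3],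
    vector [0, 4/3, 0, 4/3, 0], vector [2/3, 0, 4/3, 0, 5/3], vector [0, 2/3, 0, 5/3, 0]]"
  unfolding M_entries by (simp add: vec_eq_5 vector_5)

lemma conj_fixing_L0_classification:
  assumes symL: "transpose L1 = L1" and isoL: "isospectral (family L1)"
  shows "\<exists>M \<in> {M1, M2, M3, M4, M5, M6}. conj_fixing_L0 L1 M"
proof -
  define B where "B = sqrt 3 *\<^sub>R L1"
  have iso: "isospectral_pencil Lam B"
    using isospectral_pencil_if_isospectral[OF isoL] by (simp add: Lam_eq_L0 B_def)
  have sym: "transpose B = B" by (simp add: B_def transpose_scalar symL)
  note diag = diagonal_eq_0[OF iso]
  note B_eq = symmetric_5_eq[OF sym, unfolded diag]
  have low: "B$2$1 = B$1$2" "B$3$1 = B$1$3" "B$4$1 = B$1$4" "B$5$1 = B$1$5" "B$3$2 = B$2$3"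
    "B$4$2 = B$2$4" "B$5$2 = B$2$5" "B$4$3 = B$3$4" "B$5$3 = B$3$5" "B$5$4 = B$4$5"
    by (subst B_eq, simp add: vector_5)+
  have Bv: "(B *v v) $ 1 = B$1$2 * v$2 + B$1$3 * v$3 + B$1$4 * v$4 + B$1$5 * v$5"
    "(B *v v) $ 2 = B$1$2 * v$1 + B$2$3 * v$3 + B$2$4 * v$4 + B$2$5 * v$5"
    "(B *v v) $ 3 = B$1$3 * v$1 + B$2$3 * v$2 + B$3$4 * v$4 + B$3$5 * v$5"
    "(B *v v) $ 4 = B$1$4 * v$1 + B$2$4 * v$2 + B$3$4 * v$3 + B$4$5 * v$5"
    "(B *v v) $ 5 = B$1$5 * v$1 + B$2$5 * v$2 + B$3$5 * v$3 + B$4$5 * v$4" for v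
    unfolding mult_vec_5 low diag by simp_all
  note conj = conj_fixing_L0_from_entries[of L1, folded B_def, OF sym diag]
  define h e g where "h = Lam_pinv (B *v axis 3 1)" and "e = Lam_pinv (B *v h)" and "g = Lam_pinv (B *v e)"
  note kr = krylov_isotropic[OF iso sym, folded h_def, folded e_def, folded g_def]
  have z: "h$3 = 0" "e$3 = 0" "g$3 = 0" by (simp_all add: h_def e_def g_def Lam_pinv_nth)
  have col3: "B$1$3 = 3 * h$1" "B$2$3 = h$2" "B$3$4 = - h$4" "B$3$5 = - 3 * h$5"
    using kr(1) by (simp_all add: vec_eq_5 Bv Lam_mult axis_def)
  have d_iso: "det (x *\<^sub>R mat 1 - B) = x * (x^2 - 1) * (x^2 - 9)" for x
    using isospectral_pencilD[OF iso, of x 0 1] by simp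
  \<comment> \<open>The Krylov space of \<open>h\<close> has dimension 0, 1, or more, which isotropy
    limits to 2. These are the kernel degrees 0, 1 and 2.\<close>
  consider "h = 0" | r where "h \<noteq> 0" "e = r *\<^sub>R h" | "h \<noteq> 0" "\<And>r. e \<noteq> r *\<^sub>R h" by blast
  then show ?thesis
  proof cases
    case 1
    then have c0: "B$1$3 = 0" "B$2$3 = 0" "B$3$4 = 0" "B$3$5 = 0" using col3 by simp_all
    define a b k d l f where "a = B$1$2" and "b = B$1$4" and "k = B$1$5" and "d = B$2$4" and "l = B$2$5" and "f = B$4$5"
    note ab = a_def[symmetric] b_def[symmetric] k_def[symmetric] d_def[symmetric] l_def[symmetric] f_def[symmetric]
    have "B = vector [vector [0, a, 0, b, k], vector [a, 0, 0, d, l],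
      vector [0, 0, 0, 0, 0], vector [b, d, 0, 0, f], vector [k, l, 0, f, 0]]"
      using B_eq unfolding c0 ab .
    from kernel_constant_case[OF iso[unfolded this]]
    consider "a^2 = 1" "b^2 = 4" "k = 0" "d = 0" "l^2 = 4" "f^2 = 1" "a * b * l * f = 4"
      | "a^2 = 3" "b = 0" "k = 0" "d^2 = 4" "l = 0" "f^2 = 3"
      | "a = 0" "b = 0" "k^2 = 9" "d^2 = 1" "l = 0" "f = 0" by blast
    then show ?thesis
    proof cases
      case 1
      have "conj_fixing_L0 L1 M4"
      \<comment> \<open>The nonzero entries form the cycle 1, 2, 5, 4. The signs are fitted along
        three of its edges, and the fourth entry comes out right because
        \<open>a * b * l * f = 4\<close> is positive.\<close>
      proof (rule conj[of 1 a 1 "b / 2" "a * l / 2"])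
        show "(b / 2)^2 = 1" "(a * l / 2)^2 = 1" using 1 by (simp_all add: power_divide power_mult_distrib)
        have m: "a * a = 1" "b * b = 4" "l * l = 4" "a * (a * l * l) = 4" using 1
          by (simp_all add: power2_eq_square mult.assoc flip: mult.assoc[of a a])
        have "b / 2 * (a * l / 2) * f = 1" using 1(7) by (simp add: mult_ac)
        then show "sqrt 3 *\<^sub>R M4 = vector [vector [0, 1 * a * B$1$2, 1 * 1 * B$1$3, 1 * (b / 2) * B$1$4, 1 * (a * l / 2) * B$1$5],
          vector [1 * a * B$1$2, 0, a * 1 * B$2$3, a * (b / 2) * B$2$4, a * (a * l / 2) * B$2$5],
          vector [1 * 1 * B$1$3, a * 1 * B$2$3, 0, 1 * (b / 2) * B$3$4, 1 * (a * l / 2) * B$3$5],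
          vector [1 * (b / 2) * B$1$4, a * (b / 2) * B$2$4, 1 * (b / 2) * B$3$4, 0, b / 2 * (a * l / 2) * B$4$5],
          vector [1 * (a * l / 2) * B$1$5, a * (a * l / 2) * B$2$5, 1 * (a * l / 2) * B$3$5, b / 2 * (a * l / 2) * B$4$5, 0]]"
          unfolding M_entries c0 ab 1(3,4) using m by (simp add: vec_eq_5 vector_5)
      qed (use 1 in simp_all)
      then show ?thesis by blast
    next
      case 2
      define q where "q = sqrt 3"
      have q: "q \<noteq> 0" "q^2 = 3" "q * q = 3" by (simp_all add: q_def)
      have aq: "a * a = 3" "d * d = 4" "f * f = 3" using 2 by (simp_all add: power2_eq_square)
      have "conj_fixing_L0 L1 M5"
      \<comment> \<open>The nonzero entries form the chain 1, 2, 4, 5, so each sign can be chosen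
        from the preceding one without a compatibility condition.\<close>
      proof (rule conj[of 1 "a / q" 1 "a / q * (d / 2)" "a / q * (d / 2) * (f / q)"])
        show "(a / q)^2 = 1" "(a / q * (d / 2))^2 = 1" "(a / q * (d / 2) * (f / q))^2 = 1"
          using 2 q by (simp_all add: power_divide power_mult_distrib)
        have m: "a / q * a = q" "f / q * f = q" using aq q by (simp_all add: field_simps)
        have aa: "a / q * (a / q) = 1" "d / 2 * d = 2" "d / 2 * (d / 2) = 1" using aq q by (simp_all add: field_simps)
        have n: "a / q * (a / q * (d / 2)) * d = 2" "a / q * (d / 2) * (a / q * (d / 2) * (f / q)) * f = q"
        proof -
          have "a / q * (a / q * (d / 2)) * d = (a / q * (a / q)) * (d / 2 * d)" by (simp only: mult_ac)
          then show "a / q * (a / q * (d / 2)) * d = 2" unfolding aa by simp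
          have "a / q * (d / 2) * (a / q * (d / 2) * (f / q)) * f = (a / q * (a / q)) * (d / 2 * (d / 2)) * (f / q * f)"
            by (simp only: mult_ac)
          then show "a / q * (d / 2) * (a / q * (d / 2) * (f / q)) * f = q" unfolding aa m by simp
        qed
        show "sqrt 3 *\<^sub>R M5 = vector [vector [0, 1 * (a / q) * B$1$2, 1 * 1 * B$1$3, 1 * (a / q * (d / 2)) * B$1$4, 1 * (a / q * (d / 2) * (f / q)) * B$1$5],
          vector [1 * (a / q) * B$1$2, 0, a / q * 1 * B$2$3, a / q * (a / q * (d / 2)) * B$2$4, a / q * (a / q * (d / 2) * (f / q)) * B$2$5],
          vector [1 * 1 * B$1$3, a / q * 1 * B$2$3, 0, 1 * (a / q * (d / 2)) * B$3$4, 1 * (a / q * (d / 2) * (f / q)) * B$3$5],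
          vector [1 * (a / q * (d / 2)) * B$1$4, a / q * (a / q * (d / 2)) * B$2$4, 1 * (a / q * (d / 2)) * B$3$4, 0, a / q * (d / 2) * (a / q * (d / 2) * (f / q)) * B$4$5],
          vector [1 * (a / q * (d / 2) * (f / q)) * B$1$5, a / q * (a / q * (d / 2) * (f / q)) * B$2$5, 1 * (a / q * (d / 2) * (f / q)) * B$3$5, a / q * (d / 2) * (a / q * (d / 2) * (f / q)) * B$4$5, 0]]"
          unfolding q_def[symmetric] M_entries(5)[folded q_def] c0 ab 2(2,3,5) n mult_1 m(1) by (simp only: mult_1_right mult_zero_right mult_1)
      qed simp_all
      then show ?thesis by blast
    next
      case 3
      have "conj_fixing_L0 L1 M6"
        by (rule conj[of 1 1 1 d "k / 3"])
          (use 3 in \<open>simp_all add: power_divide M_entries c0 ab power2_eq_square\<close>)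
      then show ?thesis by blast
    qed
  next
    case (2 r)
    have Bh: "B *v h = r *\<^sub>R (Lam *v h)" unfolding kr(2)[symmetric] 2(2) by (simp add: matrix_vector_mult_scaleR)
    obtain F where F: "F = 1 \<or> F = 9" and LL: "Lam *v (Lam *v h) = F *\<^sub>R h" and B0: "B *v h = 0"
      and BL: "B *v (Lam *v h) = F *\<^sub>R axis 3 1" and h1: "h \<bullet> h = 1"
      using kernel_line_case[OF iso sym kr(1) Bh z(1) kr(4) 2(1)] by blast
    have hh: "h$1 * h$1 + h$2 * h$2 + h$4 * h$4 + h$5 * h$5 = 1"
      "3 * (h$1 * h$1) + h$2 * h$2 - h$4 * h$4 - 3 * (h$5 * h$5) = 0"
      using h1 kr(4) unfolding inner_5 Lam_mult z by simp_all
    from F show ?thesis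
    proof
      assume F: "F = 1"
      \<comment> \<open>The eigenvalue 1 of the square of \<open>Lam\<close> belongs to coordinates
        2 and 4. Unit length and isotropy then give both squares the value 1/2.\<close>
      have h15: "h$1 = 0" "h$5 = 0" using LL unfolding F by (simp_all add: vec_eq_5 Lam_mult)
      have h2: "h$2 * h$2 = 1/2" "h$4 * h$4 = 1/2" using hh unfolding h15 by simp_all
      have nz: "h$2 \<noteq> 0" "h$4 \<noteq> 0" using h2 by auto
      have "B$1$2 * h$2 = 0" "B$1$4 * h$4 = 0" "B$2$4 * h$4 = 0" "B$2$5 * h$2 = 0" "B$4$5 * h$4 = 0"
        using B0 BL unfolding F by (auto simp: vec_eq_5 Bv Lam_mult z h15 axis_def)
      then have b0: "B$1$2 = 0" "B$1$4 = 0" "B$2$4 = 0" "B$2$5 = 0" "B$4$5 = 0" "B$1$3 = 0" "B$3$5 = 0"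
        using nz col3 h15 by simp_all
      \<comment> \<open>Indices 1 and 5 have decoupled. The block on 2, 3, 4 has eigenvalues 0, 1,
        -1, so the eigenvalue 3 of \<open>B\<close> must come from this entry.\<close>
      have b15: "B$1$5 * B$1$5 = 9"
      proof -
        have hx: "h$2 * (h$2 * x) = x / 2" "h$4 * (h$4 * x) = x / 2" for x
          using h2 by (simp_all flip: mult.assoc)
        show ?thesis
          using d_iso[of 3] by (subst (asm) B_eq) (simp add: det_5 mat_def vector_5 b0 col3 algebra_simps hx h2)
      qed
      define q where "q = sqrt 2"
      have q: "q \<noteq> 0" "q * q = 2" by (simp_all add: q_def)
      have "conj_fixing_L0 L1 M2"
      \<comment> \<open>\<open>q * h$2\<close> and \<open>q * h$4\<close> are signs because the
        squares of the entries are 1/2. The minus sign compensates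
        \<open>B$3$4 = - h$4\<close>.\<close>
      proof (rule conj[of 1 "q * h$2" 1 "- q * h$4" "B$1$5 / 3"])
        have m: "q * (h$2 * h$2) = 1 / q" "q * (h$4 * h$4) = 1 / q" unfolding h2 using q by (simp_all add: field_simps)
        have "(q * h$2)^2 = (q * q) * (h$2 * h$2)" "(- q * h$4)^2 = (q * q) * (h$4 * h$4)"
          by (simp_all add: power2_eq_square mult_ac)
        then show "(q * h$2)^2 = 1" "(- q * h$4)^2 = 1" unfolding q h2 by simp_all
        show "(B$1$5 / 3)^2 = 1" using b15 by (simp add: power2_eq_square)
        have m3: "q * h$2 * h$2 = 1 / q" "- q * h$4 * (- h$4) = 1 / q"
          using m by (simp_all add: mult.assoc)
        show "sqrt 3 *\<^sub>R M2 = vector [vector [0, 1 * (q * h$2) * B$1$2, 1 * 1 * B$1$3, 1 * (- q * h$4) * B$1$4, 1 * (B$1$5 / 3) * B$1$5],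
          vector [1 * (q * h$2) * B$1$2, 0, q * h$2 * 1 * B$2$3, q * h$2 * (- q * h$4) * B$2$4, q * h$2 * (B$1$5 / 3) * B$2$5],
          vector [1 * 1 * B$1$3, q * h$2 * 1 * B$2$3, 0, 1 * (- q * h$4) * B$3$4, 1 * (B$1$5 / 3) * B$3$5],
          vector [1 * (- q * h$4) * B$1$4, q * h$2 * (- q * h$4) * B$2$4, 1 * (- q * h$4) * B$3$4, 0, - q * h$4 * (B$1$5 / 3) * B$4$5],
          vector [1 * (B$1$5 / 3) * B$1$5, q * h$2 * (B$1$5 / 3) * B$2$5, 1 * (B$1$5 / 3) * B$3$5, - q * h$4 * (B$1$5 / 3) * B$4$5, 0]]"
          unfolding M_entries b0 col3(2,3) q_def[symmetric] mult_1 mult_1_right m3 by (simp add: b15)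
      qed simp_all
      then show ?thesis by blast
    next
      assume F: "F = 9"
      have h24: "h$2 = 0" "h$4 = 0" using LL unfolding F by (simp_all add: vec_eq_5 Lam_mult)
      have h1: "h$1 * h$1 = 1/2" "h$5 * h$5 = 1/2" using hh unfolding h24 by simp_all
      have nz: "h$1 \<noteq> 0" "h$5 \<noteq> 0" using h1 by auto
      have "B$1$2 * h$1 = 0" "B$1$4 * h$1 = 0" "B$1$5 * h$5 = 0" "B$2$5 * h$5 = 0" "B$4$5 * h$5 = 0"
        using B0 BL unfolding F by (auto simp: vec_eq_5 Bv Lam_mult z h24 axis_def)
      then have b0: "B$1$2 = 0" "B$1$4 = 0" "B$1$5 = 0" "B$2$5 = 0" "B$4$5 = 0" "B$2$3 = 0" "B$3$4 = 0"
        using nz col3 h24 by simp_all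
      have b24: "B$2$4 * B$2$4 = 1"
      proof -
        have hx: "h$1 * (h$1 * x) = x / 2" "h$5 * (h$5 * x) = x / 2" for x
          using h1 by (simp_all flip: mult.assoc)
        show ?thesis
          using d_iso[of 1] by (subst (asm) B_eq) (simp add: det_5 mat_def vector_5 b0 col3 algebra_simps hx h1)
      qed
      define q where "q = sqrt 2"
      have q: "q \<noteq> 0" "q * q = 2" by (simp_all add: q_def)
      have "conj_fixing_L0 L1 M3"
      proof (rule conj[of "q * h$1" 1 1 "B$2$4" "- q * h$5"])
        have m: "q * (h$1 * h$1) = 1 / q" "q * (h$5 * h$5) = 1 / q" unfolding h1 using q by (simp_all add: field_simps)
        have "(q * h$1)^2 = (q * q) * (h$1 * h$1)" "(- q * h$5)^2 = (q * q) * (h$5 * h$5)"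
          by (simp_all add: power2_eq_square mult_ac)
        then show "(q * h$1)^2 = 1" "(- q * h$5)^2 = 1" unfolding q h1 by simp_all
        show "(B$2$4)^2 = 1" using b24 by (simp add: power2_eq_square)
        have m3: "q * h$1 * (3 * h$1) = 3 / q" "- q * h$5 * (- 3 * h$5) = 3 / q"
          using m by simp_all
        show "sqrt 3 *\<^sub>R M3 = vector [vector [0, q * h$1 * 1 * B$1$2, q * h$1 * 1 * B$1$3, q * h$1 * B$2$4 * B$1$4, q * h$1 * (- q * h$5) * B$1$5],
          vector [q * h$1 * 1 * B$1$2, 0, 1 * 1 * B$2$3, 1 * B$2$4 * B$2$4, 1 * (- q * h$5) * B$2$5],
          vector [q * h$1 * 1 * B$1$3, 1 * 1 * B$2$3, 0, 1 * B$2$4 * B$3$4, 1 * (- q * h$5) * B$3$5],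
          vector [q * h$1 * B$2$4 * B$1$4, 1 * B$2$4 * B$2$4, 1 * B$2$4 * B$3$4, 0, B$2$4 * (- q * h$5) * B$4$5],
          vector [q * h$1 * (- q * h$5) * B$1$5, 1 * (- q * h$5) * B$2$5, 1 * (- q * h$5) * B$3$5, B$2$4 * (- q * h$5) * B$4$5, 0]]"
          unfolding M_entries b0 col3(1,4) q_def[symmetric] mult_1 mult_1_right m3 b24 by simp
      qed simp_all
      then show ?thesis by blast
    qed
  next
    case 3
    note kc = kernel_conic_case[OF iso sym kr(1-3) z kr(4-7) 3]
    have h15: "h$1 = 0" "h$5 = 0" using kc(1) by (simp_all add: vec_eq_5 Lam_mult)
    have e24: "e$2 = 0" "e$4 = 0" using kc(2) by (simp_all add: vec_eq_5 Lam_mult)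
    have h2: "h$2 * h$2 = 16/9" "h$4 * h$4 = 16/9" using kc(5) kr(4) by (simp_all add: inner_5 Lam_mult h15 z)
    have e1: "e$1 * e$1 = 16/81" "e$5 * e$5 = 16/81" using kc(6) kr(6) by (simp_all add: inner_5 Lam_mult e24 z)
    have nz: "h$2 \<noteq> 0" "h$4 \<noteq> 0" "e$1 \<noteq> 0" "e$5 \<noteq> 0" using h2 e1 by auto
    \<comment> \<open>\<open>B h = Lam e\<close> gives sums, and \<open>B (Lam h)\<close> gives
      differences because \<open>Lam h\<close> has entries \<open>h$2\<close> and
      \<open>- h$4\<close>; together they isolate the single entries of \<open>B\<close>.\<close>
    have "B$1$2 * h$2 + B$1$4 * h$4 = 3 * e$1" "B$2$4 * h$4 = 0" "B$2$5 * h$2 + B$4$5 * h$4 = - 3 * e$5"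
      using kr(2) by (simp_all add: vec_eq_5 Bv Lam_mult z h15 e24)
    moreover have "B$1$2 * h$2 - B$1$4 * h$4 = 7 * e$1" "B$2$5 * h$2 - B$4$5 * h$4 = 7 * e$5"
      using kc(3) by (simp_all add: vec_eq_5 Bv Lam_mult z h15 e24 axis_def)
    moreover have "(B *v (Lam *v e)) $ 1 = h $ 1" unfolding kc(4) ..
    then have "B$1$5 * e$5 = 0" unfolding Bv Lam_mult e24 z h15 by simp
    ultimately have b: "B$1$2 * h$2 = 5 * e$1" "B$1$4 * h$4 = - 2 * e$1" "B$2$4 * h$4 = 0" "B$2$5 * h$2 = 2 * e$5"
      "B$4$5 * h$4 = - 5 * e$5" "B$1$5 * e$5 = 0"
      by linarith+
    have b0: "B$2$4 = 0" "B$1$5 = 0" "B$1$3 = 0" "B$3$5 = 0" using b nz col3 h15 by simp_all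
    \<comment> \<open>Here \<open>h$2\<close>, \<open>h$4\<close> have modulus 4/3 and
      \<open>e$1\<close>, \<open>e$5\<close> have modulus 4/9, so these multiples are signs.\<close>
    define s1 s2 s4 s5 where "s1 = 9 / 4 * e$1" and "s2 = 3 / 4 * h$2" and "s4 = - 3 / 4 * h$4" and "s5 = 9 / 4 * e$5"
    have s: "s1 * s1 = 1" "s2 * s2 = 1" "s4 * s4 = 1" "s5 * s5 = 1"
      using h2 e1 by (simp_all add: s1_def s2_def s4_def s5_def)
    have "s1 * s2 * B$1$2 = 3 / 4 * (9 / 4) * e$1 * (B$1$2 * h$2)" "s1 * s4 * B$1$4 = - 3 / 4 * (9 / 4) * e$1 * (B$1$4 * h$4)"
      "s2 * s5 * B$2$5 = 3 / 4 * (9 / 4) * e$5 * (B$2$5 * h$2)" "s4 * s5 * B$4$5 = - 3 / 4 * (9 / 4) * e$5 * (B$4$5 * h$4)"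
      by (simp_all add: s1_def s2_def s4_def s5_def)
    then have m: "s1 * s2 * B$1$2 = 5/3" "s1 * s4 * B$1$4 = 2/3" "s2 * s5 * B$2$5 = 2/3" "s4 * s5 * B$4$5 = 5/3"
      using e1 unfolding b by simp_all
    have m': "s2 * h$2 = 4/3" "s4 * h$4 = - 4/3" using h2 by (simp_all add: s2_def s4_def)
    have "conj_fixing_L0 L1 M1"
      by (rule conj[of s1 s2 1 s4 s5]) (simp_all add: power2_eq_square s sqrt_3_M1 m m' b0 col3(2,3))
    then show ?thesis by blast
  qed
qed

theorem theorem1p14:
  fixes L1 :: "real^5^5"
  shows "((\<forall>t. transpose (family L1 t) = family L1 t) \<and> isospectral (family L1) \<longrightarrow>
            (\<exists>M \<in> {M1, M2, M3, M4, M5, M6}. conj_fixing_L0 L1 M)) \<and>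
         (conj_fixing_L0 L1 M1 \<longrightarrow> dim (kernel_span (family L1)) = 3) \<and>
         (conj_fixing_L0 L1 M2 \<longrightarrow> dim (kernel_span (family L1)) = 2) \<and>
         (conj_fixing_L0 L1 M3 \<longrightarrow> dim (kernel_span (family L1)) = 2) \<and>
         (conj_fixing_L0 L1 M4 \<longrightarrow> dim (kernel_span (family L1)) = 1) \<and>
         (conj_fixing_L0 L1 M5 \<longrightarrow> dim (kernel_span (family L1)) = 1) \<and>
         (conj_fixing_L0 L1 M6 \<longrightarrow> dim (kernel_span (family L1)) = 1)"
proof (intro conjI impI)
  assume a: "(\<forall>t. transpose (family L1 t) = family L1 t) \<and> isospectral (family L1)"
  then have "transpose (family L1 (pi / 2)) = family L1 (pi / 2)" by blast
  then have "transpose L1 = L1" by (simp add: family_def)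
  then show "\<exists>M \<in> {M1, M2, M3, M4, M5, M6}. conj_fixing_L0 L1 M"
    using a conj_fixing_L0_classification by blast
qed (simp_all only: dim_kernel_span_conj dim_kernel_span_M1 dim_kernel_span_M2 dim_kernel_span_M3
    dim_kernel_span_M4 dim_kernel_span_M5 dim_kernel_span_M6)

end
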